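(* Let $d \ge 2$, $h \ge 1$ be integers, let $R_1, \dots, R_h$ be non-empty families of partitions of $[d]$, let $R_{[h]} = R_1 \wedge \dots \wedge R_h$, and let $c(d)=3^{-2^{d+1}}$. For every non-empty set $R$ of partitions of $[d]$ the following holds. 1. If $R_{[h]} \nprec R$, then for every field $\mathbb{F}$ and every positive integer $n$ there exists an order-$d$ tensor $T:[n]^d \to \mathbb{F}$ whose $R_i$-rank is equal to $1$ for each $i \in [h]$ but whose $R$-rank is at least $n^{c(d)}$. 2. If $R_{[h]} \prec R$, then whenever $k_1, \dots, k_h \ge 1$ are integers there exists some integer $C_{d,(R_1,\dots, R_h)}(k_1,\dots,k_h)$, depending only on $d,R_1,\dots,R_h,k_1,\dots,k_h$, such that for every field $\mathbb{F}$ and all positive integers $n_1,\dots,n_d$, if $T:[n_1]\times\dots\times[n_d]\to\mathbb{F}$ is an order-$d$ tensor with $R_i$-rank at most $k_i$ for each $i \in [h]$, then the $R$-rank of $T$ is at most $C_{d,(R_1,\dots, R_h)}(k_1,\dots,k_h)$.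
   Context: $[m]=\{1,\dots,m\}$; the parts of a partition are non-empty. $\mathbb{F}$ is an arbitrary field. For positive integers $n_1,\dots,n_d$, an order-$d$ tensor is a function $T:[n_1]\times\dots\times[n_d]\to\mathbb{F}$. For $x\in[n_1]\times\dots\times[n_d]$ and $J\subset[d]$, $x(J)\in\prod_{j\in J}[n_j]$ denotes the restriction of $x$ to its coordinates in $J$. $R$-rank: let $R$ be a non-empty family of partitions of $[d]$. An order-$d$ tensor $T$ has $R$-rank at most $1$ if there exist a partition $P\in R$ and, for each $J\in P$, a function $a_J:\prod_{j\in J}[n_j]\to\mathbb{F}$ such that $T(x)=\prod_{J\in P}a_J(x(J))$ for all $x$. The $R$-rank of $T$ is the smallest nonnegative integer $k$ such that $T=T_1+\dots+T_k$ for some order-$d$ tensors $T_1,\dots,T_k$ each of $R$-rank at most $1$ (the partition used may differ from one $T_i$ to another; the zero tensor has $R$-rank $0$). Finer: for partitions $P_1,P_2$ of $[d]$, $P_2\prec P_1$ ($P_2$ is finer than $P_1$) if for every $J_2\in P_2$ there is $J_1\in P_1$ with $J_2\subset J_1$. For non-empty families $R_1,R_2$ of partitions of $[d]$, $R_2\prec R_1$ if for every $P_2\in R_2$ there exists $P_1\in R_1$ with $P_2\prec P_1$; $R_2\nprec R_1$ means that this fails. Least common refinement: for partitions $P_1,\dots,P_h$ of $[d]$, $P_1\wedge\dots\wedge P_h=\{J_1\cap\dots\cap J_h: J_1\in P_1,\dots,J_h\in P_h, J_1\cap\dots\cap J_h\neq\emptyset\}$. For non-empty families $R_1,\dots,R_h$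 of partitions of $[d]$, $R_1\wedge\dots\wedge R_h=\{P_1\wedge\dots\wedge P_h: P_1\in R_1,\dots,P_h\in R_h\}$. *)

theory Defs
  imports Complex_Main "HOL-Library.FuncSet" "HOL-Library.Disjoint_Sets" "HOL-Algebra.Ring"
begin

(* The product of the sets {1..n j} over j in J; the points indexing a tensor are grid {1..d} n. *)
definition grid :: "nat set \<Rightarrow> (nat \<Rightarrow> nat) \<Rightarrow> (nat \<Rightarrow> nat) set" where
  "grid J n = (\<Pi>\<^sub>E j\<in>J. {1..n j})"

(* Values of a tensor outside the grid are irrelevant: tensors are only ever compared on the grid. *)
definition tensors :: "'a ring \<Rightarrow> nat \<Rightarrow> (nat \<Rightarrow> nat) \<Rightarrow> ((nat \<Rightarrow> nat) \<Rightarrow> 'a) set" where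
  "tensors F d n = (grid {1..d} n \<rightarrow> carrier F)"

definition partition_family :: "nat \<Rightarrow> nat set set set \<Rightarrow> bool" where
  "partition_family d R \<longleftrightarrow> R \<noteq> {} \<and> (\<forall>P\<in>R. partition_on {1..d} P)"

definition rank_le_one ::
  "'a ring \<Rightarrow> nat \<Rightarrow> (nat \<Rightarrow> nat) \<Rightarrow> nat set set set \<Rightarrow> ((nat \<Rightarrow> nat) \<Rightarrow> 'a) \<Rightarrow> bool" where
  "rank_le_one F d n R T \<longleftrightarrow>
     (\<exists>P\<in>R. \<exists>a :: nat set \<Rightarrow> (nat \<Rightarrow> nat) \<Rightarrow> 'a.
        (\<forall>J\<in>P. a J \<in> grid J n \<rightarrow> carrier F) \<and>
        (\<forall>x\<in>grid {1..d} n. T x = (\<Otimes>\<^bsub>F\<^esub>J\<in>P. a J (restrict x J))))"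

definition tensor_rank ::
  "'a ring \<Rightarrow> nat \<Rightarrow> (nat \<Rightarrow> nat) \<Rightarrow> nat set set set \<Rightarrow> ((nat \<Rightarrow> nat) \<Rightarrow> 'a) \<Rightarrow> nat" where
  "tensor_rank F d n R T =
     (LEAST k. \<exists>S :: nat \<Rightarrow> (nat \<Rightarrow> nat) \<Rightarrow> 'a.
        (\<forall>i\<in>{1..k}. S i \<in> tensors F d n \<and> rank_le_one F d n R (S i)) \<and>
        (\<forall>x\<in>grid {1..d} n. T x = (\<Oplus>\<^bsub>F\<^esub>i\<in>{1..k}. S i x)))"

definition family_finer :: "nat \<Rightarrow> nat set set set \<Rightarrow> nat set set set \<Rightarrow> bool" where
  "family_finer d R2 R1 \<longleftrightarrow> (\<forall>P2\<in>R2. \<exists>P1\<in>R1. refines {1..d} P2 P1)"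

(* common_refinement takes the set of the P i rather than the indexed family; a repeated partition
   changes nothing, since two distinct parts of it have empty intersection. *)
definition family_meet :: "nat \<Rightarrow> (nat \<Rightarrow> nat set set set) \<Rightarrow> nat set set set" where
  "family_meet h Rs = {common_refinement (P ` {1..h}) | P. \<forall>i\<in>{1..h}. P i \<in> Rs i}"

definition rank_exponent :: "nat \<Rightarrow> real" where
  "rank_exponent d = 3 powr (- (2 ^ (d + 1)))"

(* The constant C(k_1,...,k_h), as a function of d, R_1,...,R_h and k_1,...,k_h alone. HOL cannot
   quantify over types below an existential quantifier, so "there is C such that for every field"
   needs a C that is a constant whose type does not mention the type of the field elements. The one
   below is the least integer that works for all fields with carrier a set of natural numbers, that
   is, up to isomorphism, for all countable fields. If no such integer exists then the value is
   unspecified, so claiming that rank_bound is a bound includes the existence claim. Conversely, an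
   integer that works for all countable fields works for all fields: given T, pass to the countable
   subfield generated by the entries of T and of its decompositions witnessing the R_i-ranks; ranks
   do not increase on returning to the larger field. *)
definition rank_bound ::
  "nat \<Rightarrow> nat \<Rightarrow> (nat \<Rightarrow> nat set set set) \<Rightarrow> (nat \<Rightarrow> nat) \<Rightarrow> nat" where
  "rank_bound d h Rs k =
     (LEAST C. \<forall>R (F :: nat ring) n T.
        partition_family d R \<longrightarrow> family_finer d (family_meet h Rs) R \<longrightarrow>
        field F \<longrightarrow> (\<forall>j\<in>{1..d}. 1 \<le> n j) \<longrightarrow> T \<in> tensors F d n \<longrightarrow>
        (\<forall>i\<in>{1..h}. tensor_rank F d n (Rs i) T \<le> k i) \<longrightarrow>
        tensor_rank F d n R T \<le> C)"

end

theory Submission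
  imports Defs "HOL-Algebra.Weak_Morphisms" "HOL-Algebra.Ring_Divisibility"
    "HOL-Algebra.Subrings" "HOL-Library.Countable_Set"
begin

text \<open>
  Part 1. Let P be a partition in the meet that refines no partition in R, and let T be the product
  over the parts of P of identity tensors. In a short decomposition of T every summand is a product
  a b where the sets of coordinates of a and b cut some part of P. Restrict the part of index c to an
  interval whose length grows rapidly with c, and take the part of largest index. Contracting one of
  its coordinates j against a function g kills all summands in which a or b meets this part in j only,
  if g satisfies some linear conditions, and there are few of them because the other directions are
  short; so g can be chosen nonzero at most points and what remains is again such a tensor. Once
  the part has a single coordinate left, fix it, and pass to the next part. In the end no summand is left.

  Part 2. If no bound exists, choose counterexamples over fields F m and pass to a quotient K of
  the product of the F m by a maximal ideal. The limit T of the tensors is a function on an infinite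
  box, and lies in W R i for each i, where W R is the span of all products along partitions in
  the set R of partitions, which we take to be closed under refinement. Two facts finish the proof: W R meets W R' in
  the span of the partitions common to R and R'; and if a function induced by a sequence of functions over the F m
  lies in W R, then it is a sum of products of functions of this kind. Both follow from a statement
  on leading terms: a sum of products along P that is also a combination of products cutting a part of P is
  a combination of products along strictly finer partitions. For the proof, let I be a
  part of P and apply, in the coordinates of I, a linear functional that vanishes on all
  decomposable functions of these coordinates; this kills all products that cut I. In the infinite
  setting such functionals exist, and no quantitative notion of rank is needed.
\<close>

section \<open>Spans of functions and separating functionals\<close>

text \<open>Over a finite box every function of at least two coordinates is a combination of
  decomposable ones, so a span that does not count terms says nothing about a single tensor. On an
  infinite box spans become meaningful, and the number of terms of one finite combination there is
  the bound that serves infinitely many members of the sequence. It is not computed.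

  A sequence of counterexamples needs fields on one type. Hence the constant is first obtained for
  fields on natural numbers; a tensor over any field is moved to a countable subfield that contains
  its entries and the factors of its decompositions.

  In Part 1 the interval of a colour must have more points than there are linear conditions. These
  number at most k times the product of the lengths for smaller colours, so lengths (k+1)^((d+1)^c)
  suffice, and rank k forces m < (k+1)^((d+1)^(d-1)). For k \<ge> 2 the right side is at most
  k^(2(d+1)^(d-1)), with exponent at most 3^(2^(d+1)). Rank 1 is excluded separately when m >
  1.\<close>

context field
begin

definition scalar_funs :: "('x \<Rightarrow> 'a) set" where
  "scalar_funs = {f. \<forall>x. f x \<in> carrier R}"

definition fun_subspace :: "('x \<Rightarrow> 'a) set \<Rightarrow> bool" where
  "fun_subspace V \<longleftrightarrow> V \<subseteq> scalar_funs \<and> (\<lambda>_. \<zero>) \<in> V \<and>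
     (\<forall>c\<in>carrier R. \<forall>f\<in>V. \<forall>g\<in>V. (\<lambda>x. c \<otimes> f x \<oplus> g x) \<in> V)"

text \<open>The linear span. Induction over this set adds one scaled generator at a time, so that
  membership proofs need no finite index sets.\<close>

inductive_set lspan :: "('x \<Rightarrow> 'a) set \<Rightarrow> ('x \<Rightarrow> 'a) set" for B where
  zero: "(\<lambda>_. \<zero>) \<in> lspan B"
| step: "c \<in> carrier R \<Longrightarrow> f \<in> B \<Longrightarrow> g \<in> lspan B \<Longrightarrow> (\<lambda>x. c \<otimes> f x \<oplus> g x) \<in> lspan B"

definition linear_functional :: "(('x \<Rightarrow> 'a) \<Rightarrow> 'a) \<Rightarrow> bool" where
  "linear_functional G \<longleftrightarrow> (\<forall>f\<in>scalar_funs. G f \<in> carrier R) \<and>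
     (\<forall>c\<in>carrier R. \<forall>f\<in>scalar_funs. \<forall>g\<in>scalar_funs. G (\<lambda>x. c \<otimes> f x \<oplus> g x) = c \<otimes> G f \<oplus> G g)"

lemma scalar_funsD: "f \<in> scalar_funs \<Longrightarrow> f x \<in> carrier R"
  by (simp add: scalar_funs_def)

lemma fun_subspaceI:
  assumes "V \<subseteq> scalar_funs" "(\<lambda>_. \<zero>) \<in> V"
    "\<And>c f g. c \<in> carrier R \<Longrightarrow> f \<in> V \<Longrightarrow> g \<in> V \<Longrightarrow> (\<lambda>x. c \<otimes> f x \<oplus> g x) \<in> V"
  shows "fun_subspace V"
  using assms by (simp add: fun_subspace_def)

lemma fun_subspace_scalar: "fun_subspace V \<Longrightarrow> f \<in> V \<Longrightarrow> f x \<in> carrier R"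
  by (auto simp: fun_subspace_def scalar_funs_def)

lemma fun_subspace_lin:
  "fun_subspace V \<Longrightarrow> c \<in> carrier R \<Longrightarrow> f \<in> V \<Longrightarrow> g \<in> V \<Longrightarrow> (\<lambda>x. c \<otimes> f x \<oplus> g x) \<in> V"
  by (simp add: fun_subspace_def)

lemma fun_subspace_zero: "fun_subspace V \<Longrightarrow> (\<lambda>_. \<zero>) \<in> V"
  by (simp add: fun_subspace_def)

lemma fun_subspace_add:
  assumes "fun_subspace V" "f \<in> V" "g \<in> V"
  shows "(\<lambda>x. f x \<oplus> g x) \<in> V"
  using fun_subspace_lin[OF assms(1) one_closed assms(2,3)] assms
  by (simp add: fun_subspace_scalar[OF assms(1)])

lemma fun_subspace_smult:
  assumes "fun_subspace V" "c \<in> carrier R" "f \<in> V"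
  shows "(\<lambda>x. c \<otimes> f x) \<in> V"
  using fun_subspace_lin[OF assms fun_subspace_zero[OF assms(1)]] assms
  by (simp add: fun_subspace_scalar[OF assms(1)])

lemma fun_subspace_diff:
  assumes "fun_subspace V" "f \<in> V" "g \<in> V"
  shows "(\<lambda>x. f x \<ominus> g x) \<in> V"
proof -
  have "(\<lambda>x. \<ominus> \<one> \<otimes> g x \<oplus> f x) \<in> V"
    using fun_subspace_lin[OF assms(1) _ assms(3,2)] by simp
  moreover have "(\<lambda>x. \<ominus> \<one> \<otimes> g x \<oplus> f x) = (\<lambda>x. f x \<ominus> g x)"
    using assms by (auto simp: fun_eq_iff fun_subspace_scalar[OF assms(1)] l_minus a_minus_def a_comm)
  ultimately show ?thesis by simp
qed

lemma fun_subspace_inter: "fun_subspace V \<Longrightarrow> fun_subspace W \<Longrightarrow> fun_subspace (V \<inter> W)"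
  by (auto simp: fun_subspace_def)

lemma lspan_scalar: "f \<in> lspan B \<Longrightarrow> B \<subseteq> scalar_funs \<Longrightarrow> f \<in> scalar_funs"
  by (induction rule: lspan.induct) (auto simp: scalar_funs_def)

lemma lspan_least: "fun_subspace V \<Longrightarrow> B \<subseteq> V \<Longrightarrow> lspan B \<subseteq> V"
proof
  fix f assume "fun_subspace V" "B \<subseteq> V" "f \<in> lspan B"
  from this(3,1,2) show "f \<in> V"
    by (induction rule: lspan.induct) (auto simp: fun_subspace_zero fun_subspace_lin)
qed

lemma lspan_superset:
  assumes "B \<subseteq> scalar_funs" shows "B \<subseteq> lspan B"
proof
  fix f assume f: "f \<in> B"
  have "(\<lambda>x. \<one> \<otimes> f x \<oplus> (\<lambda>_. \<zero>) x) \<in> lspan B"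
    by (rule lspan.step[OF _ f lspan.zero]) simp
  then show "f \<in> lspan B" using f assms by (simp add: scalar_funs_def subset_iff)
qed

lemma fun_subspace_lspan:
  assumes B: "B \<subseteq> scalar_funs" shows "fun_subspace (lspan B)"
proof (rule fun_subspaceI)
  show "lspan B \<subseteq> scalar_funs" using lspan_scalar B by blast
  show "(\<lambda>_. \<zero>) \<in> lspan B" by (rule lspan.zero)
  fix c f g assume c: "c \<in> carrier R" and f: "f \<in> lspan B" and g: "g \<in> lspan B"
  from f show "(\<lambda>x. c \<otimes> f x \<oplus> g x) \<in> lspan B"
  proof (induction rule: lspan.induct)
    case zero
    then show ?case using g c lspan_scalar[OF g B] by (simp add: scalar_funsD)
  next
    case (step e k h)
    have car: "k x \<in> carrier R" "h x \<in> carrier R" "g x \<in> carrier R" for x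
      using step B lspan_scalar g by (auto simp: scalar_funs_def)
    have "(\<lambda>x. (c \<otimes> e) \<otimes> k x \<oplus> (c \<otimes> h x \<oplus> g x)) \<in> lspan B"
      using step c by (intro lspan.step[of "c \<otimes> e" k B "\<lambda>x. c \<otimes> h x \<oplus> g x"]) auto
    moreover have "(\<lambda>x. (c \<otimes> e) \<otimes> k x \<oplus> (c \<otimes> h x \<oplus> g x)) = (\<lambda>x. c \<otimes> (e \<otimes> k x \<oplus> h x) \<oplus> g x)"
      using car c step(1) by (auto simp: fun_eq_iff r_distr m_assoc a_assoc)
    ultimately show ?case by simp
  qed
qed

lemma lspan_mono: 
  assumes "A \<subseteq> B" shows "lspan A \<subseteq> lspan B"
proof
  fix f assume "f \<in> lspan A"
  then show "f \<in> lspan B"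
    by (induction rule: lspan.induct) (use assms in \<open>auto intro: lspan.intros\<close>)
qed

lemma lspan_Un_split:
  assumes "f \<in> lspan (A \<union> B)" "A \<subseteq> scalar_funs" "B \<subseteq> scalar_funs"
  shows "\<exists>g\<in>lspan A. \<exists>h\<in>lspan B. f = (\<lambda>x. g x \<oplus> h x)"
  using assms(1)
proof (induction rule: lspan.induct)
  case zero
  show ?case by (intro bexI[of _ "\<lambda>_. \<zero>"]) (auto intro: lspan.zero)
next
  case (step c k f)
  then obtain g h where gh: "g \<in> lspan A" "h \<in> lspan B" "f = (\<lambda>x. g x \<oplus> h x)" by blast
  have car: "g x \<in> carrier R" "h x \<in> carrier R" "k x \<in> carrier R" for x
    using gh lspan_scalar assms step(2) by (auto simp: scalar_funs_def)
  show ?case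
  proof (cases "k \<in> A")
    case True
    have "(\<lambda>x. c \<otimes> k x \<oplus> f x) = (\<lambda>x. (\<lambda>x. c \<otimes> k x \<oplus> g x) x \<oplus> h x)"
      using car step(1) gh(3) by (simp add: a_assoc)
    moreover have "(\<lambda>x. c \<otimes> k x \<oplus> g x) \<in> lspan A" using step True gh by (intro lspan.step) auto
    ultimately show ?thesis
      using gh(2) by (intro bexI[of _ "\<lambda>x. c \<otimes> k x \<oplus> g x"] bexI[of _ h]) auto
  next
    case False
    then have "k \<in> B" using step by auto
    then have "(\<lambda>x. c \<otimes> k x \<oplus> h x) \<in> lspan B" using step gh by (intro lspan.step) auto
    moreover have "(\<lambda>x. c \<otimes> k x \<oplus> f x) = (\<lambda>x. g x \<oplus> (\<lambda>x. c \<otimes> k x \<oplus> h x) x)"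
      using car step(1) gh(3) by (auto simp: fun_eq_iff a_ac)
    ultimately show ?thesis
      using gh(1) by (intro bexI[of _ g] bexI[of _ "\<lambda>x. c \<otimes> k x \<oplus> h x"]) auto
  qed
qed

lemma fun_subspace_mult_preimage:
  assumes "fun_subspace V" "u \<in> scalar_funs"
  shows "fun_subspace {f \<in> scalar_funs. (\<lambda>x. f x \<otimes> u x) \<in> V}"
proof (rule fun_subspaceI)
  show "(\<lambda>_. \<zero>) \<in> {f \<in> scalar_funs. (\<lambda>x. f x \<otimes> u x) \<in> V}"
    using assms by (simp add: scalar_funs_def fun_subspace_zero)
  fix c f g assume c: "c \<in> carrier R" and f: "f \<in> {f \<in> scalar_funs. (\<lambda>x. f x \<otimes> u x) \<in> V}"
    and g: "g \<in> {f \<in> scalar_funs. (\<lambda>x. f x \<otimes> u x) \<in> V}"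
  have "(\<lambda>x. c \<otimes> (f x \<otimes> u x) \<oplus> (g x \<otimes> u x)) \<in> V"
    using c f g by (intro fun_subspace_lin[OF assms(1)]) auto
  moreover have "(\<lambda>x. c \<otimes> (f x \<otimes> u x) \<oplus> (g x \<otimes> u x)) = (\<lambda>x. (c \<otimes> f x \<oplus> g x) \<otimes> u x)"
    using c f g assms(2) by (auto simp: fun_eq_iff scalar_funs_def l_distr m_assoc)
  ultimately show "(\<lambda>x. c \<otimes> f x \<oplus> g x) \<in> {f \<in> scalar_funs. (\<lambda>x. f x \<otimes> u x) \<in> V}"
    using c f g by (auto simp: scalar_funs_def)
qed auto

text \<open>By bilinearity generators suffice. For a fixed second factor the functions whose product
  with it lies in \<open>V\<close> form a subspace, so the claim extends from \<open>A\<close> to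
  \<open>lspan A\<close>; the same argument in the other variable extends it from \<open>B\<close>
  to \<open>lspan B\<close>.\<close>

lemma lspan_mult:
  assumes V: "fun_subspace V" and A: "A \<subseteq> scalar_funs" and B: "B \<subseteq> scalar_funs"
    and AB: "\<And>a b. a \<in> A \<Longrightarrow> b \<in> B \<Longrightarrow> (\<lambda>x. a x \<otimes> b x) \<in> V"
    and f: "f \<in> lspan A" and g: "g \<in> lspan B"
  shows "(\<lambda>x. f x \<otimes> g x) \<in> V"
proof -
  have 1: "lspan A \<subseteq> {f \<in> scalar_funs. (\<lambda>x. f x \<otimes> b x) \<in> V}" if "b \<in> B" for b
    using A B AB that by (intro lspan_least fun_subspace_mult_preimage V) auto
  have "lspan B \<subseteq> {g \<in> scalar_funs. (\<lambda>x. g x \<otimes> f x) \<in> V}"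
  proof (intro lspan_least fun_subspace_mult_preimage V)
    show fs: "f \<in> scalar_funs" using f A lspan_scalar by blast
    show "B \<subseteq> {g \<in> scalar_funs. (\<lambda>x. g x \<otimes> f x) \<in> V}"
    proof
      fix b assume b: "b \<in> B"
      then have "(\<lambda>x. f x \<otimes> b x) \<in> V" using 1 f by blast
      moreover have "(\<lambda>x. f x \<otimes> b x) = (\<lambda>x. b x \<otimes> f x)"
        using b B fs by (auto simp: fun_eq_iff scalar_funs_def m_comm)
      ultimately show "b \<in> {g \<in> scalar_funs. (\<lambda>x. g x \<otimes> f x) \<in> V}" using b B by auto
    qed
  qed
  then have "(\<lambda>x. g x \<otimes> f x) \<in> V" "g \<in> scalar_funs" using g by auto
  moreover have "(\<lambda>x. g x \<otimes> f x) = (\<lambda>x. f x \<otimes> g x)"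
    using \<open>g \<in> scalar_funs\<close> lspan_scalar[OF f A] by (auto simp: fun_eq_iff scalar_funs_def m_comm)
  ultimately show ?thesis by simp
qed

section \<open>Linear functionals that separate a function from a subspace\<close>

lemma linear_functionalD:
  assumes "linear_functional G"
  shows "f \<in> scalar_funs \<Longrightarrow> G f \<in> carrier R"
    "c \<in> carrier R \<Longrightarrow> f \<in> scalar_funs \<Longrightarrow> g \<in> scalar_funs \<Longrightarrow>
      G (\<lambda>x. c \<otimes> f x \<oplus> g x) = c \<otimes> G f \<oplus> G g"
  using assms by (auto simp: linear_functional_def)

lemma linear_functional_zero:
  assumes "linear_functional G" shows "G (\<lambda>_. \<zero>) = \<zero>"
proof -
  have z: "(\<lambda>_. \<zero>) \<in> scalar_funs" by (simp add: scalar_funs_def)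
  have "G (\<lambda>x. \<one> \<otimes> (\<lambda>_. \<zero>) x \<oplus> (\<lambda>_. \<zero>) x) = \<one> \<otimes> G (\<lambda>_. \<zero>) \<oplus> G (\<lambda>_. \<zero>)"
    using linear_functionalD(2)[OF assms one_closed z z] .
  then show ?thesis using linear_functionalD(1)[OF assms z] by simp
qed

lemma linear_functional_smult:
  assumes "linear_functional G" "c \<in> carrier R" "f \<in> scalar_funs"
  shows "G (\<lambda>x. c \<otimes> f x) = c \<otimes> G f"
proof -
  have z: "(\<lambda>_. \<zero>) \<in> scalar_funs" by (simp add: scalar_funs_def)
  have "G (\<lambda>x. c \<otimes> f x \<oplus> (\<lambda>_. \<zero>) x) = c \<otimes> G f \<oplus> G (\<lambda>_. \<zero>)"
    using linear_functionalD(2)[OF assms z] .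
  then show ?thesis
    using assms linear_functionalD(1)[OF assms(1,3)] by (simp add: linear_functional_zero scalar_funsD)
qed

text \<open>By Zorn there is a subspace \<open>H\<close> that is maximal among those containing
  \<open>D\<close> but not \<open>b\<close>. Maximality makes \<open>H\<close> a complement of the
  line through \<open>b\<close>: each f differs from an element of \<open>H\<close> by a unique
  multiple of \<open>b\<close>, and \<open>G f\<close> is the coefficient.\<close>

lemma exists_separating_functional:
  fixes D :: "('x \<Rightarrow> 'a) set"
  assumes D: "fun_subspace D" and b: "b \<in> scalar_funs" "b \<notin> D"
  shows "\<exists>G. linear_functional G \<and> (\<forall>f\<in>D. G f = \<zero>) \<and> G b = \<one>"
proof -
  define \<A> where "\<A> = {H. fun_subspace H \<and> D \<subseteq> H \<and> b \<notin> H}"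
  have "\<exists>M\<in>\<A>. \<forall>X\<in>\<A>. M \<subseteq> X \<longrightarrow> X = M"
  proof (rule subset_Zorn_nonempty)
    show "\<A> \<noteq> {}" using assms by (auto simp: \<A>_def)
    fix \<C> assume ne: "\<C> \<noteq> {}" and ch: "subset.chain \<A> \<C>"
    have "fun_subspace (\<Union>\<C>)"
    proof (rule fun_subspaceI)
      show "\<Union>\<C> \<subseteq> scalar_funs" "(\<lambda>_. \<zero>) \<in> \<Union>\<C>"
        using ch ne by (auto simp: subset.chain_def \<A>_def fun_subspace_def)
      fix c f g assume *: "c \<in> carrier R" "f \<in> \<Union>\<C>" "g \<in> \<Union>\<C>"
      then obtain X Y where "X \<in> \<C>" "Y \<in> \<C>" "f \<in> X" "g \<in> Y" by auto
      moreover have "X \<subseteq> Y \<or> Y \<subseteq> X"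
        using ch \<open>X \<in> \<C>\<close> \<open>Y \<in> \<C>\<close> by (auto simp: subset_chain_def)
      ultimately obtain Z where "Z \<in> \<C>" "f \<in> Z" "g \<in> Z" by blast
      then show "(\<lambda>x. c \<otimes> f x \<oplus> g x) \<in> \<Union>\<C>"
        using ch * fun_subspace_lin[of Z c f g] unfolding subset_chain_def \<A>_def by blast
    qed
    then show "\<Union>\<C> \<in> \<A>" using ch ne unfolding \<A>_def subset.chain_def by blast
  qed
  then obtain H where H: "fun_subspace H" "D \<subseteq> H" "b \<notin> H"
    and max: "\<And>X. fun_subspace X \<Longrightarrow> H \<subseteq> X \<Longrightarrow> b \<notin> X \<Longrightarrow> X = H"
    unfolding \<A>_def by auto
  have Hs: "H \<subseteq> scalar_funs" using H by (simp add: fun_subspace_def)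
  define P where "P f c \<longleftrightarrow> c \<in> carrier R \<and> (\<lambda>x. f x \<ominus> c \<otimes> b x) \<in> H" for f c
  have ex: "\<exists>c. P f c" if f: "f \<in> scalar_funs" for f
  proof (cases "f \<in> H")
    case True
    then have "P f \<zero>" using f b by (auto simp: P_def a_minus_def scalar_funs_def)
    then show ?thesis by blast
  next
    case False
    have "insert f H \<subseteq> scalar_funs" using f Hs by auto
    then have sub: "fun_subspace (lspan (insert f H))" "insert f H \<subseteq> lspan (insert f H)"
      by (rule fun_subspace_lspan, rule lspan_superset)
    \<comment> \<open>Adjoining f to \<open>H\<close> must bring in \<open>b\<close>. Solving b = c
      f + h for f gives the coefficient; c cannot vanish, as \<open>b\<close> is not in
      \<open>H\<close>.\<close>
    have "b \<in> lspan ({f} \<union> H)"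
      using max[OF sub(1)] sub(2) False by auto
    then obtain g h where g: "g \<in> lspan {f}" and h: "h \<in> lspan H" and bgh: "b = (\<lambda>x. g x \<oplus> h x)"
      using lspan_Un_split[of b "{f}" H] f Hs by auto
    have hH: "h \<in> H" using h lspan_least[OF H(1)] by auto
    from g have "\<exists>c\<in>carrier R. g = (\<lambda>x. c \<otimes> f x)"
    proof (induction rule: lspan.induct)
      case zero
      then show ?case using f by (intro bexI[of _ \<zero>]) (auto simp: scalar_funs_def)
    next
      case (step c k g)
      then obtain e where "e \<in> carrier R" "g = (\<lambda>x. e \<otimes> f x)" by auto
      then show ?case using step f
        by (intro bexI[of _ "c \<oplus> e"]) (auto simp: scalar_funs_def l_distr)
    qed
    then obtain c where c: "c \<in> carrier R" "g = (\<lambda>x. c \<otimes> f x)" by auto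
    have c0: "c \<noteq> \<zero>"
    proof
      assume "c = \<zero>"
      then have "b = h" using bgh c f hH Hs by (auto simp: scalar_funs_def fun_eq_iff subset_iff)
      then show False using hH H by auto
    qed
    have ci: "inv c \<in> carrier R" "inv c \<otimes> c = \<one>" using c c0 by (auto simp: field_Units)
    have "(\<lambda>x. (\<ominus> (inv c)) \<otimes> h x) \<in> H" using fun_subspace_smult[OF H(1) _ hH] ci by auto
    moreover have "(\<ominus> (inv c)) \<otimes> h x = f x \<ominus> (inv c) \<otimes> b x" for x
    proof -
      have car: "f x \<in> carrier R" "h x \<in> carrier R" using f hH Hs by (auto simp: scalar_funs_def)
      have "inv c \<otimes> b x = inv c \<otimes> (c \<otimes> f x) \<oplus> inv c \<otimes> h x"
        using bgh c car ci by (simp add: r_distr)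
      also have "inv c \<otimes> (c \<otimes> f x) = f x" using ci c car by (simp add: m_assoc[symmetric])
      finally show ?thesis using ci car
        by (simp add: a_minus_def minus_add l_minus a_assoc[symmetric] r_neg)
    qed
    ultimately have "P f (inv c)" using ci by (simp add: P_def)
    then show ?thesis by blast
  qed
  have uniq: "c = e" if "P f c" "P f e" "f \<in> scalar_funs" for f c e
  proof (rule ccontr)
    assume "c \<noteq> e"
    have ce: "c \<in> carrier R" "e \<in> carrier R" using that by (auto simp: P_def)
    then have nz: "e \<ominus> c \<noteq> \<zero>" using \<open>c \<noteq> e\<close> by (metis a_minus_def minus_equality minus_minus a_inv_closed a_comm)
    have "(\<lambda>x. (f x \<ominus> c \<otimes> b x) \<ominus> (f x \<ominus> e \<otimes> b x)) \<in> H"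
      by (rule fun_subspace_diff[OF H(1)]) (use that in \<open>auto simp: P_def\<close>)
    moreover have "(f x \<ominus> c \<otimes> b x) \<ominus> (f x \<ominus> e \<otimes> b x) = (e \<ominus> c) \<otimes> b x" for x
    proof -
      have "f x \<in> carrier R" "b x \<in> carrier R" using that b by (auto simp: scalar_funs_def)
      then show ?thesis using ce by algebra
    qed
    ultimately have "(\<lambda>x. (e \<ominus> c) \<otimes> b x) \<in> H" by simp
    then have "(\<lambda>x. inv (e \<ominus> c) \<otimes> ((e \<ominus> c) \<otimes> b x)) \<in> H"
      by (rule fun_subspace_smult[OF H(1), rotated]) (use ce nz in \<open>auto simp: field_Units\<close>)
    moreover have "inv (e \<ominus> c) \<otimes> ((e \<ominus> c) \<otimes> b x) = b x" for x
      using ce nz b by (simp add: m_assoc[symmetric] field_Units scalar_funs_def)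
    ultimately show False using H by simp
  qed
  define G where "G f = (THE c. P f c)" for f
  have G: "P f (G f)" if "f \<in> scalar_funs" for f
    unfolding G_def using ex[OF that] uniq that by (metis theI)
  have Geq: "G f = c" if "P f c" "f \<in> scalar_funs" for f c
    using G uniq that by blast
  have "linear_functional G"
    unfolding linear_functional_def
  proof (intro conjI ballI)
    fix f :: "'x \<Rightarrow> 'a" assume "f \<in> scalar_funs" then show "G f \<in> carrier R" using G by (simp add: P_def)
  next
    fix c and f g :: "'x \<Rightarrow> 'a"
    assume c: "c \<in> carrier R" and f: "f \<in> scalar_funs" and g: "g \<in> scalar_funs"
    have Gc: "G f \<in> carrier R" "G g \<in> carrier R" using G f g by (auto simp: P_def)
    have "(\<lambda>x. c \<otimes> (f x \<ominus> G f \<otimes> b x) \<oplus> (g x \<ominus> G g \<otimes> b x)) \<in> H"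
      by (rule fun_subspace_lin[OF H(1)]) (use G f g c in \<open>auto simp: P_def\<close>)
    moreover have "c \<otimes> (f x \<ominus> G f \<otimes> b x) \<oplus> (g x \<ominus> G g \<otimes> b x) = 
      (c \<otimes> f x \<oplus> g x) \<ominus> (c \<otimes> G f \<oplus> G g) \<otimes> b x" for x
    proof -
      have "f x \<in> carrier R" "g x \<in> carrier R" "b x \<in> carrier R"
        using f g b by (auto simp: scalar_funs_def)
      then show ?thesis using c Gc by algebra
    qed
    ultimately have "P (\<lambda>x. c \<otimes> f x \<oplus> g x) (c \<otimes> G f \<oplus> G g)"
      using c Gc by (simp add: P_def)
    then show "G (\<lambda>x. c \<otimes> f x \<oplus> g x) = c \<otimes> G f \<oplus> G g"
      using c f g by (intro Geq) (auto simp: scalar_funs_def)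
  qed
  moreover have "G f = \<zero>" if "f \<in> D" for f
  proof (rule Geq)
    show "f \<in> scalar_funs" using that H Hs by auto
    then show "P f \<zero>" using that H b by (auto simp: P_def a_minus_def scalar_funs_def)
  qed
  moreover have "G b = \<one>"
  proof (rule Geq)
    show "P b \<one>" using b H by (auto simp: P_def a_minus_def scalar_funs_def r_neg fun_subspace_zero)
  qed (rule b)
  ultimately show ?thesis by blast
qed

end

section \<open>Products along partitions\<close>

lemma partition_on_Union_remove:
  assumes "partition_on A P" "I \<in> P" shows "\<Union>(P - {I}) = A - I"
proof -
  have "I \<inter> \<Union>(P - {I}) = {}" using assms unfolding partition_on_def disjoint_def by blast
  moreover have "A = I \<union> \<Union>(P - {I})" using assms unfolding partition_on_def by blast
  ultimately show ?thesis by blast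
qed

lemma partition_on_remove:
  assumes "partition_on A P" "I \<in> P" shows "partition_on (A - I) (P - {I})"
  using assms partition_on_Union_remove[OF assms]
  by (simp add: partition_on_def disjoint_def)

context field
begin

lemma lspan_insertE:
  assumes "f \<in> lspan (insert b B)" "b \<in> scalar_funs" "B \<subseteq> scalar_funs"
  obtains c g where "c \<in> carrier R" "g \<in> lspan B" "f = (\<lambda>x. c \<otimes> b x \<oplus> g x)"
proof -
  have "\<exists>c\<in>carrier R. \<exists>g\<in>lspan B. f = (\<lambda>x. c \<otimes> b x \<oplus> g x)"
    using assms(1)
  proof (induction rule: lspan.induct)
    case zero
    show ?case by (intro bexI[of _ \<zero>] bexI[of _ "\<lambda>_. \<zero>"])
      (use assms in \<open>auto intro: lspan.zero simp: scalar_funs_def\<close>)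
  next
    case (step d k f)
    then obtain c g where cg: "c \<in> carrier R" "g \<in> lspan B" "f = (\<lambda>x. c \<otimes> b x \<oplus> g x)" by auto
    have car: "g x \<in> carrier R" "b x \<in> carrier R" "k x \<in> carrier R" for x
      using cg lspan_scalar assms step(2) by (auto simp: scalar_funs_def)
    show ?case
    proof (cases "k = b")
      case True
      then show ?thesis using step(1) cg car
        by (intro bexI[of _ "d \<oplus> c"] bexI[of _ g]) (auto simp: l_distr a_assoc)
    next
      case False
      then have "(\<lambda>x. d \<otimes> k x \<oplus> g x) \<in> lspan B" using step cg by (intro lspan.step) auto
      then show ?thesis using step(1) cg car
        by (intro bexI[of _ c] bexI[of _ "\<lambda>x. d \<otimes> k x \<oplus> g x"]) (auto simp: fun_eq_iff a_ac)
    qed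
  qed
  then show thesis using that by blast
qed

text \<open>Points are total functions, so functions of different sets of coordinates have one type
  and are multiplied pointwise without restricting their arguments.\<close>

definition coord_funs :: "nat set \<Rightarrow> ((nat \<Rightarrow> 'p) \<Rightarrow> 'a) set" where
  "coord_funs A = {f \<in> scalar_funs. \<forall>x y. (\<forall>j\<in>A. x j = y j) \<longrightarrow> f x = f y}"

definition mult_span :: "('x \<Rightarrow> 'a) set \<Rightarrow> ('x \<Rightarrow> 'a) set \<Rightarrow> ('x \<Rightarrow> 'a) set" where
  "mult_span V U = lspan {\<lambda>x. a x \<otimes> u x | a u. a \<in> V \<and> u \<in> U}"

text \<open>\<open>M J\<close> is the space from which the factor on the part J is taken. Besides
  \<open>coord_funs J\<close> it will be the space of internal functions of these
  coordinates.\<close>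

definition part_prods ::
  "(nat set \<Rightarrow> ((nat \<Rightarrow> 'p) \<Rightarrow> 'a) set) \<Rightarrow> nat set set \<Rightarrow> ((nat \<Rightarrow> 'p) \<Rightarrow> 'a) set" where
  "part_prods M P = {\<lambda>x. \<Otimes>J\<in>P. a J x | a. \<forall>J\<in>P. a J \<in> M J}"

definition prod_span ::
  "(nat set \<Rightarrow> ((nat \<Rightarrow> 'p) \<Rightarrow> 'a) set) \<Rightarrow> nat set set set \<Rightarrow> ((nat \<Rightarrow> 'p) \<Rightarrow> 'a) set" where
  "prod_span M Rs = lspan (\<Union>P\<in>Rs. part_prods M P)"

text \<open>For P = {I} these are the combinations of decomposable functions of the coordinates in
  I. For P = {} there are no generators and the span is zero, which starts the induction in
  \<open>leading_term\<close>.\<close>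

definition cut_span :: "nat set set \<Rightarrow> ((nat \<Rightarrow> 'p) \<Rightarrow> 'a) set" where
  "cut_span P = lspan {\<lambda>x. a x \<otimes> b x | a b. \<exists>A. a \<in> coord_funs A \<and> b \<in> coord_funs (\<Union>P - A) \<and>
     A \<subseteq> \<Union>P \<and> (\<exists>J\<in>P. J \<inter> A \<noteq> {} \<and> J - A \<noteq> {})}"

definition strict_refinements :: "nat set set \<Rightarrow> nat set set set" where
  "strict_refinements P = {Q. refines (\<Union>P) Q P \<and> Q \<noteq> P}"

definition coord_subspaces :: "(nat set \<Rightarrow> ((nat \<Rightarrow> 'p) \<Rightarrow> 'a) set) \<Rightarrow> bool" where
  "coord_subspaces M \<longleftrightarrow> (\<forall>J. fun_subspace (M J) \<and> M J \<subseteq> coord_funs J)"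

text \<open>Contraction in the coordinates of I: the coordinates outside I are kept from y, and G is
  applied to what remains as a function of z.\<close>

definition push :: "(((nat \<Rightarrow> 'p) \<Rightarrow> 'a) \<Rightarrow> 'a) \<Rightarrow> nat set \<Rightarrow> ((nat \<Rightarrow> 'p) \<Rightarrow> 'a) \<Rightarrow> (nat \<Rightarrow> 'p) \<Rightarrow> 'a" where
  "push G I f = (\<lambda>y. G (\<lambda>z. f (override_on y z I)))"

lemma coord_funs_scalar: "f \<in> coord_funs A \<Longrightarrow> f \<in> scalar_funs"
  by (simp add: coord_funs_def)

lemma coord_funs_carrier: "f \<in> coord_funs A \<Longrightarrow> f x \<in> carrier R"
  by (simp add: coord_funs_def scalar_funs_def)

lemma coord_funsD: "f \<in> coord_funs A \<Longrightarrow> (\<And>j. j \<in> A \<Longrightarrow> x j = y j) \<Longrightarrow> f x = f y"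
  by (simp add: coord_funs_def)

lemma coord_funsI:
  "(\<And>x. f x \<in> carrier R) \<Longrightarrow> (\<And>x y. (\<And>j. j \<in> A \<Longrightarrow> x j = y j) \<Longrightarrow> f x = f y) \<Longrightarrow> f \<in> coord_funs A"
  unfolding coord_funs_def scalar_funs_def by blast

lemma coord_funs_subset: "coord_funs A \<subseteq> scalar_funs"
  by (auto simp: coord_funs_def)

lemma coord_funs_mono: "A \<subseteq> B \<Longrightarrow> coord_funs A \<subseteq> coord_funs B"
  by (auto simp: coord_funs_def subset_iff)

lemma fun_subspace_coord_funs: "fun_subspace (coord_funs A :: ((nat \<Rightarrow> 'p) \<Rightarrow> 'a) set)"
proof (rule fun_subspaceI)
  fix c and f g :: "(nat \<Rightarrow> 'p) \<Rightarrow> 'a"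
  assume "c \<in> carrier R" and f: "f \<in> coord_funs A" and g: "g \<in> coord_funs A"
  then show "(\<lambda>x. c \<otimes> f x \<oplus> g x) \<in> coord_funs A"
    by (intro coord_funsI) (auto simp: coord_funs_carrier intro: arg_cong2[OF coord_funsD[OF f] coord_funsD[OF g]])
qed (auto simp: coord_funs_def scalar_funs_def)

lemma coord_subspaces_coord_funs: "coord_subspaces coord_funs"
  by (simp add: coord_subspaces_def fun_subspace_coord_funs)

lemma coord_subspacesD: "coord_subspaces M \<Longrightarrow> f \<in> M J \<Longrightarrow> f \<in> coord_funs J"
  "coord_subspaces M \<Longrightarrow> fun_subspace (M J)"
  by (auto simp: coord_subspaces_def)

lemma coord_funs_mult:
  assumes f: "f \<in> coord_funs A" and g: "g \<in> coord_funs B"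
  shows "(\<lambda>x. f x \<otimes> g x) \<in> coord_funs (A \<union> B)"
  using assms by (intro coord_funsI)
    (auto simp: coord_funs_carrier intro: arg_cong2[OF coord_funsD[OF f] coord_funsD[OF g]])

lemma coord_funs_finprod:
  fixes a :: "nat set \<Rightarrow> (nat \<Rightarrow> 'p) \<Rightarrow> 'a"
  assumes "\<And>J. J \<in> P \<Longrightarrow> a J \<in> coord_funs J"
  shows "(\<lambda>x. \<Otimes>J\<in>P. a J x) \<in> coord_funs (\<Union>P)"
proof (rule coord_funsI)
  show "(\<Otimes>J\<in>P. a J x) \<in> carrier R" for x :: "nat \<Rightarrow> 'p"
    using assms coord_funs_carrier by (intro finprod_closed) blast
  fix x y :: "nat \<Rightarrow> 'p" assume "\<And>j. j \<in> \<Union>P \<Longrightarrow> x j = y j"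
  then show "(\<Otimes>J\<in>P. a J x) = (\<Otimes>J\<in>P. a J y)"
    using assms by (intro finprod_cong') (auto intro!: coord_funsD[of _ _ x y] intro: coord_funs_carrier)
qed

lemma part_prods_coord_funs:
  assumes "coord_subspaces M" shows "part_prods M P \<subseteq> coord_funs (\<Union>P)"
  using assms coord_subspacesD(1) by (auto simp: part_prods_def intro!: coord_funs_finprod)

lemma part_prods_scalar:
  assumes "coord_subspaces M" shows "(\<Union>P\<in>Rs. part_prods M P) \<subseteq> scalar_funs"
  using part_prods_coord_funs[OF assms] coord_funs_scalar by blast

lemma fun_subspace_prod_span: "coord_subspaces M \<Longrightarrow> fun_subspace (prod_span M Rs)"
  unfolding prod_span_def by (intro fun_subspace_lspan part_prods_scalar)

lemma part_prods_subset_span: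
  "coord_subspaces M \<Longrightarrow> P \<in> Rs \<Longrightarrow> part_prods M P \<subseteq> prod_span M Rs"
  unfolding prod_span_def using lspan_superset[OF part_prods_scalar, of M Rs] by blast

lemma prod_span_mono: "Rs \<subseteq> Rs' \<Longrightarrow> prod_span M Rs \<subseteq> prod_span M Rs'"
  unfolding prod_span_def by (intro lspan_mono) auto

lemma prod_span_coord_funs:
  assumes "coord_subspaces M" "\<And>Q. Q \<in> Rs \<Longrightarrow> \<Union>Q \<subseteq> A"
  shows "prod_span M Rs \<subseteq> coord_funs A"
  unfolding prod_span_def
  using part_prods_coord_funs[OF assms(1)] coord_funs_mono[OF assms(2)]
  by (intro lspan_least fun_subspace_coord_funs) blast

lemma mult_gens_scalar:
  assumes "V \<subseteq> scalar_funs" "U \<subseteq> scalar_funs"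
  shows "{\<lambda>x. a x \<otimes> u x | a u. a \<in> V \<and> u \<in> U} \<subseteq> scalar_funs"
  using assms by (auto simp: scalar_funs_def)

lemma fun_subspace_mult_span: "V \<subseteq> scalar_funs \<Longrightarrow> U \<subseteq> scalar_funs \<Longrightarrow> fun_subspace (mult_span V U)"
  unfolding mult_span_def by (intro fun_subspace_lspan mult_gens_scalar)

lemma mult_spanI:
  assumes "V \<subseteq> scalar_funs" "U \<subseteq> scalar_funs" "a \<in> V" "u \<in> U"
  shows "(\<lambda>x. a x \<otimes> u x) \<in> mult_span V U"
  unfolding mult_span_def using lspan_superset[OF mult_gens_scalar[OF assms(1,2)]] assms(3,4) by blast

lemma mult_span_least:
  assumes "fun_subspace W" "\<And>a u. a \<in> V \<Longrightarrow> u \<in> U \<Longrightarrow> (\<lambda>x. a x \<otimes> u x) \<in> W"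
  shows "mult_span V U \<subseteq> W"
  unfolding mult_span_def using assms by (intro lspan_least) auto

lemma cut_gens_scalar:
  "{\<lambda>x. a x \<otimes> b x | a b. \<exists>A. a \<in> coord_funs A \<and> b \<in> coord_funs (\<Union>P - A) \<and>
     A \<subseteq> \<Union>P \<and> (\<exists>J\<in>P. J \<inter> A \<noteq> {} \<and> J - A \<noteq> {})} \<subseteq> (coord_funs (\<Union>P) :: ((nat \<Rightarrow> 'p) \<Rightarrow> 'a) set)"
proof clarify
  fix a b :: "(nat \<Rightarrow> 'p) \<Rightarrow> 'a" and A assume *: "a \<in> coord_funs A" "b \<in> coord_funs (\<Union>P - A)" "A \<subseteq> \<Union>P"
  then have "A \<union> (\<Union>P - A) = \<Union>P" by blast
  then show "(\<lambda>x. a x \<otimes> b x) \<in> coord_funs (\<Union>P)" using coord_funs_mult[OF *(1,2)] by simp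
qed

lemma fun_subspace_cut_span: "fun_subspace (cut_span P)"
  unfolding cut_span_def
  by (rule fun_subspace_lspan, rule subset_trans[OF cut_gens_scalar coord_funs_subset])

lemma cut_span_coord_funs: "cut_span P \<subseteq> coord_funs (\<Union>P)"
  unfolding cut_span_def by (rule lspan_least[OF fun_subspace_coord_funs cut_gens_scalar])

lemma cut_spanI:
  assumes "a \<in> coord_funs A" "b \<in> coord_funs (\<Union>P - A)" "A \<subseteq> \<Union>P" "J \<in> P" "J \<inter> A \<noteq> {}" "J - A \<noteq> {}"
  shows "(\<lambda>x. a x \<otimes> b x) \<in> cut_span P"
proof -
  have "(\<lambda>x. a x \<otimes> b x) \<in> {\<lambda>x. a x \<otimes> b x | a b. \<exists>A. a \<in> coord_funs A \<and> b \<in> coord_funs (\<Union>P - A) \<and>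
     A \<subseteq> \<Union>P \<and> (\<exists>J\<in>P. J \<inter> A \<noteq> {} \<and> J - A \<noteq> {})}" using assms by blast
  then show ?thesis unfolding cut_span_def
    using lspan_superset[OF subset_trans[OF cut_gens_scalar coord_funs_subset]] by blast
qed

lemma cut_span_least:
  assumes "fun_subspace W"
    "\<And>a b A J. a \<in> coord_funs A \<Longrightarrow> b \<in> coord_funs (\<Union>P - A) \<Longrightarrow> A \<subseteq> \<Union>P \<Longrightarrow> J \<in> P \<Longrightarrow>
      J \<inter> A \<noteq> {} \<Longrightarrow> J - A \<noteq> {} \<Longrightarrow> (\<lambda>x. a x \<otimes> b x) \<in> W"
  shows "cut_span P \<subseteq> W"
  unfolding cut_span_def using assms by (intro lspan_least) blast+

lemma part_prods_removeE:
  assumes "f \<in> part_prods M P" "coord_subspaces M" "finite P" "I \<in> P"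
  obtains a u where "a \<in> M I" "u \<in> part_prods M (P - {I})" "f = (\<lambda>x. a x \<otimes> u x)"
proof -
  obtain a where a: "\<forall>J\<in>P. a J \<in> M J" "f = (\<lambda>x. \<Otimes>J\<in>P. a J x)"
    using assms(1) by (auto simp: part_prods_def)
  have car: "a J x \<in> carrier R" if "J \<in> P" for J x
    using a that assms(2) by (meson coord_funs_carrier coord_subspacesD(1))
  have "(\<Otimes>J\<in>P. a J x) = a I x \<otimes> (\<Otimes>J\<in>P - {I}. a J x)" for x
    using finprod_insert[of "P - {I}" I "\<lambda>J. a J x"] assms(3,4) car by (auto simp: insert_absorb)
  then show thesis using a assms(4) by (intro that[of "a I" "\<lambda>x. \<Otimes>J\<in>P - {I}. a J x"]) (auto simp: part_prods_def)
qed

lemma part_prods_insertI: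
  assumes "a \<in> M I" "u \<in> part_prods M P" "coord_subspaces M" "finite P" "I \<notin> P"
  shows "(\<lambda>x. a x \<otimes> u x) \<in> part_prods M (insert I P)"
proof -
  obtain b where b: "\<forall>J\<in>P. b J \<in> M J" "u = (\<lambda>x. \<Otimes>J\<in>P. b J x)"
    using assms(2) by (auto simp: part_prods_def)
  have car: "b J x \<in> carrier R" if "J \<in> P" for J x
    using b that assms(3) by (meson coord_funs_carrier coord_subspacesD(1))
  have ca: "a x \<in> carrier R" for x using assms(1,3) by (meson coord_funs_carrier coord_subspacesD(1))
  have "(\<lambda>x. a x \<otimes> u x) = (\<lambda>x. \<Otimes>J\<in>insert I P. (b(I := a)) J x)"
  proof
    fix x
    have "(\<Otimes>J\<in>P. (b(I := a)) J x) = (\<Otimes>J\<in>P. b J x)"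
      using car assms(5) by (intro finprod_cong') auto
    then show "a x \<otimes> u x = (\<Otimes>J\<in>insert I P. (b(I := a)) J x)"
      using assms(4,5) car ca b(2) by (subst finprod_insert) auto
  qed
  then show ?thesis using b assms(1) by (auto simp: part_prods_def intro!: exI[of _ "b(I := a)"])
qed

text \<open>This writes products along P as products of two functions, the form in which
  \<open>elimination_step\<close> treats a single part.\<close>

lemma prod_span_remove:
  assumes M: "coord_subspaces M" and "finite P" "I \<in> P"
  shows "prod_span M {P} = mult_span (M I) (prod_span M {P - {I}})"
proof
  have sc: "M I \<subseteq> scalar_funs" "prod_span M {P - {I}} \<subseteq> scalar_funs"
    using coord_subspacesD[OF M] coord_funs_scalar fun_subspace_prod_span[OF M, of "{P - {I}}"]
    by (auto simp: fun_subspace_def)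
  show "prod_span M {P} \<subseteq> mult_span (M I) (prod_span M {P - {I}})"
    unfolding prod_span_def[of M "{P}"]
  proof (rule lspan_least[OF fun_subspace_mult_span[OF sc]], rule subsetI)
    fix f assume "f \<in> (\<Union>P\<in>{P}. part_prods M P)"
    then obtain a u where au: "a \<in> M I" "u \<in> part_prods M (P - {I})" "f = (\<lambda>x. a x \<otimes> u x)"
      using part_prods_removeE[OF _ M assms(2,3)] by blast
    show "f \<in> mult_span (M I) (prod_span M {P - {I}})"
      unfolding au(3) using au(1,2) part_prods_subset_span[OF M, of "P - {I}" "{P - {I}}"]
      by (intro mult_spanI[OF sc]) auto
  qed
  show "mult_span (M I) (prod_span M {P - {I}}) \<subseteq> prod_span M {P}"
  proof (rule mult_span_least[OF fun_subspace_prod_span[OF M]])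
    fix a u assume a: "a \<in> M I" and u: "u \<in> prod_span M {P - {I}}"
    show "(\<lambda>x. a x \<otimes> u x) \<in> prod_span M {P}"
    proof (rule lspan_mult[OF fun_subspace_prod_span[OF M] sc(1) part_prods_scalar[OF M]])
      show "a \<in> lspan (M I)" using a lspan_superset[OF sc(1)] by blast
      show "u \<in> lspan (\<Union>Q\<in>{P - {I}}. part_prods M Q)" using u by (simp add: prod_span_def)
      fix a b assume "a \<in> M I" "b \<in> (\<Union>Q\<in>{P - {I}}. part_prods M Q)"
      then have "(\<lambda>x. a x \<otimes> b x) \<in> part_prods M (insert I (P - {I}))"
        using assms by (intro part_prods_insertI) auto
      then show "(\<lambda>x. a x \<otimes> b x) \<in> prod_span M {P}"
        using part_prods_subset_span[OF M, of P "{P}"] assms(3) by (auto simp: insert_absorb)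
    qed
  qed
qed

text \<open>If P does not refine Q, some part of P lies in no part of Q. A part of Q that meets it
  then cuts it, and the factor on that part of Q is separated from the product of all the
  others.\<close>

lemma part_prods_cut_span:
  assumes P: "partition_on (\<Union>P) P" and Q: "partition_on (\<Union>P) Q" and fin: "finite (\<Union>P)"
    and nref: "\<not> refines (\<Union>P) P Q"
  shows "part_prods coord_funs Q \<subseteq> cut_span P"
proof
  fix f :: "(nat \<Rightarrow> 'p) \<Rightarrow> 'a" assume f: "f \<in> part_prods coord_funs Q"
  obtain J where J: "J \<in> P" "\<And>Y. Y \<in> Q \<Longrightarrow> \<not> J \<subseteq> Y"
    using nref P Q by (auto simp: refines_def)
  have "J \<noteq> {}" using P J by (auto simp: partition_on_def)
  then obtain j where j: "j \<in> J" by auto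
  then obtain A where A: "A \<in> Q" "j \<in> A"
    using Q J(1) unfolding partition_on_def by blast
  obtain a u where au: "a \<in> coord_funs A" "u \<in> part_prods coord_funs (Q - {A})" "f = (\<lambda>x. a x \<otimes> u x)"
    using part_prods_removeE[OF f coord_subspaces_coord_funs finite_elements[OF fin Q] A(1)] .
  have "\<Union>(Q - {A}) \<subseteq> \<Union>P - A"
    using partition_on_Union_remove[OF Q A(1)] by simp
  then have "u \<in> coord_funs (\<Union>P - A)"
    using au(2) part_prods_coord_funs[OF coord_subspaces_coord_funs, of "Q - {A}"] coord_funs_mono by blast
  then show "f \<in> cut_span P"
    unfolding au(3) using J(2) j A Q
    by (intro cut_spanI[OF au(1) _ _ J(1)]) (blast, auto simp: partition_on_def)
qed

lemma prod_span_cut_span: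
  assumes "partition_on (\<Union>P) P" "finite (\<Union>P)"
    and "\<And>Q. Q \<in> Rs \<Longrightarrow> partition_on (\<Union>P) Q \<and> \<not> refines (\<Union>P) P Q"
  shows "prod_span coord_funs Rs \<subseteq> cut_span P"
  unfolding prod_span_def
  using part_prods_cut_span[OF assms(1) _ assms(2)] assms(3)
  by (intro lspan_least fun_subspace_cut_span) blast

text \<open>Refinement is antisymmetric, so P does not refine a strict refinement of itself.\<close>

lemma strict_cut_span:
  assumes "partition_on (\<Union>P) P" "finite (\<Union>P)"
  shows "prod_span coord_funs (strict_refinements P) \<subseteq> cut_span P"
proof (rule prod_span_cut_span[OF assms])
  fix Q assume "Q \<in> strict_refinements P"
  then show "partition_on (\<Union>P) Q \<and> \<not> refines (\<Union>P) P Q"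
    using refines_asym[of "\<Union>P" P Q] by (auto simp: strict_refinements_def refines_def[of _ Q P])
qed

section \<open>Contraction of the coordinates of a part by a functional\<close>

lemma override_scalar: "f \<in> scalar_funs \<Longrightarrow> (\<lambda>z. f (override_on y z I)) \<in> scalar_funs"
  by (simp add: scalar_funs_def)

lemma override_coord_funs:
  fixes f :: "(nat \<Rightarrow> 'p) \<Rightarrow> 'a"
  assumes f: "f \<in> coord_funs A"
  shows "(\<lambda>z. f (override_on y z I)) \<in> coord_funs (A \<inter> I)"
proof (rule coord_funsI)
  fix z w :: "nat \<Rightarrow> 'p" assume "\<And>j. j \<in> A \<inter> I \<Longrightarrow> z j = w j"
  then show "f (override_on y z I) = f (override_on y w I)"
    by (intro coord_funsD[OF f]) (simp add: override_on_def)
qed (use f coord_funs_carrier in blast)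

lemma push_coord_funs:
  fixes f :: "(nat \<Rightarrow> 'p) \<Rightarrow> 'a"
  assumes "linear_functional G" "f \<in> coord_funs A"
  shows "push G I f \<in> coord_funs (A - I)"
proof (rule coord_funsI)
  show "push G I f y \<in> carrier R" for y :: "nat \<Rightarrow> 'p"
    unfolding push_def
    by (rule linear_functionalD(1)[OF assms(1) override_scalar[OF coord_funs_scalar[OF assms(2)]]])
  fix x y :: "nat \<Rightarrow> 'p" assume xy: "\<And>j. j \<in> A - I \<Longrightarrow> x j = y j"
  have "(\<lambda>z. f (override_on x z I)) = (\<lambda>z. f (override_on y z I))"
    using xy by (intro ext coord_funsD[OF assms(2)]) (auto simp: override_on_def)
  then show "push G I f x = push G I f y" by (simp add: push_def)
qed

lemma push_lin:
  assumes "linear_functional G" "c \<in> carrier R" "f \<in> scalar_funs" "g \<in> scalar_funs"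
  shows "push G I (\<lambda>x. c \<otimes> f x \<oplus> g x) = (\<lambda>y. c \<otimes> push G I f y \<oplus> push G I g y)"
  unfolding push_def
  by (rule ext, rule linear_functionalD(2)[OF assms(1,2) override_scalar[OF assms(3)] override_scalar[OF assms(4)]])

lemma push_diff:
  assumes G: "linear_functional G" and f: "f \<in> scalar_funs" and g: "g \<in> scalar_funs"
  shows "push G I (\<lambda>x. f x \<ominus> g x) = (\<lambda>y. push G I f y \<ominus> push G I g y)"
proof -
  have *: "(\<lambda>x. f x \<ominus> g x) = (\<lambda>x. (\<ominus> \<one>) \<otimes> g x \<oplus> f x)"
    using f g by (auto simp: fun_eq_iff scalar_funs_def a_minus_def l_minus a_comm)
  have c: "push G I f y \<in> carrier R" "push G I g y \<in> carrier R" for y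
    unfolding push_def by (rule linear_functionalD(1)[OF G override_scalar[OF f]],
      rule linear_functionalD(1)[OF G override_scalar[OF g]])
  show ?thesis unfolding * using push_lin[OF G _ g f, of "\<ominus> \<one>"] c
    by (auto simp: fun_eq_iff a_minus_def l_minus a_comm)
qed

text \<open>Let A be the set of coordinates of the factor a. If A cuts I, every slice of a b in the
  coordinates of I is decomposable and is killed by \<open>G\<close>. Otherwise one of the two
  factors does not depend on I and comes out of \<open>G\<close>, while the cut part J differs from
  I and survives in P - {I}.\<close>

lemma push_cut_span:
  fixes f :: "(nat \<Rightarrow> 'p) \<Rightarrow> 'a"
  assumes G: "linear_functional G" and kill: "\<And>f. f \<in> cut_span {I} \<Longrightarrow> G f = \<zero>"
    and P: "partition_on (\<Union>P) P" and I: "I \<in> P" and f: "f \<in> cut_span P"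
  shows "push G I f \<in> cut_span (P - {I})"
proof -
  have un: "\<Union>(P - {I}) = \<Union>P - I" by (rule partition_on_Union_remove[OF P I])
  have disj: "J \<inter> I = {}" if "J \<in> P" "J \<noteq> I" for J using that P I by (auto simp: partition_on_def disjoint_def)
  let ?V = "{f \<in> scalar_funs. push G I f \<in> cut_span (P - {I})}"
  have "cut_span P \<subseteq> ?V"
  proof (rule cut_span_least)
    show "fun_subspace ?V"
    proof (rule fun_subspaceI)
      have "push G I (\<lambda>_. \<zero>) = (\<lambda>_. \<zero>)"
        using linear_functional_zero[OF G] by (simp add: push_def)
      then show "(\<lambda>_. \<zero>) \<in> ?V" by (simp add: scalar_funs_def fun_subspace_zero fun_subspace_cut_span)
      fix c and f g :: "(nat \<Rightarrow> 'p) \<Rightarrow> 'a"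
      assume "c \<in> carrier R" "f \<in> ?V" "g \<in> ?V"
      then show "(\<lambda>x. c \<otimes> f x \<oplus> g x) \<in> ?V"
        by (auto simp: push_lin[OF G] intro!: fun_subspace_lin[OF fun_subspace_cut_span])
          (auto simp: scalar_funs_def)
    qed auto
    fix a b :: "(nat \<Rightarrow> 'p) \<Rightarrow> 'a" and A J
    assume a: "a \<in> coord_funs A" and b: "b \<in> coord_funs (\<Union>P - A)" and A: "A \<subseteq> \<Union>P"
      and J: "J \<in> P" "J \<inter> A \<noteq> {}" "J - A \<noteq> {}"
    have ac: "a x \<in> carrier R" and bc: "b x \<in> carrier R" for x using a b coord_funs_carrier by auto
    have "push G I (\<lambda>x. a x \<otimes> b x) \<in> cut_span (P - {I})"
    proof (cases "I \<inter> A = {} \<or> I \<subseteq> A")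
      case False
      have "G (\<lambda>z. a (override_on y z I) \<otimes> b (override_on y z I)) = \<zero>" for y
      proof (rule kill, rule cut_spanI[where J = I and A = "A \<inter> I"])
        show "(\<lambda>z. a (override_on y z I)) \<in> coord_funs (A \<inter> I)" by (rule override_coord_funs[OF a])
        have "(\<Union>P - A) \<inter> I \<subseteq> \<Union>{I} - A \<inter> I" by auto
        then show "(\<lambda>z. b (override_on y z I)) \<in> coord_funs (\<Union>{I} - A \<inter> I)"
          using override_coord_funs[OF b, of y I] coord_funs_mono by blast
      qed (use False in auto)
      then have "push G I (\<lambda>x. a x \<otimes> b x) = (\<lambda>_. \<zero>)" by (simp add: push_def)
      then show ?thesis by (simp add: fun_subspace_zero fun_subspace_cut_span)
    next
      case True
      then have JI: "J \<noteq> I" using J by auto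
      then have JP: "J \<in> P - {I}" "J \<inter> I = {}" using J disj by auto
      show ?thesis
      proof (cases "I \<subseteq> A")
        case True
        have "b (override_on y z I) = b y" for y z
          using True by (intro coord_funsD[OF b]) (auto simp: override_on_def)
        then have "push G I (\<lambda>x. a x \<otimes> b x) = (\<lambda>y. push G I a y \<otimes> b y)"
          using linear_functional_smult[OF G bc override_scalar[OF coord_funs_scalar[OF a]]]
            linear_functionalD(1)[OF G override_scalar[OF coord_funs_scalar[OF a]]] ac bc
          by (simp add: push_def m_comm)
        moreover have "(\<lambda>y. push G I a y \<otimes> b y) \<in> cut_span (P - {I})"
        proof (rule cut_spanI[OF push_coord_funs[OF G a] _ _ JP(1)])
          have "\<Union>(P - {I}) - (A - I) = \<Union>P - A" using True un by auto
          then show "b \<in> coord_funs (\<Union>(P - {I}) - (A - I))" using b by simp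
        qed (use J JP A un in auto)
        ultimately show ?thesis by simp
      next
        case False
        then have IA: "I \<inter> A = {}" using \<open>I \<inter> A = {} \<or> I \<subseteq> A\<close> by simp
        have "a (override_on y z I) = a y" for y z
          using IA by (intro coord_funsD[OF a]) (auto simp: override_on_def)
        then have "push G I (\<lambda>x. a x \<otimes> b x) = (\<lambda>y. a y \<otimes> push G I b y)"
          using linear_functional_smult[OF G ac override_scalar[OF coord_funs_scalar[OF b]]]
          by (simp add: push_def)
        moreover have "(\<lambda>y. a y \<otimes> push G I b y) \<in> cut_span (P - {I})"
        proof (rule cut_spanI[OF a _ _ JP(1)])
          have "\<Union>P - A - I = \<Union>(P - {I}) - A" using un by auto
          then show "push G I b \<in> coord_funs (\<Union>(P - {I}) - A)" using push_coord_funs[OF G b, of I] by simp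
        qed (use J JP A un IA in auto)
        ultimately show ?thesis by simp
      qed
    qed
    then show "(\<lambda>x. a x \<otimes> b x) \<in> ?V" using ac bc by (simp add: scalar_funs_def)
  qed
  then show ?thesis using f by auto
qed

end

section \<open>Refinements of partitions\<close>

lemma partition_on_insertI:
  assumes "partition_on (A - p) P" "p \<subseteq> A" "p \<noteq> {}"
  shows "partition_on A (insert p P)"
  using assms partition_onD1[OF assms(1)] by (subst partition_on_insert) (auto simp: disjnt_def)

lemma insert_strict_refinement:
  assumes P: "partition_on (\<Union>P) P" and I: "I \<in> P"
    and Q: "refines (\<Union>P - I) Q (P - {I})" "Q \<noteq> P - {I}"
  shows "refines (\<Union>P) (insert I Q) P" "insert I Q \<noteq> P" "I \<notin> Q"
proof -
  have QP: "partition_on (\<Union>P - I) Q" and sub: "\<forall>X\<in>Q. \<exists>Y\<in>P - {I}. X \<subseteq> Y"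
    using Q by (auto simp: refines_def)
  have Ine: "I \<noteq> {}" using P I by (auto simp: partition_on_def)
  show nin: "I \<notin> Q"
  proof
    assume "I \<in> Q"
    then have "I \<subseteq> \<Union>P - I" using QP unfolding partition_on_def by blast
    then show False using Ine by blast
  qed
  have "partition_on (\<Union>P) (insert I Q)"
    using QP Ine I by (intro partition_on_insertI) auto
  then show "refines (\<Union>P) (insert I Q) P" using sub I P unfolding refines_def by auto
  show "insert I Q \<noteq> P" using nin Q(2) by auto
qed

text \<open>The two non-membership facts are what \<open>part_prods_insertI\<close> asks for when
  the factors on A and on I - A are added one after the other.\<close>

lemma split_part_strict_refinement:
  assumes P: "partition_on (\<Union>P) P" and I: "I \<in> P" and A: "A \<subseteq> I" "A \<noteq> {}" "A \<noteq> I"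
  shows "refines (\<Union>P) (insert A (insert (I - A) (P - {I}))) P"
    "insert A (insert (I - A) (P - {I})) \<noteq> P" "A \<notin> insert (I - A) (P - {I})" "I - A \<notin> P - {I}"
proof -
  have dj: "X \<inter> Y = {}" if "X \<in> P" "Y \<in> P" "X \<noteq> Y" for X Y
    using that P by (auto simp: partition_on_def disjoint_def)
  have nin: "X \<notin> P - {I}" if "X \<subseteq> I" "X \<noteq> {}" for X
  proof
    assume "X \<in> P - {I}" then have "X \<inter> I = {}" using dj I by auto
    then show False using that by blast
  qed
  show "I - A \<notin> P - {I}" using A by (intro nin) auto
  show "A \<notin> insert (I - A) (P - {I})" using nin[of A] A by blast
  have "I \<notin> insert A (insert (I - A) (P - {I}))" using A by blast
  then show "insert A (insert (I - A) (P - {I})) \<noteq> P" using I by auto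
  have "\<Union>P - A - (I - A) = \<Union>P - I" using A by blast
  then have "partition_on (\<Union>P) (insert A (insert (I - A) (P - {I})))"
    using partition_on_remove[OF P I] A I by (intro partition_on_insertI) auto
  then show "refines (\<Union>P) (insert A (insert (I - A) (P - {I}))) P"
    unfolding refines_def using P A(1) I by auto
qed

lemma finite_partitions: "finite A \<Longrightarrow> (\<And>P. P \<in> Rs \<Longrightarrow> partition_on A P) \<Longrightarrow> finite Rs"
  by (rule finite_subset[of _ "Pow (Pow A)"]) (auto simp: partition_on_def)

text \<open>Maximise the number of refinements. A strictly coarser partition inherits all
  refinements and gains itself, so a maximum of this number is maximal for refinement.\<close>

lemma exists_maximal_partition:
  assumes fin: "finite A" and Rs: "\<And>P. P \<in> Rs \<Longrightarrow> partition_on A P" and ne: "Rs \<noteq> {}"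
  obtains P where "P \<in> Rs" "\<And>Q. Q \<in> Rs \<Longrightarrow> refines A P Q \<Longrightarrow> Q = P"
proof -
  define m where "m P = card {Q. refines A Q P}" for P
  have finR: "finite Rs" using finite_partitions fin Rs by blast
  then obtain P where P: "P \<in> Rs" "m P = Max (m ` Rs)"
    using Max_in[of "m ` Rs"] ne by (metis (no_types, lifting) finite_imageI image_iff image_is_empty)
  have "Q = P" if Q: "Q \<in> Rs" "refines A P Q" for Q
  proof (rule ccontr)
    assume "Q \<noteq> P"
    then have "\<not> refines A Q P" using refines_asym Q(2) by metis
    moreover have "refines A Q Q" using Rs[OF Q(1)] by (rule refines_refl)
    ultimately have "{S. refines A S P} \<subset> {S. refines A S Q}"
      using refines_trans Q(2) by (metis (no_types, lifting) mem_Collect_eq psubsetI subsetI)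
    moreover have "finite {S. refines A S Q}"
      by (rule finite_partitions[OF fin]) (auto simp: refines_def)
    ultimately have "m P < m Q" unfolding m_def by (rule psubset_card_mono[rotated])
    then show False using P(2) Max_ge[OF finite_imageI[OF finR] imageI[OF Q(1), of m]] by linarith
  qed
  then show thesis using that P by blast
qed

text \<open>A down-set in the refinement order. Strict refinements of a member stay in the family,
  and removing a maximal member leaves a down-set; the inductions on families rest on these two
  facts.\<close>

definition refinement_closed :: "nat set \<Rightarrow> nat set set set \<Rightarrow> bool" where
  "refinement_closed A Rs \<longleftrightarrow>
     (\<forall>P\<in>Rs. partition_on A P \<and> (\<forall>Q. refines A Q P \<longrightarrow> Q \<in> Rs))"

lemma refinement_closed_remove_maximal:
  assumes "refinement_closed A Rs" "\<And>Q. Q \<in> Rs \<Longrightarrow> refines A P Q \<Longrightarrow> Q = P"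
  shows "refinement_closed A (Rs - {P})"
  using assms by (auto simp: refinement_closed_def)

section \<open>Elimination of the factors on one part\<close>

context field
begin

text \<open>\<open>U\<close> is a subspace, so the contributions of \<open>b\<close> can be
  collected in one product b u with u in \<open>U\<close>, and the rest uses \<open>B\<close>
  only.\<close>

lemma mult_span_insertE:
  assumes p: "p \<in> mult_span (lspan (insert b B)) U" and b: "b \<in> scalar_funs" and B: "B \<subseteq> scalar_funs"
    and U: "fun_subspace U"
  obtains u q where "u \<in> U" "q \<in> mult_span (lspan B) U" "p = (\<lambda>x. b x \<otimes> u x \<oplus> q x)"
proof -
  have Us: "U \<subseteq> scalar_funs" using U by (simp add: fun_subspace_def)
  have Bs: "lspan B \<subseteq> scalar_funs" using B lspan_scalar by blast
  note S = fun_subspace_mult_span[OF Bs Us]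
  have "\<exists>u\<in>U. \<exists>q\<in>mult_span (lspan B) U. p = (\<lambda>x. b x \<otimes> u x \<oplus> q x)"
    using p unfolding mult_span_def[of "lspan (insert b B)"]
  proof (induction rule: lspan.induct)
    case zero
    show ?case
      by (intro bexI[of _ "\<lambda>_. \<zero>"] fun_subspace_zero U S) (use b in \<open>simp add: scalar_funs_def\<close>)
  next
    case (step c k g)
    then obtain u q where uq: "u \<in> U" "q \<in> mult_span (lspan B) U" "g = (\<lambda>x. b x \<otimes> u x \<oplus> q x)" by auto
    obtain a v where av: "a \<in> lspan (insert b B)" "v \<in> U" "k = (\<lambda>x. a x \<otimes> v x)" using step by auto
    obtain e a' where a': "e \<in> carrier R" "a' \<in> lspan B" "a = (\<lambda>x. e \<otimes> b x \<oplus> a' x)"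
      using lspan_insertE[OF av(1) b B] .
    have car: "u x \<in> carrier R" "q x \<in> carrier R" "v x \<in> carrier R" "b x \<in> carrier R" "a' x \<in> carrier R" for x
      using uq av a' b Us Bs S unfolding fun_subspace_def scalar_funs_def by auto
    have 1: "(\<lambda>x. (c \<otimes> e) \<otimes> v x \<oplus> u x) \<in> U"
      using step(1) a'(1) by (intro fun_subspace_lin[OF U _ av(2) uq(1)]) simp
    have 2: "(\<lambda>x. c \<otimes> (a' x \<otimes> v x) \<oplus> q x) \<in> mult_span (lspan B) U"
      by (rule fun_subspace_lin[OF S step(1) mult_spanI[OF Bs Us a'(2) av(2)] uq(2)])
    have "c \<otimes> k x \<oplus> g x = b x \<otimes> ((c \<otimes> e) \<otimes> v x \<oplus> u x) \<oplus> (c \<otimes> (a' x \<otimes> v x) \<oplus> q x)" for x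
      unfolding uq(3) av(3) a'(3) using car[of x] step(1) a'(1) by algebra
    then show ?case using 1 2 by (intro bexI[OF _ 1] bexI[OF _ 2]) auto
  qed
  then show thesis using that by blast
qed

text \<open>Adding the part I to a strict refinement of P - {I} gives a strict refinement of
  P.\<close>

lemma mult_strict_span:
  fixes a u :: "(nat \<Rightarrow> 'p) \<Rightarrow> 'a"
  assumes P: "partition_on (\<Union>P) P" "finite (\<Union>P)" and I: "I \<in> P"
    and a: "a \<in> coord_funs I" and u: "u \<in> prod_span coord_funs (strict_refinements (P - {I}))"
  shows "(\<lambda>x. a x \<otimes> u x) \<in> prod_span coord_funs (strict_refinements P)"
proof (rule lspan_mult[OF fun_subspace_prod_span coord_funs_subset part_prods_scalar])
  show "a \<in> lspan (coord_funs I)" using a lspan_superset[OF coord_funs_subset] by blast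
  show "u \<in> lspan (\<Union>Q\<in>strict_refinements (P - {I}). part_prods coord_funs Q)"
    using u by (simp add: prod_span_def)
  fix a b :: "(nat \<Rightarrow> 'p) \<Rightarrow> 'a"
  assume a: "a \<in> coord_funs I" and "b \<in> (\<Union>Q\<in>strict_refinements (P - {I}). part_prods coord_funs Q)"
  then obtain Q where Q: "refines (\<Union>P - I) Q (P - {I})" "Q \<noteq> P - {I}" and b: "b \<in> part_prods coord_funs Q"
    using partition_on_Union_remove[OF P(1) I] by (auto simp: strict_refinements_def)
  note Q' = insert_strict_refinement[OF P(1) I Q]
  have "finite Q" using Q(1) P(2) by (auto simp: refines_def intro: finite_elements)
  then have "(\<lambda>x. a x \<otimes> b x) \<in> part_prods coord_funs (insert I Q)"
    using Q' by (intro part_prods_insertI a b coord_subspaces_coord_funs)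
  moreover have "insert I Q \<in> strict_refinements P" using Q' by (simp add: strict_refinements_def)
  ultimately show "(\<lambda>x. a x \<otimes> b x) \<in> prod_span coord_funs (strict_refinements P)"
    using part_prods_subset_span[OF coord_subspaces_coord_funs] by blast
qed (rule coord_subspaces_coord_funs)+

text \<open>A decomposable factor on I splits this part in two, so the product runs along a strict
  refinement of P.\<close>

lemma mult_cut_span:
  fixes a u :: "(nat \<Rightarrow> 'p) \<Rightarrow> 'a"
  assumes P: "partition_on (\<Union>P) P" "finite (\<Union>P)" and I: "I \<in> P"
    and a: "a \<in> cut_span {I}" and u: "u \<in> prod_span coord_funs {P - {I}}"
  shows "(\<lambda>x. a x \<otimes> u x) \<in> prod_span coord_funs (strict_refinements P)"
proof (rule lspan_mult[OF fun_subspace_prod_span _ part_prods_scalar])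
  show "u \<in> lspan (\<Union>Q\<in>{P - {I}}. part_prods coord_funs Q)"
    using u by (simp add: prod_span_def)
  show "a \<in> lspan {\<lambda>x. a x \<otimes> b x | a b. \<exists>A. a \<in> coord_funs A \<and> b \<in> coord_funs (\<Union>{I} - A) \<and>
     A \<subseteq> \<Union>{I} \<and> (\<exists>J\<in>{I}. J \<inter> A \<noteq> {} \<and> J - A \<noteq> {})}" using a unfolding cut_span_def .
  show "{\<lambda>x. a x \<otimes> b x | a b. \<exists>A. a \<in> coord_funs A \<and> b \<in> coord_funs (\<Union>{I} - A) \<and>
     A \<subseteq> \<Union>{I} \<and> (\<exists>J\<in>{I}. J \<inter> A \<noteq> {} \<and> J - A \<noteq> {})} \<subseteq> scalar_funs"
    by (rule subset_trans[OF cut_gens_scalar coord_funs_subset])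
  fix c u :: "(nat \<Rightarrow> 'p) \<Rightarrow> 'a"
  assume c: "c \<in> {\<lambda>x. a x \<otimes> b x | a b. \<exists>A. a \<in> coord_funs A \<and> b \<in> coord_funs (\<Union>{I} - A) \<and>
     A \<subseteq> \<Union>{I} \<and> (\<exists>J\<in>{I}. J \<inter> A \<noteq> {} \<and> J - A \<noteq> {})}"
    and "u \<in> (\<Union>Q\<in>{P - {I}}. part_prods coord_funs Q)"
  then have u: "u \<in> part_prods coord_funs (P - {I})" by simp
  obtain a b A where ab: "a \<in> coord_funs A" "b \<in> coord_funs (I - A)" "A \<subseteq> I" "A \<noteq> {}" "A \<noteq> I"
    "c = (\<lambda>x. a x \<otimes> b x)" using c by auto
  note Q = split_part_strict_refinement[OF P(1) I ab(3-5)]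
  have "finite P" by (rule finite_elements[OF P(2,1)])
  then have fin: "finite (P - {I})" "finite (insert (I - A) (P - {I}))" by auto
  have "(\<lambda>x. b x \<otimes> u x) \<in> part_prods coord_funs (insert (I - A) (P - {I}))"
    using Q(4) fin(1) by (intro part_prods_insertI ab u coord_subspaces_coord_funs)
  then have "(\<lambda>x. a x \<otimes> (b x \<otimes> u x)) \<in> part_prods coord_funs (insert A (insert (I - A) (P - {I})))"
    by (rule part_prods_insertI[OF ab(1) _ coord_subspaces_coord_funs fin(2) Q(3)])
  moreover have "insert A (insert (I - A) (P - {I})) \<in> strict_refinements P"
    using Q by (simp add: strict_refinements_def)
  ultimately have "(\<lambda>x. a x \<otimes> (b x \<otimes> u x)) \<in> prod_span coord_funs (strict_refinements P)"
    using part_prods_subset_span[OF coord_subspaces_coord_funs] by blast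
  moreover have "u \<in> scalar_funs" using u part_prods_scalar[OF coord_subspaces_coord_funs, of "{P - {I}}"] by auto
  then have "(\<lambda>x. a x \<otimes> (b x \<otimes> u x)) = (\<lambda>x. c x \<otimes> u x)"
    using ab(6) coord_funs_carrier[OF ab(1)] coord_funs_carrier[OF ab(2)]
    by (auto simp: fun_eq_iff m_assoc scalar_funs_def)
  ultimately show "(\<lambda>x. c x \<otimes> u x) \<in> prod_span coord_funs (strict_refinements P)" by simp
qed (rule coord_subspaces_coord_funs)+

text \<open>The second factor u is constant along I, so contraction leaves u times the value of
  \<open>G\<close> at the factor on I, and \<open>G\<close> vanishes on \<open>V\<close>.\<close>

lemma push_kills_mult_span:
  assumes G: "linear_functional G" and V: "V \<subseteq> coord_funs I" and kill: "\<And>v. v \<in> V \<Longrightarrow> G v = \<zero>"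
    and U: "U \<subseteq> coord_funs (B - I)" and q: "q \<in> mult_span V U"
  shows "push G I q = (\<lambda>_. \<zero>)"
  using q unfolding mult_span_def
proof (induction rule: lspan.induct)
  case zero
  show ?case using linear_functional_zero[OF G] by (simp add: push_def)
next
  case (step c f g)
  then obtain a u where au: "a \<in> V" "u \<in> U" "f = (\<lambda>x. a x \<otimes> u x)" by auto
  have gs: "g \<in> scalar_funs" and fs: "f \<in> scalar_funs"
  proof -
    have "V \<subseteq> scalar_funs" "U \<subseteq> scalar_funs" using V U coord_funs_subset by blast+
    note mg = mult_gens_scalar[OF this]
    show "f \<in> scalar_funs" using mg step(2) by blast
    show "g \<in> scalar_funs" using lspan_scalar[OF step(3) mg] .
  qed
  have "push G I f y = \<zero>" for y
  proof -
    have "u (override_on y z I) = u y" for z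
      by (rule coord_funsD[of _ "B - I"]) (use U au in \<open>auto simp: override_on_def\<close>)
    moreover have "a (override_on y z I) = a z" for z
      by (rule coord_funsD[of _ I]) (use V au in \<open>auto simp: override_on_def\<close>)
    ultimately have "push G I f y = G (\<lambda>z. a z \<otimes> u y)" by (simp add: push_def au(3))
    also have "(\<lambda>z. a z \<otimes> u y) = (\<lambda>z. u y \<otimes> a z)"
      using au V U by (intro ext m_comm) (auto intro: coord_funs_carrier)
    also have "G \<dots> = u y \<otimes> G a"
      using au V U by (intro linear_functional_smult[OF G]) (auto intro: coord_funs_carrier coord_funs_scalar)
    also have "\<dots> = \<zero>"
      using kill[OF au(1)] coord_funs_carrier[OF subsetD[OF U au(2)]] by simp
    finally show ?thesis .
  qed
  then show ?case using push_lin[OF G step(1) fs gs] step by (simp add: fun_eq_iff)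
qed

text \<open>Beyond \<open>N\<close> and the decomposable functions, only finitely many functions
  \<open>B\<close> of the coordinates in I are needed to write p, and they are removed one by one.
  To remove b, choose \<open>G\<close> that vanishes on all the others with G b = 1. The slices of f
  lie in \<open>N\<close> and are killed, so contracting f - p leaves -u, where u is the coefficient
  of b. Hence u lies in the cut span of P - {I}, and \<open>LT\<close> makes b u a combination along
  strict refinements of P. The space \<open>N\<close> is zero in \<open>leading_term\<close> and
  \<open>M I\<close> in \<open>leading_term_internal\<close>.\<close>

lemma elimination_step:
  fixes f p :: "(nat \<Rightarrow> 'p) \<Rightarrow> 'a"
  assumes P: "partition_on (\<Union>P) P" "finite (\<Union>P)" and I: "I \<in> P"
    and U: "fun_subspace U" "U \<subseteq> prod_span coord_funs {P - {I}}"
    and LT: "prod_span coord_funs {P - {I}} \<inter> cut_span (P - {I}) \<subseteq>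
      (prod_span coord_funs (strict_refinements (P - {I})) :: ((nat \<Rightarrow> 'p) \<Rightarrow> 'a) set)"
    and N: "fun_subspace N" "N \<subseteq> coord_funs I"
    and f: "f \<in> scalar_funs" "\<And>y. (\<lambda>z. f (override_on y z I)) \<in> N"
    and p: "p \<in> mult_span (coord_funs I) U" and fp: "(\<lambda>x. f x \<ominus> p x) \<in> cut_span P"
  shows "p \<in> lspan (mult_span N U \<union> prod_span coord_funs (strict_refinements P))"
proof -
  have cI: "cut_span {I} \<subseteq> coord_funs I" using cut_span_coord_funs[of "{I}"] by simp
  have Uc: "U \<subseteq> coord_funs (\<Union>P - I)"
    using U(2) prod_span_coord_funs[OF coord_subspaces_coord_funs, of "{P - {I}}" "\<Union>P - I"]
      partition_on_Union_remove[OF P(1) I] by auto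
  then have Us: "U \<subseteq> scalar_funs" using coord_funs_subset by blast
  have Ns: "N \<subseteq> scalar_funs" and Ms: "mult_span N U \<subseteq> scalar_funs"
    using N coord_funs_subset fun_subspace_mult_span[OF _ Us, of N] by (auto simp: fun_subspace_def)
  have Ws: "prod_span coord_funs (strict_refinements P) \<subseteq> scalar_funs"
    using fun_subspace_prod_span[OF coord_subspaces_coord_funs] unfolding fun_subspace_def by blast
  let ?H = "lspan (mult_span N U \<union> prod_span coord_funs (strict_refinements P))"
  let ?gens = "mult_span N U \<union> prod_span coord_funs (strict_refinements P)"
  have Hs: "?gens \<subseteq> scalar_funs" using Ms Ws by auto
  note H = fun_subspace_lspan[OF Hs]
  note HI = subsetD[OF lspan_superset[OF Hs]]
  \<comment> \<open>p is generalised because each step subtracts b u from it; f - p stays in the cut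
    span, which contains all products along strict refinements.\<close>
  have key: "p \<in> ?H" if "finite B" "B \<subseteq> coord_funs I" "p \<in> mult_span (lspan (B \<union> (N \<union> cut_span {I}))) U"
     "(\<lambda>x. f x \<ominus> p x) \<in> cut_span P" for B and p :: "(nat \<Rightarrow> 'p) \<Rightarrow> 'a"
    using that
  proof (induction B arbitrary: p rule: finite_induct)
    case empty
    \<comment> \<open>Only factors in \<open>N\<close> and decomposable factors are left; they give
      the two kinds of generators in the conclusion.\<close>
    have "mult_span (lspan (N \<union> cut_span {I})) U \<subseteq> ?H"
    proof (rule mult_span_least[OF H])
      fix a u assume a: "a \<in> lspan (N \<union> cut_span {I})" and u: "u \<in> U"
      show "(\<lambda>x. a x \<otimes> u x) \<in> ?H"
      proof (rule lspan_mult[OF H _ Us _ a subsetD[OF lspan_superset[OF Us] u]])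
        show "N \<union> cut_span {I} \<subseteq> scalar_funs" using Ns cI coord_funs_subset by blast
        fix a u assume a: "a \<in> N \<union> cut_span {I}" and u: "u \<in> U"
        show "(\<lambda>x. a x \<otimes> u x) \<in> ?H"
        proof (cases "a \<in> N")
          case True
          then show ?thesis using u by (intro HI UnI1 mult_spanI[OF Ns Us])
        next
          case False
          then show ?thesis using a u U(2) by (intro HI UnI2 mult_cut_span[OF P I]) auto
        qed
      qed
    qed
    then show ?case using empty by auto
  next
    case (insert b B)
    let ?C = "B \<union> (N \<union> cut_span {I})"
    have Cc: "?C \<subseteq> coord_funs I" using insert.prems(1) N cI by auto
    then have Cs: "?C \<subseteq> scalar_funs" using coord_funs_subset by blast
    have bc: "b \<in> coord_funs I" and bs: "b \<in> scalar_funs" using insert.prems(1) coord_funs_subset by auto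
    have Lc: "lspan ?C \<subseteq> coord_funs I" by (rule lspan_least[OF fun_subspace_coord_funs Cc])
    have Bc: "B \<subseteq> coord_funs I" using insert.prems(1) by simp
    show ?case
    \<comment> \<open>A redundant b is dropped without changing the span; otherwise it can be
      separated from the span of the remaining functions.\<close>
    proof (cases "b \<in> lspan ?C")
      case True
      then have "lspan (insert b B \<union> (N \<union> cut_span {I})) \<subseteq> lspan ?C"
        using lspan_superset[OF Cs] by (intro lspan_least fun_subspace_lspan Cs) auto
      then have "mult_span (lspan (insert b B \<union> (N \<union> cut_span {I}))) U \<subseteq> mult_span (lspan ?C) U"
        unfolding mult_span_def by (intro lspan_mono) auto
      then show ?thesis using insert.IH[OF Bc] insert.prems by blast
    next
      case False
      obtain G where G: "linear_functional G" and kill: "\<And>g. g \<in> lspan ?C \<Longrightarrow> G g = \<zero>" and Gb: "G b = \<one>"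
        using exists_separating_functional[OF fun_subspace_lspan[OF Cs] bs False] by blast
      obtain u q where uq: "u \<in> U" "q \<in> mult_span (lspan ?C) U" "p = (\<lambda>x. b x \<otimes> u x \<oplus> q x)"
        using mult_span_insertE[OF insert.prems(2)[unfolded Un_insert_left] bs Cs U(1)] .
      have us: "u \<in> scalar_funs" using uq(1) Us by auto
      have qs: "q \<in> scalar_funs"
        using uq(2) fun_subspace_mult_span[OF subset_trans[OF Lc coord_funs_subset] Us] by (auto simp: fun_subspace_def)
      have bus: "(\<lambda>x. b x \<otimes> u x) \<in> scalar_funs" using us bs by (simp add: scalar_funs_def)
      have ps: "p \<in> scalar_funs" unfolding uq(3) using bus qs by (simp add: scalar_funs_def)
      have "push G I (\<lambda>x. b x \<otimes> u x) = u"
      proof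
        fix y
        have "u (override_on y z I) = u y" for z
          by (rule coord_funsD[of _ "\<Union>P - I"]) (use Uc uq in \<open>auto simp: override_on_def\<close>)
        moreover have "b (override_on y z I) = b z" for z
          by (rule coord_funsD[OF bc]) (simp add: override_on_def)
        ultimately have "push G I (\<lambda>x. b x \<otimes> u x) y = G (\<lambda>z. b z \<otimes> u y)" by (simp add: push_def)
        also have "(\<lambda>z. b z \<otimes> u y) = (\<lambda>z. u y \<otimes> b z)"
          using bs us by (intro ext m_comm) (simp_all add: scalar_funs_def)
        also have "G \<dots> = u y \<otimes> G b" by (rule linear_functional_smult[OF G scalar_funsD[OF us] bs])
        finally show "push G I (\<lambda>x. b x \<otimes> u x) y = u y" using Gb us by (simp add: scalar_funsD)
      qed
      moreover have "push G I q = (\<lambda>_. \<zero>)"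
        by (rule push_kills_mult_span[OF G Lc kill Uc uq(2)])
      moreover have "p = (\<lambda>x. \<one> \<otimes> (b x \<otimes> u x) \<oplus> q x)"
        unfolding uq(3) using bus by (simp add: scalar_funs_def)
      ultimately have pp: "push G I p = u"
        using push_lin[OF G one_closed bus qs, of I] us by (simp add: scalar_funs_def)
      have "push G I f = (\<lambda>_. \<zero>)"
        unfolding push_def using f(2) lspan_superset[OF Cs] by (intro ext kill) auto
      moreover have "push G I (\<lambda>x. f x \<ominus> p x) \<in> cut_span (P - {I})"
        using lspan_superset[OF Cs] by (intro push_cut_span[OF G kill P(1) I insert.prems(3)]) auto
      ultimately have "(\<lambda>y. \<zero> \<ominus> u y) \<in> cut_span (P - {I})"
        by (simp add: push_diff[OF G f(1) ps] pp)
      then have "(\<lambda>y. (\<ominus> \<one>) \<otimes> (\<zero> \<ominus> u y)) \<in> cut_span (P - {I})"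
        by (intro fun_subspace_smult[OF fun_subspace_cut_span]) auto
      moreover have "(\<lambda>y. (\<ominus> \<one>) \<otimes> (\<zero> \<ominus> u y)) = u"
        using us by (auto simp: fun_eq_iff scalar_funs_def a_minus_def l_minus)
      ultimately have "u \<in> prod_span coord_funs (strict_refinements (P - {I}))" using LT uq(1) U(2) by auto
      then have bu: "(\<lambda>x. b x \<otimes> u x) \<in> prod_span coord_funs (strict_refinements P)"
        by (rule mult_strict_span[OF P I bc])
      have "(\<lambda>x. (f x \<ominus> p x) \<oplus> b x \<otimes> u x) \<in> cut_span P"
        using strict_cut_span[OF P] bu by (intro fun_subspace_add[OF fun_subspace_cut_span insert.prems(3)]) auto
      moreover have "(f x \<ominus> p x) \<oplus> b x \<otimes> u x = f x \<ominus> q x" for x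
      proof -
        have "f x \<in> carrier R" "b x \<in> carrier R" "u x \<in> carrier R" "q x \<in> carrier R"
          using f(1) bs us qs by (auto simp: scalar_funs_def)
        then show ?thesis unfolding uq(3) by algebra
      qed
      ultimately have "q \<in> ?H" using insert.IH[OF Bc uq(2)] by simp
      then show ?thesis unfolding uq(3) by (rule fun_subspace_add[OF H HI[OF UnI2[OF bu]]])
    qed
  qed
  \<comment> \<open>p is a finite sum of products, and the factors on I that occur in it form
    \<open>B\<close>.\<close>
  have "\<exists>B. finite B \<and> B \<subseteq> coord_funs I \<and> p \<in> mult_span (lspan (B \<union> (N \<union> cut_span {I}))) U"
    using p unfolding mult_span_def[of "coord_funs I"]
  proof (induction rule: lspan.induct)
    case zero
    show ?case by (intro exI[of _ "{}"]) (auto simp: mult_span_def intro: lspan.zero)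
  next
    case (step c k g)
    then obtain B where B: "finite B" "B \<subseteq> coord_funs I"
      "g \<in> mult_span (lspan (B \<union> (N \<union> cut_span {I}))) U" by auto
    obtain a u where au: "a \<in> coord_funs I" "u \<in> U" "k = (\<lambda>x. a x \<otimes> u x)" using step by auto
    have sc: "insert a B \<union> (N \<union> cut_span {I}) \<subseteq> scalar_funs"
      using au B N cI coord_funs_subset by blast
    have "a \<in> lspan (insert a B \<union> (N \<union> cut_span {I}))" using lspan_superset[OF sc] by auto
    moreover have "g \<in> mult_span (lspan (insert a B \<union> (N \<union> cut_span {I}))) U"
    proof -
      have "lspan (B \<union> (N \<union> cut_span {I})) \<subseteq> lspan (insert a B \<union> (N \<union> cut_span {I}))"
        by (rule lspan_mono) auto
      then have "mult_span (lspan (B \<union> (N \<union> cut_span {I}))) U \<subseteq>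
          mult_span (lspan (insert a B \<union> (N \<union> cut_span {I}))) U"
        unfolding mult_span_def by (intro lspan_mono) auto
      then show ?thesis using B(3) by blast
    qed
    ultimately have "(\<lambda>x. c \<otimes> k x \<oplus> g x) \<in> mult_span (lspan (insert a B \<union> (N \<union> cut_span {I}))) U"
      unfolding mult_span_def au(3) using au(2) by (intro lspan.step step(1)) auto
    then show ?case using B au by (intro exI[of _ "insert a B"]) auto
  qed
  then show ?thesis using key fp by blast
qed


section \<open>Leading terms and their consequences for spans\<close>

lemma prod_span_scalar: "coord_subspaces M \<Longrightarrow> prod_span M Rs \<subseteq> scalar_funs"
  using fun_subspace_prod_span unfolding fun_subspace_def by blast

lemma part_prods_cong: "(\<And>J. J \<in> P \<Longrightarrow> M J = M' J) \<Longrightarrow> part_prods M P = part_prods M' P"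
  unfolding part_prods_def by auto

lemma prod_span_mono_funs: "(\<And>J. M J \<subseteq> M' J) \<Longrightarrow> prod_span M Rs \<subseteq> prod_span M' Rs"
  unfolding prod_span_def part_prods_def by (rule lspan_mono) blast

lemma prod_span_insertE:
  assumes "f \<in> prod_span M (insert P Rs)" "coord_subspaces M"
  obtains p w where "p \<in> prod_span M {P}" "w \<in> prod_span M Rs" "f = (\<lambda>x. p x \<oplus> w x)"
proof -
  have "f \<in> lspan ((\<Union>Q\<in>{P}. part_prods M Q) \<union> (\<Union>Q\<in>Rs. part_prods M Q))"
    using assms(1) by (simp add: prod_span_def)
  from lspan_Un_split[OF this part_prods_scalar[OF assms(2)] part_prods_scalar[OF assms(2)]]
  show thesis using that by (auto simp: prod_span_def)
qed

text \<open>Induction on the number of parts, with \<open>elimination_step\<close> for f = 0 and N =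
  {0}: up to strict refinements, the factors on I are then reduced to zero.\<close>

lemma leading_term:
  assumes "partition_on (\<Union>P) P" "finite (\<Union>P)"
  shows "prod_span coord_funs {P} \<inter> cut_span P \<subseteq>
    (prod_span coord_funs (strict_refinements P) :: ((nat \<Rightarrow> 'p) \<Rightarrow> 'a) set)"
  using assms
proof (induction "card P" arbitrary: P)
  case 0
  then have "P = {}" using finite_elements by fastforce
  moreover have "f = (\<lambda>_. \<zero>)" if "f \<in> cut_span {}" for f :: "(nat \<Rightarrow> 'p) \<Rightarrow> 'a"
    using that unfolding cut_span_def by (cases rule: lspan.cases) auto
  ultimately show ?case
    using fun_subspace_zero[OF fun_subspace_prod_span[OF coord_subspaces_coord_funs]] by blast
next
  case (Suc n)
  have finP: "finite P" by (rule finite_elements[OF Suc.prems(2,1)])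
  then obtain I where I: "I \<in> P" using Suc.hyps(2) by fastforce
  have un: "\<Union>(P - {I}) = \<Union>P - I" by (rule partition_on_Union_remove[OF Suc.prems(1) I])
  have LT: "prod_span coord_funs {P - {I}} \<inter> cut_span (P - {I}) \<subseteq>
    (prod_span coord_funs (strict_refinements (P - {I})) :: ((nat \<Rightarrow> 'p) \<Rightarrow> 'a) set)"
    using Suc.hyps(2) I partition_on_remove[OF Suc.prems(1) I] Suc.prems(2) finP
    by (intro Suc.hyps(1)) (simp_all add: un)
  show ?case
  proof
    fix p :: "(nat \<Rightarrow> 'p) \<Rightarrow> 'a" assume p: "p \<in> prod_span coord_funs {P} \<inter> cut_span P"
    let ?U = "prod_span coord_funs {P - {I}} :: ((nat \<Rightarrow> 'p) \<Rightarrow> 'a) set"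
    let ?W = "prod_span coord_funs (strict_refinements P) :: ((nat \<Rightarrow> 'p) \<Rightarrow> 'a) set"
    have U: "fun_subspace ?U" by (rule fun_subspace_prod_span[OF coord_subspaces_coord_funs])
    have W: "fun_subspace ?W" by (rule fun_subspace_prod_span[OF coord_subspaces_coord_funs])
    have z: "fun_subspace {\<lambda>_. \<zero>}" by (auto simp: fun_subspace_def scalar_funs_def)
    have "p \<in> lspan (mult_span {\<lambda>_. \<zero>} ?U \<union> ?W)"
    proof (rule elimination_step[OF Suc.prems I U subset_refl LT z])
      show "{\<lambda>_. \<zero>} \<subseteq> coord_funs I" using fun_subspace_zero[OF fun_subspace_coord_funs] by blast
      show "(\<lambda>_. \<zero>) \<in> scalar_funs" by (simp add: scalar_funs_def)
      show "p \<in> mult_span (coord_funs I) ?U"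
        using p prod_span_remove[OF coord_subspaces_coord_funs finP I] by auto
      show "(\<lambda>x. \<zero> \<ominus> p x) \<in> cut_span P"
        using p fun_subspace_zero[OF fun_subspace_cut_span]
        by (intro fun_subspace_diff[OF fun_subspace_cut_span]) auto
    qed simp
    moreover have "mult_span {\<lambda>_. \<zero>} ?U \<subseteq> ?W"
    proof (rule mult_span_least[OF W])
      fix a u assume "a \<in> {\<lambda>_::nat \<Rightarrow> 'p. \<zero>}" "u \<in> ?U"
      then have "(\<lambda>x. a x \<otimes> u x) = (\<lambda>_. \<zero>)"
        using prod_span_scalar[OF coord_subspaces_coord_funs, of "{P - {I}}"]
        by (auto simp: fun_eq_iff scalar_funs_def)
      then show "(\<lambda>x. a x \<otimes> u x) \<in> ?W" by (simp add: fun_subspace_zero[OF W])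
    qed
    ultimately show "p \<in> ?W" using lspan_least[OF W, of "mult_span {\<lambda>_. \<zero>} ?U \<union> ?W"] by blast
  qed
qed

text \<open>The factors of p are brought into \<open>M\<close> one part at a time. The error of each
  replacement runs along strict refinements and hence lies in \<open>cut_span P\<close>, so f minus
  the new approximation still satisfies the hypothesis of \<open>elimination_step\<close>.\<close>

lemma leading_term_internal:
  fixes f :: "(nat \<Rightarrow> 'p) \<Rightarrow> 'a"
  assumes P: "partition_on (\<Union>P) P" "finite (\<Union>P)" and M: "coord_subspaces M"
    and f: "f \<in> scalar_funs" "\<And>I y. I \<in> P \<Longrightarrow> (\<lambda>z. f (override_on y z I)) \<in> M I"
    and p: "p \<in> prod_span coord_funs {P}" and fp: "(\<lambda>x. f x \<ominus> p x) \<in> cut_span P"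
  obtains q where "q \<in> prod_span M {P}" "(\<lambda>x. p x \<ominus> q x) \<in> prod_span coord_funs (strict_refinements P)"
proof -
  \<comment> \<open>\<open>Z\<close> is the set of parts whose factors already lie in
    \<open>M\<close>.\<close>
  define MZ where "MZ Z J = (if J \<in> Z then M J else coord_funs J)" for Z J
  have MZ: "coord_subspaces (MZ Z)" for Z
    using M by (auto simp: coord_subspaces_def MZ_def fun_subspace_coord_funs)
  have MZs: "MZ Z J \<subseteq> coord_funs J" for Z J
    using MZ by (auto simp: coord_subspaces_def)
  let ?W = "prod_span coord_funs (strict_refinements P) :: ((nat \<Rightarrow> 'p) \<Rightarrow> 'a) set"
  have W: "fun_subspace ?W" by (rule fun_subspace_prod_span[OF coord_subspaces_coord_funs])
  have ps: "p \<in> scalar_funs" using p prod_span_scalar[OF coord_subspaces_coord_funs] by blast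
  have finP: "finite P" by (rule finite_elements[OF P(2,1)])
  have "\<exists>q\<in>prod_span (MZ Z) {P}. (\<lambda>x. p x \<ominus> q x) \<in> ?W" if "Z \<subseteq> P" for Z
    using finite_subset[OF that finP] that
  proof (induction Z rule: finite_induct)
    case empty
    have "MZ {} = coord_funs" by (simp add: MZ_def fun_eq_iff)
    moreover have "(\<lambda>x. p x \<ominus> p x) = (\<lambda>_. \<zero>)"
      using ps by (simp add: scalar_funs_def fun_eq_iff a_minus_def r_neg)
    ultimately show ?case using p fun_subspace_zero[OF W] by (intro bexI[of _ p]) auto
  next
    case (insert I Z)
    then obtain q where q: "q \<in> prod_span (MZ Z) {P}" "(\<lambda>x. p x \<ominus> q x) \<in> ?W" by auto
    have I: "I \<in> P" using insert by auto
    have qs: "q \<in> scalar_funs" using q prod_span_scalar[OF MZ] by blast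
    let ?U = "prod_span (MZ Z) {P - {I}}"
    have U: "fun_subspace ?U" by (rule fun_subspace_prod_span[OF MZ])
    have UM: "?U = prod_span (MZ (insert I Z)) {P - {I}}"
      unfolding prod_span_def using part_prods_cong[of "P - {I}" "MZ Z" "MZ (insert I Z)"]
      by (simp add: MZ_def)
    have un: "\<Union>(P - {I}) = \<Union>P - I" by (rule partition_on_Union_remove[OF P(1) I])
    have "q \<in> lspan (mult_span (M I) ?U \<union> ?W)"
    proof (rule elimination_step[OF P I U])
      show "?U \<subseteq> prod_span coord_funs {P - {I}}" by (rule prod_span_mono_funs[OF MZs])
      show "prod_span coord_funs {P - {I}} \<inter> cut_span (P - {I}) \<subseteq>
          prod_span coord_funs (strict_refinements (P - {I}))"
        using partition_on_remove[OF P(1) I] P(2) by (intro leading_term) (simp_all add: un)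
      show "fun_subspace (M I)" "M I \<subseteq> coord_funs I" using M by (auto simp: coord_subspaces_def)
      show "q \<in> mult_span (coord_funs I) ?U"
        using q(1) prod_span_remove[OF MZ finP I, of Z] insert.hyps(2) by (simp add: MZ_def[of Z I])
      have "(\<lambda>x. (f x \<ominus> p x) \<oplus> (p x \<ominus> q x)) \<in> cut_span P"
        using q(2) strict_cut_span[OF P] by (intro fun_subspace_add[OF fun_subspace_cut_span fp]) auto
      moreover have "(f x \<ominus> p x) \<oplus> (p x \<ominus> q x) = f x \<ominus> q x" for x
      proof -
        have "f x \<in> carrier R" "p x \<in> carrier R" "q x \<in> carrier R"
          using f(1) ps qs by (auto simp: scalar_funs_def)
        then show ?thesis by algebra
      qed
      ultimately show "(\<lambda>x. f x \<ominus> q x) \<in> cut_span P" by simp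
    qed (use f I in auto)
    moreover have Ms: "mult_span (M I) ?U \<subseteq> scalar_funs"
      using fun_subspace_mult_span[of "M I" ?U] prod_span_scalar[OF MZ] coord_subspacesD(1)[OF M] coord_funs_scalar
      unfolding fun_subspace_def by blast
    ultimately obtain g h where gh: "g \<in> lspan (mult_span (M I) ?U)" "h \<in> lspan ?W" "q = (\<lambda>x. g x \<oplus> h x)"
      using lspan_Un_split[OF _ Ms prod_span_scalar[OF coord_subspaces_coord_funs]] by blast
    have "mult_span (M I) ?U = prod_span (MZ (insert I Z)) {P}"
      using prod_span_remove[OF MZ finP I, of "insert I Z"] UM by (simp add: MZ_def[of "insert I Z" I])
    then have g: "g \<in> prod_span (MZ (insert I Z)) {P}"
      using gh(1) lspan_least[OF fun_subspace_prod_span[OF MZ, of "insert I Z" "{P}"]] by auto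
    have h: "h \<in> ?W" using gh(2) lspan_least[OF W] by auto
    have "(\<lambda>x. (p x \<ominus> q x) \<oplus> h x) \<in> ?W" by (rule fun_subspace_add[OF W q(2) h])
    moreover have "(p x \<ominus> q x) \<oplus> h x = p x \<ominus> g x" for x
    proof -
      have "p x \<in> carrier R" "h x \<in> carrier R" "g x \<in> carrier R"
        using ps fun_subspace_scalar[OF W h] fun_subspace_scalar[OF fun_subspace_prod_span[OF MZ] g]
        by (auto simp: scalar_funs_def)
      then show ?thesis unfolding gh(3) by algebra
    qed
    ultimately show ?case using g by auto
  qed
  from this[OF subset_refl] obtain q where q: "q \<in> prod_span (MZ P) {P}" "(\<lambda>x. p x \<ominus> q x) \<in> ?W" by blast
  have "prod_span (MZ P) {P} = prod_span M {P}"
    unfolding prod_span_def using part_prods_cong[of P "MZ P" M] by (simp add: MZ_def)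
  then show thesis using that q by auto
qed

text \<open>Induction on the family, a maximal member P first. P refines no other member, so f minus
  its component p along P lies in \<open>cut_span P\<close>, and
  \<open>leading_term_internal\<close> supplies an internal q in place of p. The difference p - q
  runs along strict refinements of P, which are in the family, and f - q is again internal by
  \<open>K_prods\<close>; so the induction hypothesis for the family without P applies to f - q. The
  slices that \<open>leading_term_internal\<close> asks for come from
  \<open>K_slice\<close>.\<close>

lemma internal_prod_span:
  fixes f :: "(nat \<Rightarrow> 'p) \<Rightarrow> 'a"
  assumes A: "finite A" and Rs: "refinement_closed A Rs" and K: "fun_subspace K"
    and K_slice: "\<And>f y I. f \<in> K \<Longrightarrow> (\<lambda>z. f (override_on y z I)) \<in> K"
    and K_prods: "\<And>P. P \<in> Rs \<Longrightarrow> part_prods (\<lambda>J. K \<inter> coord_funs J) P \<subseteq> K"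
    and f: "f \<in> K" "f \<in> prod_span coord_funs Rs"
  shows "f \<in> prod_span (\<lambda>J. K \<inter> coord_funs J) Rs"
proof -
  let ?M = "\<lambda>J. K \<inter> coord_funs J"
  have M: "coord_subspaces ?M"
    unfolding coord_subspaces_def using fun_subspace_inter[OF K fun_subspace_coord_funs] by auto
  have finR: "finite Rs" using finite_partitions[OF A] Rs by (auto simp: refinement_closed_def)
  show ?thesis using finR Rs K_prods f
  proof (induction Rs arbitrary: f rule: finite_psubset_induct)
    case (psubset Rs)
    show ?case
    proof (cases "Rs = {}")
      case True
      have "f = (\<lambda>_. \<zero>)"
        using psubset.prems(4) unfolding prod_span_def True by (cases rule: lspan.cases) auto
      then show ?thesis using fun_subspace_zero[OF fun_subspace_prod_span[OF M]] by simp
    next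
      case False
      have parts: "\<And>P. P \<in> Rs \<Longrightarrow> partition_on A P" using psubset.prems(1) by (auto simp: refinement_closed_def)
      obtain P where P: "P \<in> Rs" and max: "\<And>Q. Q \<in> Rs \<Longrightarrow> refines A P Q \<Longrightarrow> Q = P"
        using exists_maximal_partition[OF A parts False] by blast
      have AP: "A = \<Union>P" using parts[OF P] by (simp add: partition_on_def)
      have PP: "partition_on (\<Union>P) P" "finite (\<Union>P)" using parts[OF P] A AP by auto
      let ?Rs = "Rs - {P}"
      have rc: "refinement_closed A ?Rs" by (rule refinement_closed_remove_maximal[OF psubset.prems(1) max])
      obtain p w where pw: "p \<in> prod_span coord_funs {P}" "w \<in> prod_span coord_funs ?Rs" "f = (\<lambda>x. p x \<oplus> w x)"
        using prod_span_insertE[of f coord_funs P ?Rs] psubset.prems(4) P coord_subspaces_coord_funs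
        by (auto simp: insert_absorb)
      have sc: "p x \<in> carrier R" "w x \<in> carrier R" for x
        using pw fun_subspace_scalar[OF fun_subspace_prod_span[OF coord_subspaces_coord_funs]] by blast+
      have "prod_span coord_funs ?Rs \<subseteq> (cut_span P :: ((nat \<Rightarrow> 'p) \<Rightarrow> 'a) set)"
        using parts max AP by (intro prod_span_cut_span PP) auto
      moreover have "(\<lambda>x. f x \<ominus> p x) = w"
      proof
        fix x show "f x \<ominus> p x = w x" unfolding pw(3) using sc[of x] by algebra
      qed
      ultimately have fp: "(\<lambda>x. f x \<ominus> p x) \<in> cut_span P" using pw(2) by auto
      have fs: "f \<in> scalar_funs" using psubset.prems(3) K by (auto simp: fun_subspace_def)
      have slice: "(\<lambda>z. f (override_on y z I)) \<in> ?M I" if "I \<in> P" for I y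
      proof
        have "f \<in> coord_funs UNIV" using fs by (simp add: coord_funs_def fun_eq_iff[symmetric])
        from override_coord_funs[OF this, of y I]
        show "(\<lambda>z. f (override_on y z I)) \<in> coord_funs I" by simp
      qed (rule K_slice[OF psubset.prems(3)])
      obtain q where q: "q \<in> prod_span ?M {P}"
        "(\<lambda>x. p x \<ominus> q x) \<in> prod_span coord_funs (strict_refinements P)"
        using leading_term_internal[OF PP M fs slice pw(1) fp] by blast
      have "strict_refinements P \<subseteq> ?Rs"
        using psubset.prems(1) P AP by (auto simp: strict_refinements_def refinement_closed_def)
      then have pq: "(\<lambda>x. p x \<ominus> q x) \<in> prod_span coord_funs ?Rs" using q(2) prod_span_mono by blast
      have qK: "q \<in> K"
        using q(1) psubset.prems(2)[OF P] lspan_least[OF K, of "\<Union>Q\<in>{P}. part_prods ?M Q"]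
        by (auto simp: prod_span_def)
      have qs: "q x \<in> carrier R" for x by (rule fun_subspace_scalar[OF K qK])
      have fq: "(\<lambda>x. f x \<ominus> q x) \<in> K" by (rule fun_subspace_diff[OF K psubset.prems(3) qK])
      have "(\<lambda>x. (p x \<ominus> q x) \<oplus> w x) \<in> prod_span coord_funs ?Rs"
        by (rule fun_subspace_add[OF fun_subspace_prod_span[OF coord_subspaces_coord_funs] pq pw(2)])
      moreover have "(p x \<ominus> q x) \<oplus> w x = f x \<ominus> q x" for x
        unfolding pw(3) using sc[of x] qs[of x] by algebra
      ultimately have "(\<lambda>x. f x \<ominus> q x) \<in> prod_span coord_funs ?Rs" by simp
      then have "(\<lambda>x. f x \<ominus> q x) \<in> prod_span ?M ?Rs"
        using P psubset.prems(2) by (intro psubset.IH[OF _ rc _ fq]) auto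
      then have "(\<lambda>x. f x \<ominus> q x) \<in> prod_span ?M Rs" using prod_span_mono[of ?Rs Rs] by blast
      moreover have "q \<in> prod_span ?M Rs" using q(1) P prod_span_mono[of "{P}" Rs] by blast
      ultimately have "(\<lambda>x. (f x \<ominus> q x) \<oplus> q x) \<in> prod_span ?M Rs"
        by (rule fun_subspace_add[OF fun_subspace_prod_span[OF M]])
      moreover have "(f x \<ominus> q x) \<oplus> q x = f x" for x
        using qs[of x] fun_subspace_scalar[OF K psubset.prems(3), of x] by algebra
      ultimately show ?thesis by simp
    qed
  qed
qed

text \<open>The members outside \<open>Rs2\<close> are removed one at a time, a maximal one P first.
  P refines no member of \<open>Rs2\<close> and no other member of the first family, so f as well as
  its terms along those other members lie in \<open>cut_span P\<close>. Hence so does the component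
  of f along P, and \<open>leading_term\<close> moves it to strict refinements of P, which the first
  family contains.\<close>

lemma prod_span_inter:
  assumes A: "finite A" and Rs: "refinement_closed A Rs1" "refinement_closed A Rs2"
  shows "prod_span coord_funs Rs1 \<inter> prod_span coord_funs Rs2 \<subseteq>
    (prod_span coord_funs (Rs1 \<inter> Rs2) :: ((nat \<Rightarrow> 'p) \<Rightarrow> 'a) set)"
proof -
  have finR: "finite Rs1" using finite_partitions[OF A] Rs by (auto simp: refinement_closed_def)
  show ?thesis using finR Rs(1)
  proof (induction Rs1 rule: finite_psubset_induct)
    case (psubset Rs)
    have parts: "\<And>P. P \<in> Rs \<Longrightarrow> partition_on A P" using psubset.prems(1) by (auto simp: refinement_closed_def)
    show ?case
    proof (cases "Rs - Rs2 = {}")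
      case True
      then have "Rs \<inter> Rs2 = Rs" by auto
      then show ?thesis by simp
    next
      case False
      obtain P where P: "P \<in> Rs - Rs2" and max: "\<And>Q. Q \<in> Rs - Rs2 \<Longrightarrow> refines A P Q \<Longrightarrow> Q = P"
        by (rule exists_maximal_partition[OF A _ False]) (use parts in auto)
      \<comment> \<open>\<open>Rs2\<close> is closed under refinement and does not contain
        P.\<close>
      have not2: "\<not> refines A P Q" if "Q \<in> Rs2" for Q
        using that P Rs(2) by (auto simp: refinement_closed_def)
      \<comment> \<open>By \<open>not2\<close> a member coarser than P is outside
        \<open>Rs2\<close>, so maximality of P extends to all of \<open>Rs\<close>.\<close>
      have max': "Q = P" if "Q \<in> Rs" "refines A P Q" for Q
        using that max not2 by blast
      have PR: "P \<in> Rs" using P by simp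
      have AP: "A = \<Union>P" using parts[OF PR] by (simp add: partition_on_def)
      have PP: "partition_on (\<Union>P) P" "finite (\<Union>P)" using parts[OF PR] A AP by auto
      let ?Rs = "Rs - {P}"
      have rc: "refinement_closed A ?Rs" by (rule refinement_closed_remove_maximal[OF psubset.prems(1) max'])
      have c1: "prod_span coord_funs ?Rs \<subseteq> (cut_span P :: ((nat \<Rightarrow> 'p) \<Rightarrow> 'a) set)"
        using parts max' AP by (intro prod_span_cut_span PP) auto
      have c2: "prod_span coord_funs Rs2 \<subseteq> (cut_span P :: ((nat \<Rightarrow> 'p) \<Rightarrow> 'a) set)"
        using Rs(2) not2 AP by (intro prod_span_cut_span PP) (auto simp: refinement_closed_def)
      have sr: "strict_refinements P \<subseteq> ?Rs"
        using psubset.prems(1) PR AP by (auto simp: strict_refinements_def refinement_closed_def)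
      show ?thesis
      proof
        fix f :: "(nat \<Rightarrow> 'p) \<Rightarrow> 'a"
        assume f: "f \<in> prod_span coord_funs Rs \<inter> prod_span coord_funs Rs2"
        obtain p w where pw: "p \<in> prod_span coord_funs {P}" "w \<in> prod_span coord_funs ?Rs" "f = (\<lambda>x. p x \<oplus> w x)"
          using prod_span_insertE[of f coord_funs P ?Rs] f PR coord_subspaces_coord_funs
          by (auto simp: insert_absorb)
        have sc: "p x \<in> carrier R" "w x \<in> carrier R" for x
          using pw fun_subspace_scalar[OF fun_subspace_prod_span[OF coord_subspaces_coord_funs]] by blast+
        have "(\<lambda>x. f x \<ominus> w x) \<in> cut_span P"
          using f c1 c2 pw(2) by (intro fun_subspace_diff[OF fun_subspace_cut_span]) auto
        moreover have "(\<lambda>x. f x \<ominus> w x) = p"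
        proof
          fix x show "f x \<ominus> w x = p x" unfolding pw(3) using sc[of x] by algebra
        qed
        ultimately have "p \<in> prod_span coord_funs (strict_refinements P)"
          using leading_term[OF PP] pw(1) by auto
        then have "p \<in> prod_span coord_funs ?Rs" using sr prod_span_mono by blast
        then have "f \<in> prod_span coord_funs ?Rs"
          unfolding pw(3) by (rule fun_subspace_add[OF fun_subspace_prod_span[OF coord_subspaces_coord_funs] _ pw(2)])
        moreover have "?Rs \<subset> Rs" using PR by auto
        ultimately have "f \<in> prod_span coord_funs (?Rs \<inter> Rs2)" using psubset.IH[OF _ rc] f by blast
        then show "f \<in> prod_span coord_funs (Rs \<inter> Rs2)" using prod_span_mono[of "?Rs \<inter> Rs2" "Rs \<inter> Rs2"] by blast
      qed
    qed
  qed
qed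

lemma prod_span_INT:
  fixes f :: "(nat \<Rightarrow> 'p) \<Rightarrow> 'a"
  assumes "finite A" "finite I" "I \<noteq> {}" "\<And>i. i \<in> I \<Longrightarrow> refinement_closed A (Rs i)"
    "\<And>i. i \<in> I \<Longrightarrow> f \<in> prod_span coord_funs (Rs i)"
  shows "f \<in> prod_span coord_funs (\<Inter>i\<in>I. Rs i)"
  using assms(2-5)
proof (induction I rule: finite_ne_induct)
  case (insert i I)
  have "refinement_closed A (\<Inter>i\<in>I. Rs i)"
    using insert.prems(1) insert.hyps(2) unfolding refinement_closed_def by blast
  then show ?case using prod_span_inter[OF assms(1), of "Rs i" "\<Inter>i\<in>I. Rs i"] insert by auto
qed simp

end

section \<open>Decompositions of tensors\<close>

text \<open>The property under the LEAST of \<open>tensor_rank\<close>, isolated so that its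
  existence and its monotonicity in k can be proved. By \<open>tensor_rank_le_iff\<close> the LEAST
  then disappears from the arguments.\<close>

definition rank_decomp ::
  "'a ring \<Rightarrow> nat \<Rightarrow> (nat \<Rightarrow> nat) \<Rightarrow> nat set set set \<Rightarrow> nat \<Rightarrow> ((nat \<Rightarrow> nat) \<Rightarrow> 'a) \<Rightarrow> bool" where
  "rank_decomp F d n Rs k T \<longleftrightarrow> (\<exists>S :: nat \<Rightarrow> (nat \<Rightarrow> nat) \<Rightarrow> 'a.
     (\<forall>i\<in>{1..k}. S i \<in> tensors F d n \<and> rank_le_one F d n Rs (S i)) \<and>
     (\<forall>x\<in>grid {1..d} n. T x = (\<Oplus>\<^bsub>F\<^esub>i\<in>{1..k}. S i x)))"

lemma tensor_rank_Least: "tensor_rank F d n Rs T = (LEAST k. rank_decomp F d n Rs k T)"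
  by (simp add: tensor_rank_def rank_decomp_def)

lemma partition_familyD: "partition_family d Rs \<Longrightarrow> P \<in> Rs \<Longrightarrow> partition_on {1..d} P"
  by (simp add: partition_family_def)

lemma grid_restrict: "x \<in> grid A n \<Longrightarrow> J \<subseteq> A \<Longrightarrow> restrict x J \<in> grid J n"
  by (auto simp: grid_def)

lemma partition_on_subset: "partition_on A P \<Longrightarrow> J \<in> P \<Longrightarrow> J \<subseteq> A"
  by (auto simp: partition_on_def)

lemma finite_grid: "finite A \<Longrightarrow> finite (grid A n)"
  by (simp add: grid_def finite_PiE)

lemma (in comm_monoid) finprod_eq_zero_witness:
  assumes "finite A" "j \<in> A" "f \<in> A \<rightarrow> carrier G" "\<And>x. x \<in> carrier G \<Longrightarrow> f j \<otimes> x = f j"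
  shows "finprod G f A = f j"
proof -
  have "finprod G f A = f j \<otimes> finprod G f (A - {j})"
    using finprod_insert[of "A - {j}" j f] assms by (simp add: insert_absorb Pi_def)
  also have "\<dots> = f j" using assms by (intro assms(4) finprod_closed) auto
  finally show ?thesis .
qed

lemma (in field) finprod_zero:
  assumes "finite A" "j \<in> A" "f \<in> A \<rightarrow> carrier R" "f j = \<zero>"
  shows "finprod R f A = \<zero>"
  using finprod_eq_zero_witness[OF assms(1-3)] assms(4) by simp

text \<open>Multiply together the factors whose parts lie in a common part of Q. Since parts are
  non-empty, each part of P lies in exactly one part of Q.\<close>

lemma rank_le_one_coarsen:
  fixes F :: "'a ring"
  assumes "field F" and ref: "refines {1..d} P Q" and S: "rank_le_one F d n {P} S"
  shows "rank_le_one F d n {Q} S"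
proof -
  interpret field F by fact
  obtain a where a: "\<And>J. J \<in> P \<Longrightarrow> a J \<in> grid J n \<rightarrow> carrier F"
    and Sx: "\<And>x. x \<in> grid {1..d} n \<Longrightarrow> S x = (\<Otimes>\<^bsub>F\<^esub>J\<in>P. a J (restrict x J))"
    using S by (auto simp: rank_le_one_def)
  have P: "partition_on {1..d} P" and Q: "partition_on {1..d} Q" and PQ: "\<And>X. X \<in> P \<Longrightarrow> \<exists>Y\<in>Q. X \<subseteq> Y"
    using ref by (auto simp: refines_def)
  have finP: "finite P" and finQ: "finite Q" using finite_elements P Q by blast+
  define b where "b J x = (\<Otimes>\<^bsub>F\<^esub>I\<in>{I\<in>P. I \<subseteq> J}. a I (restrict x I))" for J x
  have "b J \<in> grid J n \<rightarrow> carrier F" for J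
  proof
    fix x assume "x \<in> grid J n"
    then show "b J x \<in> carrier F" unfolding b_def
      using a grid_restrict by (intro finprod_closed) (auto simp: Pi_def)
  qed
  moreover have "S x = (\<Otimes>\<^bsub>F\<^esub>J\<in>Q. b J (restrict x J))" if x: "x \<in> grid {1..d} n" for x
  proof -
    have ac: "a I (restrict x I) \<in> carrier F" if "I \<in> P" for I
      using a[OF that] grid_restrict[OF x partition_on_subset[OF P that]] by auto
    have "P = (\<Union>J\<in>Q. {I\<in>P. I \<subseteq> J})" using PQ by auto
    then have "S x = (\<Otimes>\<^bsub>F\<^esub>I\<in>(\<Union>J\<in>Q. {I\<in>P. I \<subseteq> J}). a I (restrict x I))" using Sx[OF x] by simp
    also have "\<dots> = (\<Otimes>\<^bsub>F\<^esub>J\<in>Q. \<Otimes>\<^bsub>F\<^esub>I\<in>{I\<in>P. I \<subseteq> J}. a I (restrict x I))"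
    proof (rule finprod_UN_disjoint)
      show "pairwise (\<lambda>J K. disjnt {I\<in>P. I \<subseteq> J} {I\<in>P. I \<subseteq> K}) Q"
      proof (rule pairwiseI)
        fix J K assume "J \<in> Q" "K \<in> Q" "J \<noteq> K"
        then have "J \<inter> K = {}" using Q by (auto simp: partition_on_def disjoint_def)
        then have "I = {}" if "I \<subseteq> J" "I \<subseteq> K" for I using that by blast
        moreover have "{} \<notin> P" using P by (simp add: partition_on_def)
        ultimately show "disjnt {I\<in>P. I \<subseteq> J} {I\<in>P. I \<subseteq> K}" by (auto simp: disjnt_def)
      qed
    qed (use finP finQ ac in auto)
    also have "\<dots> = (\<Otimes>\<^bsub>F\<^esub>J\<in>Q. b J (restrict x J))"
    proof (rule finprod_cong')
      fix J assume "J \<in> Q"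
      have "restrict (restrict x J) I = restrict x I" if "I \<subseteq> J" for I
        using that by (auto simp: restrict_def fun_eq_iff)
      then show "(\<Otimes>\<^bsub>F\<^esub>I\<in>{I\<in>P. I \<subseteq> J}. a I (restrict x I)) = b J (restrict x J)"
        unfolding b_def using ac by (intro finprod_cong') auto
    next
      show "(\<lambda>J. b J (restrict x J)) \<in> Q \<rightarrow> carrier F"
      proof
        fix J assume "J \<in> Q"
        then show "b J (restrict x J) \<in> carrier F"
          using \<open>\<And>J. b J \<in> grid J n \<rightarrow> carrier F\<close>[of J] grid_restrict[OF x partition_on_subset[OF Q]] by auto
      qed
    qed simp
    finally show ?thesis .
  qed
  ultimately show ?thesis by (auto simp: rank_le_one_def)
qed

lemma rank_decomp_coarsen:
  fixes F :: "'a ring"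
  assumes "field F" and dec: "rank_decomp F d n Rs k T"
    and ref: "\<And>P. P \<in> Rs \<Longrightarrow> \<exists>Q\<in>Rs'. refines {1..d} P Q"
  shows "rank_decomp F d n Rs' k T"
proof -
  have "rank_le_one F d n Rs' S" if S: "rank_le_one F d n Rs S" for S
  proof -
    obtain P where P: "P \<in> Rs" "rank_le_one F d n {P} S" using S by (auto simp: rank_le_one_def)
    then obtain Q where Q: "Q \<in> Rs'" "refines {1..d} P Q" using ref by blast
    show ?thesis using rank_le_one_coarsen[OF assms(1) Q(2) P(2)] Q(1) by (auto simp: rank_le_one_def)
  qed
  then show ?thesis using dec unfolding rank_decomp_def by blast
qed

text \<open>As 1 \<le> d the partition has a part, so the product has a factor that can be
  zero.\<close>

lemma rank_le_one_zero:
  fixes F :: "'a ring"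
  assumes "field F" "1 \<le> d" "partition_family d Rs"
  shows "rank_le_one F d n Rs (\<lambda>_. \<zero>\<^bsub>F\<^esub>)"
proof -
  interpret field F by fact
  obtain P where P: "P \<in> Rs" "partition_on {1..d} P" using assms(3) by (auto simp: partition_family_def)
  then have fin: "finite P" and ne: "P \<noteq> {}" using finite_elements[OF _ P(2)] assms(2) by (auto simp: partition_on_def)
  then obtain J where "J \<in> P" by blast
  then have "(\<Otimes>\<^bsub>F\<^esub>J\<in>P. \<zero>\<^bsub>F\<^esub>) = \<zero>\<^bsub>F\<^esub>" using fin by (intro finprod_zero) auto
  then show ?thesis using P unfolding rank_le_one_def
    by (intro bexI[of _ P] exI[of _ "\<lambda>_ _. \<zero>\<^bsub>F\<^esub>"]) auto
qed

lemma rank_decomp_mono: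
  fixes F :: "'a ring"
  assumes "field F" "1 \<le> d" "partition_family d Rs" "rank_decomp F d n Rs k T" "k \<le> k'"
  shows "rank_decomp F d n Rs k' T"
proof -
  interpret field F by fact
  show ?thesis using assms(5,4)
  proof (induction rule: dec_induct)
    case (step k)
    obtain S where S: "\<And>i. i \<in> {1..k} \<Longrightarrow> S i \<in> tensors F d n \<and> rank_le_one F d n Rs (S i)"
      "\<And>x. x \<in> grid {1..d} n \<Longrightarrow> T x = (\<Oplus>\<^bsub>F\<^esub>i\<in>{1..k}. S i x)"
      using step.IH[OF step.prems] unfolding rank_decomp_def by blast
    define S' where "S' = S(Suc k := (\<lambda>_. \<zero>\<^bsub>F\<^esub>))"
    have "T x = (\<Oplus>\<^bsub>F\<^esub>i\<in>{1..Suc k}. S' i x)" if x: "x \<in> grid {1..d} n" for x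
    proof -
      have car: "S i x \<in> carrier F" if "i \<in> {1..k}" for i using S(1)[OF that] x by (auto simp: tensors_def)
      have "{1..Suc k} = insert (Suc k) {1..k}" by auto
      then have "(\<Oplus>\<^bsub>F\<^esub>i\<in>{1..Suc k}. S' i x) = \<zero>\<^bsub>F\<^esub> \<oplus>\<^bsub>F\<^esub> (\<Oplus>\<^bsub>F\<^esub>i\<in>{1..k}. S' i x)"
        using car by (simp add: S'_def)
      also have "(\<Oplus>\<^bsub>F\<^esub>i\<in>{1..k}. S' i x) = (\<Oplus>\<^bsub>F\<^esub>i\<in>{1..k}. S i x)"
        using car by (intro finsum_cong') (auto simp: S'_def)
      finally show ?thesis using S(2)[OF x] car by simp
    qed
    moreover have "S' i \<in> tensors F d n \<and> rank_le_one F d n Rs (S' i)" if "i \<in> {1..Suc k}" for i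
      using S(1)[of i] that rank_le_one_zero[OF assms(1-3)] by (auto simp: S'_def tensors_def)
    ultimately show ?case unfolding rank_decomp_def by blast
  qed
qed

text \<open>The indicator of z factors along every partition into the indicators of the restrictions
  of z; the value c is put into one of the factors.\<close>

lemma rank_le_one_delta:
  fixes F :: "'a ring"
  assumes "field F" "1 \<le> d" "partition_family d Rs" and z: "z \<in> grid {1..d} n" and c: "c \<in> carrier F"
  shows "rank_le_one F d n Rs (\<lambda>x. if x = z then c else \<zero>\<^bsub>F\<^esub>)"
proof -
  interpret field F by fact
  obtain P where P: "P \<in> Rs" "partition_on {1..d} P" using assms(3) by (auto simp: partition_family_def)
  then have fin: "finite P" and ne: "P \<noteq> {}" using finite_elements[OF _ P(2)] assms(2) by (auto simp: partition_on_def)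
  then obtain J0 where J0: "J0 \<in> P" by blast
  define a where "a J y = (if y = restrict z J then (if J0 = J then c else \<one>\<^bsub>F\<^esub>) else \<zero>\<^bsub>F\<^esub>)" for J y
  have ac: "a J y \<in> carrier F" for J y using c by (simp add: a_def)
  have "(if x = z then c else \<zero>\<^bsub>F\<^esub>) = (\<Otimes>\<^bsub>F\<^esub>J\<in>P. a J (restrict x J))" if x: "x \<in> grid {1..d} n" for x
  proof (cases "x = z")
    case True
    then show ?thesis using finprod_singleton[OF J0 fin, of "\<lambda>_. c"] c by (simp add: a_def)
  next
    case False
    then obtain j where j: "j \<in> {1..d}" "x j \<noteq> z j"
      using x z unfolding grid_def by (metis PiE_ext)
    then obtain J where J: "J \<in> P" "j \<in> J" using P(2) unfolding partition_on_def by blast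
    then have "restrict x J \<noteq> restrict z J" using j(2) by (metis restrict_apply')
    then have "(\<Otimes>\<^bsub>F\<^esub>J\<in>P. a J (restrict x J)) = \<zero>\<^bsub>F\<^esub>"
      using J(1) ac by (intro finprod_zero[OF fin J(1)]) (auto simp: a_def)
    then show ?thesis using False by simp
  qed
  then show ?thesis unfolding rank_le_one_def using P(1) ac by (intro bexI[of _ P] exI[of _ a]) auto
qed

text \<open>T is the sum of its single entries. Without some decomposition the LEAST in
  \<open>tensor_rank\<close> would be unspecified.\<close>

lemma rank_decomp_exists:
  fixes F :: "'a ring"
  assumes "field F" "1 \<le> d" "partition_family d Rs" and T: "T \<in> tensors F d n"
  shows "\<exists>k. rank_decomp F d n Rs k T"
proof -
  interpret field F by fact
  have fin: "finite (grid {1..d} n)" by (simp add: finite_grid)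
  obtain z where z: "bij_betw z {1..card (grid {1..d} n)} (grid {1..d} n)"
    using ex_bij_betw_nat_finite_1[OF fin] by blast
  let ?k = "card (grid {1..d} n)"
  define S where "S i x = (if x = z i then T (z i) else \<zero>\<^bsub>F\<^esub>)" for i x
  have Tc: "T x \<in> carrier F" if "x \<in> grid {1..d} n" for x using T that by (auto simp: tensors_def)
  have zi: "z i \<in> grid {1..d} n" if "i \<in> {1..?k}" for i using z that by (auto simp: bij_betw_def)
  have "T x = (\<Oplus>\<^bsub>F\<^esub>i\<in>{1..?k}. S i x)" if x: "x \<in> grid {1..d} n" for x
  proof -
    have "(\<Oplus>\<^bsub>F\<^esub>i\<in>{1..?k}. S i x) = (\<Oplus>\<^bsub>F\<^esub>y\<in>z ` {1..?k}. if x = y then T y else \<zero>\<^bsub>F\<^esub>)"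
      using z zi Tc by (subst finsum_reindex) (auto simp: bij_betw_def S_def)
    also have "z ` {1..?k} = grid {1..d} n" using z by (simp add: bij_betw_def)
    also have "(\<Oplus>\<^bsub>F\<^esub>y\<in>grid {1..d} n. if x = y then T y else \<zero>\<^bsub>F\<^esub>) = T x"
      using fin x Tc by (intro finsum_singleton) auto
    finally show ?thesis by simp
  qed
  moreover have "S i \<in> tensors F d n \<and> rank_le_one F d n Rs (S i)" if "i \<in> {1..?k}" for i
    using rank_le_one_delta[OF assms(1-3) zi[OF that] Tc[OF zi[OF that]]] Tc[OF zi[OF that]]
    by (auto simp: tensors_def S_def[abs_def])
  ultimately show ?thesis unfolding rank_decomp_def by blast
qed

lemma tensor_rank_le_iff:
  fixes F :: "'a ring"
  assumes "field F" "1 \<le> d" "partition_family d Rs" "T \<in> tensors F d n"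
  shows "tensor_rank F d n Rs T \<le> k \<longleftrightarrow> rank_decomp F d n Rs k T"
proof
  have "rank_decomp F d n Rs (tensor_rank F d n Rs T) T"
    unfolding tensor_rank_Least using rank_decomp_exists[OF assms] by (rule LeastI_ex)
  then show "tensor_rank F d n Rs T \<le> k \<Longrightarrow> rank_decomp F d n Rs k T"
    using rank_decomp_mono[OF assms(1-3)] by blast
qed (simp add: tensor_rank_Least Least_le)

text \<open>Points of the grid are parametrised by arbitrary functions, so that tensors become total functions.\<close>

definition grid_point :: "nat \<Rightarrow> (nat \<Rightarrow> nat) \<Rightarrow> (nat \<Rightarrow> nat) \<Rightarrow> nat \<Rightarrow> nat" where
  "grid_point d n x = restrict (\<lambda>j. if x j \<in> {1..n j} then x j else 1) {1..d}"

lemma grid_point_in: "(\<And>j. j \<in> {1..d} \<Longrightarrow> 1 \<le> n j) \<Longrightarrow> grid_point d n x \<in> grid {1..d} n"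
  by (auto simp: grid_point_def grid_def)

lemma grid_point_id: "x \<in> grid {1..d} n \<Longrightarrow> grid_point d n x = x"
  by (rule ext) (auto simp: grid_point_def grid_def restrict_def PiE_def extensional_def Pi_def)

text \<open>The factors become total functions, so the theory of spans applies to tensors. The
  equation is stated at \<open>grid_point d n x\<close>, which lies in the grid as all lengths are
  positive; it therefore holds for every x.\<close>

lemma rank_decomp_total:
  fixes F :: "'a ring"
  assumes "field F" "partition_family d Rs" and n: "\<And>j. j \<in> {1..d} \<Longrightarrow> 1 \<le> n j"
    and dec: "rank_decomp F d n Rs k T"
  obtains P a where "\<And>i. i \<in> {1..k} \<Longrightarrow> P i \<in> Rs"
    "\<And>i J. i \<in> {1..k} \<Longrightarrow> J \<in> P i \<Longrightarrow> a i J \<in> field.coord_funs F J"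
    "\<And>x. T (grid_point d n x) = (\<Oplus>\<^bsub>F\<^esub>i\<in>{1..k}. \<Otimes>\<^bsub>F\<^esub>J\<in>P i. a i J x)"
proof -
  interpret field F by fact
  obtain S where S: "\<And>i. i \<in> {1..k} \<Longrightarrow> rank_le_one F d n Rs (S i)"
    and T: "\<And>x. x \<in> grid {1..d} n \<Longrightarrow> T x = (\<Oplus>\<^bsub>F\<^esub>i\<in>{1..k}. S i x)"
    using dec unfolding rank_decomp_def by blast
  have "\<forall>i\<in>{1..k}. \<exists>Pa. fst Pa \<in> Rs \<and> (\<forall>J\<in>fst Pa. snd Pa J \<in> grid J n \<rightarrow> carrier F) \<and>
      (\<forall>x\<in>grid {1..d} n. S i x = (\<Otimes>\<^bsub>F\<^esub>J\<in>fst Pa. snd Pa J (restrict x J)))"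
  proof
    fix i assume "i \<in> {1..k}"
    then obtain P a where "P \<in> Rs" "\<forall>J\<in>P. a J \<in> grid J n \<rightarrow> carrier F"
      "\<forall>x\<in>grid {1..d} n. S i x = (\<Otimes>\<^bsub>F\<^esub>J\<in>P. a J (restrict x J))"
      using S unfolding rank_le_one_def by blast
    then show "\<exists>Pa. fst Pa \<in> Rs \<and> (\<forall>J\<in>fst Pa. snd Pa J \<in> grid J n \<rightarrow> carrier F) \<and>
      (\<forall>x\<in>grid {1..d} n. S i x = (\<Otimes>\<^bsub>F\<^esub>J\<in>fst Pa. snd Pa J (restrict x J)))"
      by (intro exI[of _ "(P, a)"]) simp
  qed
  from bchoice[OF this] obtain Pa where Pa: "\<forall>i\<in>{1..k}. fst (Pa i) \<in> Rs \<and>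
      (\<forall>J\<in>fst (Pa i). snd (Pa i) J \<in> grid J n \<rightarrow> carrier F) \<and>
      (\<forall>x\<in>grid {1..d} n. S i x = (\<Otimes>\<^bsub>F\<^esub>J\<in>fst (Pa i). snd (Pa i) J (restrict x J)))" ..
  define P a where "P i = fst (Pa i)" and "a i = snd (Pa i)" for i
  have P: "P i \<in> Rs" and a: "\<And>J. J \<in> P i \<Longrightarrow> a i J \<in> grid J n \<rightarrow> carrier F"
    and Sx: "\<And>x. x \<in> grid {1..d} n \<Longrightarrow> S i x = (\<Otimes>\<^bsub>F\<^esub>J\<in>P i. a i J (restrict x J))"
    if "i \<in> {1..k}" for i
    using Pa that by (simp_all add: P_def a_def)
  define b where "b i J x = a i J (restrict (grid_point d n x) J)" for i J x
  have b: "b i J \<in> coord_funs J" if i: "i \<in> {1..k}" and J: "J \<in> P i" for i J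
  proof (rule coord_funsI)
    have Jd: "J \<subseteq> {1..d}" using partition_on_subset[OF partition_familyD[OF assms(2) P[OF i]] J] .
    have "restrict (grid_point d n x) J \<in> grid J n" for x
      using Jd by (rule grid_restrict[OF grid_point_in[OF n], rotated])
    then show "b i J x \<in> carrier F" for x using a[OF i J] by (auto simp: b_def)
    fix x y :: "nat \<Rightarrow> nat" assume "\<And>j. j \<in> J \<Longrightarrow> x j = y j"
    then have "restrict (grid_point d n x) J = restrict (grid_point d n y) J"
      by (auto simp: grid_point_def restrict_def fun_eq_iff)
    then show "b i J x = b i J y" by (simp add: b_def)
  qed
  have "T (grid_point d n x) = (\<Oplus>\<^bsub>F\<^esub>i\<in>{1..k}. \<Otimes>\<^bsub>F\<^esub>J\<in>P i. b i J x)" for x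
  proof -
    have "T (grid_point d n x) = (\<Oplus>\<^bsub>F\<^esub>i\<in>{1..k}. S i (grid_point d n x))"
      by (rule T[OF grid_point_in[OF n]])
    also have "\<dots> = (\<Oplus>\<^bsub>F\<^esub>i\<in>{1..k}. \<Otimes>\<^bsub>F\<^esub>J\<in>P i. b i J x)"
    proof (rule finsum_cong')
      show "S i (grid_point d n x) = (\<Otimes>\<^bsub>F\<^esub>J\<in>P i. b i J x)" if "i \<in> {1..k}" for i
        using Sx[OF that grid_point_in[OF n]] by (simp add: b_def)
      show "(\<lambda>i. \<Otimes>\<^bsub>F\<^esub>J\<in>P i. b i J x) \<in> {1..k} \<rightarrow> carrier F"
        using b coord_funs_carrier by (intro Pi_I finprod_closed) blast
    qed simp
    finally show ?thesis .
  qed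
  then show thesis using that[of P b] P b by blast
qed

text \<open>The way back from total functions: a function of the coordinates in J is unchanged when
  its argument is restricted to J.\<close>

lemma rank_decompI:
  fixes F :: "'a ring"
  assumes "field F"
    and P: "\<And>i. i \<in> {1..k} \<Longrightarrow> P i \<in> Rs"
    and a: "\<And>i J. i \<in> {1..k} \<Longrightarrow> J \<in> P i \<Longrightarrow> a i J \<in> field.coord_funs F J"
    and T: "\<And>x. x \<in> grid {1..d} n \<Longrightarrow> T x = (\<Oplus>\<^bsub>F\<^esub>i\<in>{1..k}. \<Otimes>\<^bsub>F\<^esub>J\<in>P i. a i J x)"
  shows "rank_decomp F d n Rs k T"
  unfolding rank_decomp_def
proof (intro exI[of _ "\<lambda>i x. \<Otimes>\<^bsub>F\<^esub>J\<in>P i. a i J x"] conjI ballI T)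
  interpret field F by fact
  fix i assume i: "i \<in> {1..k}"
  have car: "a i J x \<in> carrier F" if "J \<in> P i" for J x using a[OF i that] coord_funs_carrier by blast
  show "(\<lambda>x. \<Otimes>\<^bsub>F\<^esub>J\<in>P i. a i J x) \<in> tensors F d n"
    unfolding tensors_def using car by (intro Pi_I finprod_closed) auto
  have "a i J (restrict x J) = a i J x" if "J \<in> P i" for J x
    by (rule coord_funsD[OF a[OF i that]]) simp
  then have "(\<Otimes>\<^bsub>F\<^esub>J\<in>P i. a i J x) = (\<Otimes>\<^bsub>F\<^esub>J\<in>P i. a i J (restrict x J))" for x
    using car by (intro finprod_cong') auto
  then show "rank_le_one F d n Rs (\<lambda>x. \<Otimes>\<^bsub>F\<^esub>J\<in>P i. a i J x)"
    unfolding rank_le_one_def using P[OF i] car by (intro bexI[of _ "P i"] exI[of _ "a i"]) auto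
qed auto

section \<open>Limits of sequences of fields\<close>

definition seq_ring :: "(nat \<Rightarrow> 'b ring) \<Rightarrow> (nat \<Rightarrow> 'b) ring" where
  "seq_ring F = \<lparr>carrier = {u. \<forall>m. u m \<in> carrier (F m)},
     monoid.mult = (\<lambda>u v m. u m \<otimes>\<^bsub>F m\<^esub> v m), monoid.one = (\<lambda>m. \<one>\<^bsub>F m\<^esub>),
     ring.zero = (\<lambda>m. \<zero>\<^bsub>F m\<^esub>), ring.add = (\<lambda>u v m. u m \<oplus>\<^bsub>F m\<^esub> v m)\<rparr>"

lemma seq_ring_simps [simp]:
  "carrier (seq_ring F) = {u. \<forall>m. u m \<in> carrier (F m)}"
  "u \<otimes>\<^bsub>seq_ring F\<^esub> v = (\<lambda>m. u m \<otimes>\<^bsub>F m\<^esub> v m)"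
  "u \<oplus>\<^bsub>seq_ring F\<^esub> v = (\<lambda>m. u m \<oplus>\<^bsub>F m\<^esub> v m)"
  "\<one>\<^bsub>seq_ring F\<^esub> = (\<lambda>m. \<one>\<^bsub>F m\<^esub>)"
  "\<zero>\<^bsub>seq_ring F\<^esub> = (\<lambda>m. \<zero>\<^bsub>F m\<^esub>)"
  by (simp_all add: seq_ring_def)

lemma cring_seq_ring:
  assumes "\<And>m. cring (F m)" shows "cring (seq_ring F)"
proof (rule cringI)
  have ag: "abelian_group (F m)" and cm: "comm_monoid (F m)" for m
    using assms cring.axioms(1)[OF assms] by (auto simp: ring_def cring_def intro: comm_monoid.intro)
  show "abelian_group (seq_ring F)"
  proof (rule abelian_groupI)
    fix u assume "u \<in> carrier (seq_ring F)"
    then show "\<exists>v\<in>carrier (seq_ring F). v \<oplus>\<^bsub>seq_ring F\<^esub> u = \<zero>\<^bsub>seq_ring F\<^esub>"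
      using ag by (intro bexI[of _ "\<lambda>m. \<ominus>\<^bsub>F m\<^esub> u m"])
        (auto simp: abelian_group.l_neg abelian_group.a_inv_closed)
  qed (auto simp: fun_eq_iff cring.cring_simprules[OF assms])
  show "comm_monoid (seq_ring F)"
    using cring.cring_simprules(5,6,11,12,14)[OF assms]
    by (intro comm_monoidI) (auto simp: fun_eq_iff)
qed (use cring.cring_simprules(13)[OF assms] in \<open>auto simp: fun_eq_iff\<close>)

lemma finsum_seq_ring:
  assumes "\<And>m. cring (F m)" "f \<in> A \<rightarrow> carrier (seq_ring F)"
  shows "finsum (seq_ring F) f A = (\<lambda>m. finsum (F m) (\<lambda>i. f i m) A)"
  using assms(2)
proof (induction A rule: infinite_finite_induct)
  interpret S: cring "seq_ring F" by (rule cring_seq_ring[OF assms(1)])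
  have am: "abelian_monoid (F m)" for m using assms(1)[of m] by (simp add: cring_def ring_def abelian_group_def)
  case (infinite A)
  then show ?case by (simp add: S.finsum_infinite abelian_monoid.finsum_infinite[OF am])
next
  interpret S: cring "seq_ring F" by (rule cring_seq_ring[OF assms(1)])
  have am: "abelian_monoid (F m)" for m using assms(1)[of m] by (simp add: cring_def ring_def abelian_group_def)
  case empty
  then show ?case by (simp add: abelian_monoid.finsum_empty[OF am])
next
  interpret S: cring "seq_ring F" by (rule cring_seq_ring[OF assms(1)])
  have am: "abelian_monoid (F m)" for m using assms(1)[of m] by (simp add: cring_def ring_def abelian_group_def)
  case (insert i A)
  then show ?case by (simp add: Pi_def abelian_monoid.finsum_insert[OF am])
qed

lemma finprod_seq_ring:
  assumes "\<And>m. cring (F m)" "f \<in> A \<rightarrow> carrier (seq_ring F)"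
  shows "finprod (seq_ring F) f A = (\<lambda>m. finprod (F m) (\<lambda>i. f i m) A)"
  using assms(2)
proof (induction A rule: infinite_finite_induct)
  interpret S: cring "seq_ring F" by (rule cring_seq_ring[OF assms(1)])
  have am: "comm_monoid (F m)" for m using assms(1)[of m] by (simp add: cring_def)
  case (infinite A)
  then show ?case by (simp add: S.finprod_infinite comm_monoid.finprod_infinite[OF am])
next
  interpret S: cring "seq_ring F" by (rule cring_seq_ring[OF assms(1)])
  have am: "comm_monoid (F m)" for m using assms(1)[of m] by (simp add: cring_def)
  case empty
  then show ?case by (simp add: comm_monoid.finprod_empty[OF am])
next
  interpret S: cring "seq_ring F" by (rule cring_seq_ring[OF assms(1)])
  have am: "comm_monoid (F m)" for m using assms(1)[of m] by (simp add: cring_def)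
  case (insert i A)
  then show ?case by (simp add: Pi_def comm_monoid.finprod_insert[OF am])
qed

text \<open>The union of a chain of ideals that avoid 1 avoids 1, so Zorn applies, and every proper
  ideal avoids 1.\<close>

lemma (in cring) exists_maximalideal:
  assumes I: "ideal I R" "\<one> \<notin> I"
  obtains M where "maximalideal M R" "I \<subseteq> M"
proof -
  define \<A> where "\<A> = {J. ideal J R \<and> I \<subseteq> J \<and> \<one> \<notin> J}"
  have "\<exists>M\<in>\<A>. \<forall>X\<in>\<A>. M \<subseteq> X \<longrightarrow> X = M"
  proof (rule subset_Zorn_nonempty)
    show "\<A> \<noteq> {}" using I by (auto simp: \<A>_def)
    fix \<C> assume ne: "\<C> \<noteq> {}" and ch: "subset.chain \<A> \<C>"
    then have "subset.chain {I. ideal I R} \<C>" by (auto simp: subset_chain_def \<A>_def)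
    from chain_Union_is_ideal[OF this] ne have "ideal (\<Union>\<C>) R" by simp
    then show "\<Union>\<C> \<in> \<A>" using ch ne unfolding \<A>_def subset_chain_def by blast
  qed
  then obtain M where M: "ideal M R" "I \<subseteq> M" "\<one> \<notin> M"
    and max: "\<And>X. ideal X R \<Longrightarrow> M \<subseteq> X \<Longrightarrow> \<one> \<notin> X \<Longrightarrow> X = M"
    unfolding \<A>_def by auto
  have "maximalideal M R"
  proof (rule maximalidealI[OF M(1)])
    show "carrier R \<noteq> M" using M(3) by auto
    fix J assume J: "ideal J R" "M \<subseteq> J"
    then show "J = M \<or> J = carrier R"
      using max[OF J] ideal.one_imp_carrier[OF J(1)] by blast
  qed
  then show thesis using that M(2) by blast
qed

text \<open>A maximal ideal containing the finitely supported sequences plays the role of a free ultrafilter: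
  a sequence in it vanishes infinitely often, as otherwise it would differ from a unit by a finitely
  supported sequence.\<close>

lemma exists_limit_field:
  fixes F :: "nat \<Rightarrow> 'b ring"
  assumes F: "\<And>m. field (F m)"
  obtains K :: "(nat \<Rightarrow> 'b) set ring" and \<phi> where "field K" "ring_hom_cring (seq_ring F) K \<phi>"
    "\<phi> ` carrier (seq_ring F) = carrier K"
    "\<And>u. u \<in> carrier (seq_ring F) \<Longrightarrow> \<phi> u = \<zero>\<^bsub>K\<^esub> \<Longrightarrow> infinite {m. u m = \<zero>\<^bsub>F m\<^esub>}"
proof -
  have cr: "\<And>m. cring (F m)" using F by (simp add: field_def domain_def)
  interpret S: cring "seq_ring F" by (rule cring_seq_ring[OF cr])
  define I where "I = {u \<in> carrier (seq_ring F). finite {m. u m \<noteq> \<zero>\<^bsub>F m\<^esub>}}"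
  have minus: "\<ominus>\<^bsub>seq_ring F\<^esub> u = (\<lambda>m. \<ominus>\<^bsub>F m\<^esub> u m)" if "u \<in> carrier (seq_ring F)" for u
    using that cring.cring_simprules(3,9)[OF cr] by (intro S.minus_equality) (auto simp: fun_eq_iff)
  have "ideal I (seq_ring F)"
  proof (rule idealI)
    show "ring (seq_ring F)" by (rule S.ring_axioms)
    show "subgroup I (add_monoid (seq_ring F))"
    proof (rule S.add.subgroupI)
      show "I \<subseteq> carrier (seq_ring F)" by (auto simp: I_def)
      have "\<zero>\<^bsub>seq_ring F\<^esub> \<in> I" using S.zero_closed by (simp add: I_def)
      then show "I \<noteq> {}" by blast
      fix u assume u: "u \<in> I"
      have "\<ominus>\<^bsub>seq_ring F\<^esub> u \<in> carrier (seq_ring F)" using u by (intro S.a_inv_closed) (simp add: I_def)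
      moreover have "{m. \<ominus>\<^bsub>F m\<^esub> u m \<noteq> \<zero>\<^bsub>F m\<^esub>} \<subseteq> {m. u m \<noteq> \<zero>\<^bsub>F m\<^esub>}"
        using ring.minus_zero[OF cring.axioms(1)[OF cr]] by auto
      ultimately show "\<ominus>\<^bsub>seq_ring F\<^esub> u \<in> I"
        using u minus[of u] by (auto simp: I_def intro: finite_subset)
      fix v assume v: "v \<in> I"
      have "u \<oplus>\<^bsub>seq_ring F\<^esub> v \<in> carrier (seq_ring F)" using u v by (intro S.a_closed) (simp_all add: I_def)
      moreover have "{m. u m \<oplus>\<^bsub>F m\<^esub> v m \<noteq> \<zero>\<^bsub>F m\<^esub>} \<subseteq> {m. u m \<noteq> \<zero>\<^bsub>F m\<^esub>} \<union> {m. v m \<noteq> \<zero>\<^bsub>F m\<^esub>}"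
        using cring.cring_simprules(2,8)[OF cr] by auto
      ultimately show "u \<oplus>\<^bsub>seq_ring F\<^esub> v \<in> I"
        using u v by (auto simp: I_def intro: finite_subset)
    qed
    fix u v assume u: "u \<in> I" and v: "v \<in> carrier (seq_ring F)"
    have fin: "finite {m. u m \<noteq> \<zero>\<^bsub>F m\<^esub>}" using u by (simp add: I_def)
    have "v \<otimes>\<^bsub>seq_ring F\<^esub> u \<in> carrier (seq_ring F)" "u \<otimes>\<^bsub>seq_ring F\<^esub> v \<in> carrier (seq_ring F)"
      using u v by (auto intro!: S.m_closed simp del: seq_ring_simps simp: I_def)
    moreover have "{m. v m \<otimes>\<^bsub>F m\<^esub> u m \<noteq> \<zero>\<^bsub>F m\<^esub>} \<subseteq> {m. u m \<noteq> \<zero>\<^bsub>F m\<^esub>}"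
      "{m. u m \<otimes>\<^bsub>F m\<^esub> v m \<noteq> \<zero>\<^bsub>F m\<^esub>} \<subseteq> {m. u m \<noteq> \<zero>\<^bsub>F m\<^esub>}"
      using v by (auto simp: cring.cring_simprules(26,27)[OF cr])
    ultimately show "v \<otimes>\<^bsub>seq_ring F\<^esub> u \<in> I" "u \<otimes>\<^bsub>seq_ring F\<^esub> v \<in> I"
      using finite_subset[OF _ fin] by (simp_all add: I_def)
  qed
  moreover have ne: "\<one>\<^bsub>F m\<^esub> \<noteq> \<zero>\<^bsub>F m\<^esub>" for m
    using F[of m] by (simp add: field_def domain_def domain_axioms_def)
  then have "\<one>\<^bsub>seq_ring F\<^esub> \<notin> I" by (simp add: I_def)
  ultimately obtain M where M: "maximalideal M (seq_ring F)" "I \<subseteq> M"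
    using S.exists_maximalideal by blast
  interpret M: maximalideal M "seq_ring F" by (rule M(1))
  have field: "field (seq_ring F Quot M)" by (rule M.quotient_is_field[OF S.is_cring])
  have hom: "ring_hom_cring (seq_ring F) (seq_ring F Quot M) ((+>\<^bsub>seq_ring F\<^esub>) M)"
    by (rule M.rcos_ring_hom_cring[OF S.is_cring])
  have "infinite {m. u m = \<zero>\<^bsub>F m\<^esub>}"
    if u: "u \<in> carrier (seq_ring F)" and z: "M +>\<^bsub>seq_ring F\<^esub> u = \<zero>\<^bsub>seq_ring F Quot M\<^esub>" for u
  proof
    assume fin: "finite {m. u m = \<zero>\<^bsub>F m\<^esub>}"
    \<comment> \<open>e is 1 at the finitely many zeros of u and 0 elsewhere; then u + e is a unit
      with inverse v.\<close>
    define e where "e m = (if u m = \<zero>\<^bsub>F m\<^esub> then \<one>\<^bsub>F m\<^esub> else \<zero>\<^bsub>F m\<^esub>)" for m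
    define v where "v m = (if u m = \<zero>\<^bsub>F m\<^esub> then \<one>\<^bsub>F m\<^esub> else inv\<^bsub>F m\<^esub> u m)" for m
    have ec: "e \<in> carrier (seq_ring F)" using cring.cring_simprules(2,6)[OF cr] by (simp add: e_def)
    have inv: "inv\<^bsub>F m\<^esub> u m \<in> carrier (F m)" "u m \<otimes>\<^bsub>F m\<^esub> inv\<^bsub>F m\<^esub> u m = \<one>\<^bsub>F m\<^esub>"
      if "u m \<noteq> \<zero>\<^bsub>F m\<^esub>" for m
    proof -
      interpret Fm: field "F m" by (rule F)
      have "u m \<in> Units (F m)" using that u by (simp add: Fm.field_Units)
      then show "inv\<^bsub>F m\<^esub> u m \<in> carrier (F m)" "u m \<otimes>\<^bsub>F m\<^esub> inv\<^bsub>F m\<^esub> u m = \<one>\<^bsub>F m\<^esub>" by auto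
    qed
    have vc: "v \<in> carrier (seq_ring F)" using inv(1) cring.cring_simprules(6)[OF cr] by (simp add: v_def)
    have "{m. e m \<noteq> \<zero>\<^bsub>F m\<^esub>} \<subseteq> {m. u m = \<zero>\<^bsub>F m\<^esub>}" by (auto simp: e_def)
    then have "e \<in> I" using ec finite_subset[OF _ fin] by (simp add: I_def)
    then have "e \<in> M" using M(2) by blast
    moreover have "u \<in> M" using z M.rcos_const_imp_mem[OF u] by (simp add: FactRing_def)
    ultimately have "u \<oplus>\<^bsub>seq_ring F\<^esub> e \<in> M" by (rule M.a_closed[rotated])
    then have "(u \<oplus>\<^bsub>seq_ring F\<^esub> e) \<otimes>\<^bsub>seq_ring F\<^esub> v \<in> M" using vc by (rule M.I_r_closed)
    moreover have "(u m \<oplus>\<^bsub>F m\<^esub> e m) \<otimes>\<^bsub>F m\<^esub> v m = \<one>\<^bsub>F m\<^esub>" for m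
    proof -
      interpret Fm: field "F m" by (rule F)
      show ?thesis using u inv(2)[of m] by (simp add: e_def v_def)
    qed
    ultimately have "\<one>\<^bsub>seq_ring F\<^esub> \<in> M" by simp
    then show False using M.one_imp_carrier M.I_notcarr by simp
  qed
  moreover have "(+>\<^bsub>seq_ring F\<^esub>) M ` carrier (seq_ring F) = carrier (seq_ring F Quot M)"
    by (auto simp: FactRing_def A_RCOSETS_def')
  ultimately show thesis using that field hom by blast
qed

section \<open>Elements of spans as explicit sums\<close>

context field
begin

lemma fun_subspace_finsum:
  assumes V: "fun_subspace V" and f: "\<And>i. i \<in> A \<Longrightarrow> f i \<in> V"
  shows "(\<lambda>x. \<Oplus>i\<in>A. f i x) \<in> V"
  using f
proof (induction A rule: infinite_finite_induct)
  case (insert i A)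
  have "(\<lambda>x. f i x \<oplus> (\<Oplus>i\<in>A. f i x)) \<in> V"
    using insert by (intro fun_subspace_add[OF V]) auto
  moreover have "f j x \<in> carrier R" if "j \<in> insert i A" for j x
    using fun_subspace_scalar[OF V insert.prems[OF that]] .
  then have "(\<lambda>x. f i x \<oplus> (\<Oplus>i\<in>A. f i x)) = (\<lambda>x. \<Oplus>i\<in>insert i A. f i x)"
    using insert.hyps by (intro ext) (simp add: Pi_def)
  ultimately show ?case by simp
qed (simp_all add: finsum_infinite fun_subspace_zero[OF V])

text \<open>The scalar is absorbed in one factor, which exists as P is non-empty.\<close>

lemma part_prods_smult:
  assumes M: "coord_subspaces M" and P: "finite P" "P \<noteq> {}" and c: "c \<in> carrier R" and f: "f \<in> part_prods M P"
  shows "(\<lambda>x. c \<otimes> f x) \<in> part_prods M P"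
proof -
  obtain I where I: "I \<in> P" using P by auto
  obtain a u where au: "a \<in> M I" "u \<in> part_prods M (P - {I})" "f = (\<lambda>x. a x \<otimes> u x)"
    using part_prods_removeE[OF f M P(1) I] by blast
  have "(\<lambda>x. c \<otimes> a x) \<in> M I"
    using coord_subspacesD(2)[OF M] c au(1) by (rule fun_subspace_smult)
  then have "(\<lambda>x. (c \<otimes> a x) \<otimes> u x) \<in> part_prods M (insert I (P - {I}))"
    using P au(2) by (intro part_prods_insertI[OF _ _ M]) auto
  moreover have "u \<in> scalar_funs" using au(2) part_prods_scalar[OF M, of "{P - {I}}"] by auto
  then have "(\<lambda>x. (c \<otimes> a x) \<otimes> u x) = (\<lambda>x. c \<otimes> f x)"
    using c coord_funs_carrier[OF coord_subspacesD(1)[OF M au(1)]]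
    by (auto simp: au(3) fun_eq_iff m_assoc scalar_funs_def)
  ultimately show ?thesis using I by (simp add: insert_absorb)
qed

text \<open>With the scalars absorbed in the factors, N counts summands of the kind that the rank
  counts; it becomes the bound in the limit argument.\<close>

lemma prod_span_sum:
  assumes M: "coord_subspaces M" and Rs: "\<And>P. P \<in> Rs \<Longrightarrow> finite P \<and> P \<noteq> {}" and f: "f \<in> prod_span M Rs"
  obtains N :: nat and P a where "\<And>i. i \<in> {1..N} \<Longrightarrow> P i \<in> Rs"
    "\<And>i J. i \<in> {1..N} \<Longrightarrow> J \<in> P i \<Longrightarrow> a i J \<in> M J"
    "f = (\<lambda>x. \<Oplus>i\<in>{1..N}. \<Otimes>J\<in>P i. a i J x)"
proof -
  define Q where "Q f N P a \<longleftrightarrow> (\<forall>i\<in>{1..N}. P i \<in> Rs \<and> (\<forall>J\<in>P i. a i J \<in> M J)) \<and>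
    f = (\<lambda>x. \<Oplus>i\<in>{1..N}. \<Otimes>J\<in>P i. a i J x)" for f and N :: nat and P a
  have "\<exists>N P a. Q f N P a"
    using f unfolding prod_span_def
  proof (induction rule: lspan.induct)
    case zero
    show ?case by (intro exI[of _ 0]) (simp add: Q_def)
  next
    case (step c k g)
    then obtain N P a where g: "Q g N P a" by blast
    obtain P0 where P0: "P0 \<in> Rs" "k \<in> part_prods M P0" using step by blast
    then obtain a0 where a0: "\<forall>J\<in>P0. a0 J \<in> M J" "(\<lambda>x. c \<otimes> k x) = (\<lambda>x. \<Otimes>J\<in>P0. a0 J x)"
      using part_prods_smult[OF M _ _ step(1) P0(2)] Rs[OF P0(1)] unfolding part_prods_def by auto
    define P' a' where "P' = P(Suc N := P0)" and "a' = a(Suc N := a0)"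
    have car: "(\<Otimes>J\<in>P' i. a' i J x) \<in> carrier R" if "i \<in> {1..Suc N}" for i x
    proof (rule finprod_closed, rule Pi_I)
      fix J assume "J \<in> P' i"
      then have "a' i J \<in> M J" using that g a0 by (auto simp: Q_def P'_def a'_def split: if_splits)
      then show "a' i J x \<in> carrier R" using coord_funs_carrier coord_subspacesD(1)[OF M] by blast
    qed
    have "c \<otimes> k x \<oplus> g x = (\<Oplus>i\<in>{1..Suc N}. \<Otimes>J\<in>P' i. a' i J x)" for x
    proof -
      have "{1..Suc N} = insert (Suc N) {1..N}" by auto
      then have "(\<Oplus>i\<in>{1..Suc N}. \<Otimes>J\<in>P' i. a' i J x) =
          (\<Otimes>J\<in>P' (Suc N). a' (Suc N) J x) \<oplus> (\<Oplus>i\<in>{1..N}. \<Otimes>J\<in>P' i. a' i J x)"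
        using car by simp
      also have "(\<Otimes>J\<in>P' (Suc N). a' (Suc N) J x) = c \<otimes> k x"
        using a0(2) by (simp add: P'_def a'_def fun_eq_iff)
      also have "(\<Oplus>i\<in>{1..N}. \<Otimes>J\<in>P' i. a' i J x) = g x"
      proof -
        have "(\<Otimes>J\<in>P i. a i J x) \<in> carrier R" if "i \<in> {1..N}" for i
          using car[of i x] that by (simp add: P'_def a'_def)
        then have "(\<Oplus>i\<in>{1..N}. \<Otimes>J\<in>P' i. a' i J x) = (\<Oplus>i\<in>{1..N}. \<Otimes>J\<in>P i. a i J x)"
          by (intro finsum_cong') (auto simp: P'_def a'_def)
        then show ?thesis using g by (simp add: Q_def)
      qed
      finally show ?thesis ..
    qed
    moreover have "\<forall>i\<in>{1..Suc N}. P' i \<in> Rs \<and> (\<forall>J\<in>P' i. a' i J \<in> M J)"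
      using g P0 a0 by (auto simp: Q_def P'_def a'_def le_Suc_eq)
    ultimately have "Q (\<lambda>x. c \<otimes> k x \<oplus> g x) (Suc N) P' a'" by (simp add: Q_def)
    then show ?case by blast
  qed
  then obtain N P a where "Q f N P a" by blast
  then show thesis using that[of N P a] unfolding Q_def by blast
qed

end

text \<open>The partition of the i-th summand may depend on the tensor. Summing over all P in
  \<open>Rs\<close>, with zero factors for the partitions that do not occur, gives all tensors of a
  sequence decompositions of the same shape, so that the limit can be taken factor by
  factor.\<close>

lemma rank_decomp_uniform:
  fixes F :: "'a ring"
  assumes "field F" and d: "1 \<le> d" and Rs: "partition_family d Rs" and n: "\<And>j. j \<in> {1..d} \<Longrightarrow> 1 \<le> n j"
    and dec: "rank_decomp F d n Rs k T"
  obtains a where "\<And>i P J. P \<in> Rs \<Longrightarrow> J \<in> P \<Longrightarrow> a i P J \<in> field.coord_funs F J"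
    "\<And>x. T (grid_point d n x) = (\<Oplus>\<^bsub>F\<^esub>i\<in>{1..k}. \<Oplus>\<^bsub>F\<^esub>P\<in>Rs. \<Otimes>\<^bsub>F\<^esub>J\<in>P. a i P J x)"
proof -
  interpret field F by fact
  obtain P a where P: "\<And>i. i \<in> {1..k} \<Longrightarrow> P i \<in> Rs"
    and a: "\<And>i J. i \<in> {1..k} \<Longrightarrow> J \<in> P i \<Longrightarrow> a i J \<in> coord_funs J"
    and T: "\<And>x. T (grid_point d n x) = (\<Oplus>\<^bsub>F\<^esub>i\<in>{1..k}. \<Otimes>\<^bsub>F\<^esub>J\<in>P i. a i J x)"
    using rank_decomp_total[OF assms(1) Rs n dec] by blast
  have finR: "finite Rs" using finite_partitions[of "{1..d}"] partition_familyD[OF Rs] by blast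
  have fin: "finite Q" "Q \<noteq> {}" if "Q \<in> Rs" for Q
    using partition_familyD[OF Rs that] finite_elements[of "{1..d}" Q] d by (auto simp: partition_on_def)
  define b where "b i Q J x = (if i \<in> {1..k} \<and> P i = Q then a i J x else \<zero>\<^bsub>F\<^esub>)" for i Q J x
  have b: "b i Q J \<in> coord_funs J" if "Q \<in> Rs" "J \<in> Q" for i Q J
  proof (cases "i \<in> {1..k} \<and> P i = Q")
    case True
    then have "b i Q J = a i J" by (simp add: b_def[abs_def])
    then show ?thesis using a[of i J] True that by simp
  next
    case False
    then have "b i Q J = (\<lambda>_. \<zero>\<^bsub>F\<^esub>)" by (auto simp: b_def[abs_def])
    then show ?thesis using fun_subspace_zero[OF fun_subspace_coord_funs] by simp
  qed
  have "(\<Oplus>\<^bsub>F\<^esub>Q\<in>Rs. \<Otimes>\<^bsub>F\<^esub>J\<in>Q. b i Q J x) = (\<Otimes>\<^bsub>F\<^esub>J\<in>P i. a i J x)" if i: "i \<in> {1..k}" for i x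
  proof -
    have car: "(\<Otimes>\<^bsub>F\<^esub>J\<in>P i. a i J x) \<in> carrier F"
      using a[OF i] coord_funs_carrier by (intro finprod_closed) blast
    have "(\<Oplus>\<^bsub>F\<^esub>Q\<in>Rs. \<Otimes>\<^bsub>F\<^esub>J\<in>Q. b i Q J x) =
        (\<Oplus>\<^bsub>F\<^esub>Q\<in>Rs. if P i = Q then (\<Otimes>\<^bsub>F\<^esub>J\<in>P i. a i J x) else \<zero>\<^bsub>F\<^esub>)"
    proof (rule finsum_cong')
      fix Q assume Q: "Q \<in> Rs"
      show "(\<Otimes>\<^bsub>F\<^esub>J\<in>Q. b i Q J x) = (if P i = Q then (\<Otimes>\<^bsub>F\<^esub>J\<in>P i. a i J x) else \<zero>\<^bsub>F\<^esub>)"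
      proof (cases "P i = Q")
        case True
        then show ?thesis using i by (simp add: b_def)
      next
        case False
        obtain J where "J \<in> Q" using fin[OF Q] by auto
        then have "(\<Otimes>\<^bsub>F\<^esub>J\<in>Q. b i Q J x) = \<zero>\<^bsub>F\<^esub>"
          using fin[OF Q] False by (intro finprod_zero) (auto simp: b_def)
        then show ?thesis using False by simp
      qed
    qed (use car in auto)
    also have "\<dots> = (\<Otimes>\<^bsub>F\<^esub>J\<in>P i. a i J x)"
      using finR P[OF i] car by (intro finsum_singleton) auto
    finally show ?thesis .
  qed
  then have "(\<Oplus>\<^bsub>F\<^esub>i\<in>{1..k}. \<Otimes>\<^bsub>F\<^esub>J\<in>P i. a i J x) = (\<Oplus>\<^bsub>F\<^esub>i\<in>{1..k}. \<Oplus>\<^bsub>F\<^esub>Q\<in>Rs. \<Otimes>\<^bsub>F\<^esub>J\<in>Q. b i Q J x)" for x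
  proof (intro finsum_cong')
    show "(\<lambda>i. \<Oplus>\<^bsub>F\<^esub>Q\<in>Rs. \<Otimes>\<^bsub>F\<^esub>J\<in>Q. b i Q J x) \<in> {1..k} \<rightarrow> carrier F"
      using b coord_funs_carrier by (intro Pi_I finsum_closed finprod_closed) blast
  qed auto
  then show thesis using that[of b] b T by simp
qed

section \<open>Passage to the limit of a sequence of tensors\<close>

definition refinements :: "nat \<Rightarrow> nat set set set \<Rightarrow> nat set set set" where
  "refinements d Rs = {P. \<exists>Q\<in>Rs. refines {1..d} P Q}"

lemma refinement_closed_refinements: "refinement_closed {1..d} (refinements d Rs)"
proof -
  have "partition_on {1..d} P" if "refines {1..d} P Q" for P Q using that by (simp add: refines_def)
  then show ?thesis unfolding refinement_closed_def refinements_def using refines_trans by blast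
qed

text \<open>Internal functions are those induced by sequences of functions over the fields F m. The
  coordinates of a point of the limit are themselves sequences.\<close>

definition seq_valid :: "(nat \<Rightarrow> 'b ring) \<Rightarrow> (nat \<Rightarrow> (nat \<Rightarrow> nat) \<Rightarrow> 'b) \<Rightarrow> bool" where
  "seq_valid F g \<longleftrightarrow> (\<forall>m x. g m x \<in> carrier (F m))"

text \<open>Only values are reduced, by \<phi>; points are not identified. Two points agree in the
  coordinate j if their whole sequences there are equal.\<close>

definition seq_lift ::
  "((nat \<Rightarrow> 'b) \<Rightarrow> 'c) \<Rightarrow> (nat \<Rightarrow> (nat \<Rightarrow> nat) \<Rightarrow> 'b) \<Rightarrow> (nat \<Rightarrow> nat \<Rightarrow> nat) \<Rightarrow> 'c" where
  "seq_lift \<phi> g x = \<phi> (\<lambda>m. g m (\<lambda>j. x j m))"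

lemma seq_lift_closed:
  assumes "ring_hom_cring (seq_ring F) K \<phi>" "seq_valid F g"
  shows "seq_lift \<phi> g x \<in> carrier K"
proof -
  interpret ring_hom_cring "seq_ring F" K \<phi> by fact
  show ?thesis using assms(2) hom_closed[of "\<lambda>m. g m (\<lambda>j. x j m)"] by (simp add: seq_lift_def seq_valid_def)
qed

lemma seq_lift_finsum:
  assumes cr: "\<And>m. cring (F m)" and "ring_hom_cring (seq_ring F) K \<phi>" and g: "\<And>i. i \<in> A \<Longrightarrow> seq_valid F (g i)"
  shows "(\<lambda>x. \<Oplus>\<^bsub>K\<^esub>i\<in>A. seq_lift \<phi> (g i) x) = seq_lift \<phi> (\<lambda>m x. \<Oplus>\<^bsub>F m\<^esub>i\<in>A. g i m x)"
proof
  interpret ring_hom_cring "seq_ring F" K \<phi> by fact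
  fix x
  have *: "(\<lambda>i m. g i m (\<lambda>j. x j m)) \<in> A \<rightarrow> carrier (seq_ring F)" using g by (simp add: seq_valid_def)
  show "(\<Oplus>\<^bsub>K\<^esub>i\<in>A. seq_lift \<phi> (g i) x) = seq_lift \<phi> (\<lambda>m x. \<Oplus>\<^bsub>F m\<^esub>i\<in>A. g i m x) x"
    using hom_finsum[OF *] finsum_seq_ring[OF cr *] by (simp add: seq_lift_def o_def)
qed

lemma seq_lift_finprod:
  assumes cr: "\<And>m. cring (F m)" and "ring_hom_cring (seq_ring F) K \<phi>" and g: "\<And>i. i \<in> A \<Longrightarrow> seq_valid F (g i)"
  shows "(\<lambda>x. \<Otimes>\<^bsub>K\<^esub>i\<in>A. seq_lift \<phi> (g i) x) = seq_lift \<phi> (\<lambda>m x. \<Otimes>\<^bsub>F m\<^esub>i\<in>A. g i m x)"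
proof
  interpret ring_hom_cring "seq_ring F" K \<phi> by fact
  fix x
  have *: "(\<lambda>i m. g i m (\<lambda>j. x j m)) \<in> A \<rightarrow> carrier (seq_ring F)" using g by (simp add: seq_valid_def)
  show "(\<Otimes>\<^bsub>K\<^esub>i\<in>A. seq_lift \<phi> (g i) x) = seq_lift \<phi> (\<lambda>m x. \<Otimes>\<^bsub>F m\<^esub>i\<in>A. g i m x) x"
    using hom_finprod[OF *] finprod_seq_ring[OF cr *] by (simp add: seq_lift_def o_def)
qed

lemma seq_valid_finsum:
  assumes cr: "\<And>m. cring (F m)" and g: "\<And>i. i \<in> A \<Longrightarrow> seq_valid F (g i)"
  shows "seq_valid F (\<lambda>m x. \<Oplus>\<^bsub>F m\<^esub>i\<in>A. g i m x)"
  unfolding seq_valid_def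
proof (intro allI)
  fix m x
  interpret Fm: cring "F m" by (rule cr)
  show "(\<Oplus>\<^bsub>F m\<^esub>i\<in>A. g i m x) \<in> carrier (F m)" using g by (intro Fm.finsum_closed) (auto simp: seq_valid_def)
qed

lemma seq_valid_finprod:
  assumes cr: "\<And>m. cring (F m)" and g: "\<And>i. i \<in> A \<Longrightarrow> seq_valid F (g i)"
  shows "seq_valid F (\<lambda>m x. \<Otimes>\<^bsub>F m\<^esub>i\<in>A. g i m x)"
  unfolding seq_valid_def
proof (intro allI)
  fix m x
  interpret Fm: cring "F m" by (rule cr)
  show "(\<Otimes>\<^bsub>F m\<^esub>i\<in>A. g i m x) \<in> carrier (F m)" using g by (intro Fm.finprod_closed) (auto simp: seq_valid_def)
qed

text \<open>Decompositions of fixed lengths k i pass to the limit of the T m, which thus lies in the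
  span for every i. By \<open>prod_span_INT\<close> and \<open>internal_prod_span\<close> it is a
  finite sum of products of internal functions along members of the intersection. The number N of
  these terms serves every m at which the sum already represents T m, and by \<open>ker\<close>
  there are infinitely many such m.\<close>

lemma uniform_rank_bound:
  fixes F :: "nat \<Rightarrow> 'b ring" and Rs :: "nat \<Rightarrow> nat set set set"
  assumes F: "\<And>m. field (F m)" and d: "1 \<le> d" and h: "1 \<le> h"
    and Rs: "\<And>i. i \<in> {1..h} \<Longrightarrow> partition_family d (Rs i)"
    and n: "\<And>m j. j \<in> {1..d} \<Longrightarrow> 1 \<le> n m j"
    and dec: "\<And>m i. i \<in> {1..h} \<Longrightarrow> rank_decomp (F m) d (n m) (Rs i) (k i) (T m)"
  shows "\<exists>N. infinite {m. rank_decomp (F m) d (n m) (\<Inter>i\<in>{1..h}. refinements d (Rs i)) N (T m)}"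
proof -
  have cr: "cring (F m)" for m using F by (simp add: field_def domain_def)
  obtain K :: "(nat \<Rightarrow> 'b) set ring" and \<phi> where K: "field K" and hom: "ring_hom_cring (seq_ring F) K \<phi>"
    and surj: "\<phi> ` carrier (seq_ring F) = carrier K"
    and ker: "\<And>u. u \<in> carrier (seq_ring F) \<Longrightarrow> \<phi> u = \<zero>\<^bsub>K\<^esub> \<Longrightarrow> infinite {m. u m = \<zero>\<^bsub>F m\<^esub>}"
    using exists_limit_field[of F] F by blast
  interpret K: field K by fact
  interpret hom: ring_hom_cring "seq_ring F" K \<phi> by fact
  note lift_car = seq_lift_closed[OF hom]
  note lift_sum = seq_lift_finsum[where F = F, OF cr hom]
  note lift_prod = seq_lift_finprod[where F = F, OF cr hom]
  note valid_sum = seq_valid_finsum[where F = F, OF cr]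
  note valid_prod = seq_valid_finprod[where F = F, OF cr]
  note valid_def = seq_valid_def
  note lift_def = seq_lift_def
  define Internal where "Internal = seq_lift \<phi> ` Collect (seq_valid F)"
  have Internal_sub: "K.fun_subspace Internal"
  proof (rule K.fun_subspaceI)
    show "Internal \<subseteq> K.scalar_funs" using lift_car by (auto simp: Internal_def K.scalar_funs_def)
    have "seq_lift \<phi> (\<lambda>m x. \<zero>\<^bsub>F m\<^esub>) = (\<lambda>_. \<zero>\<^bsub>K\<^esub>)" using hom.hom_zero by (simp add: lift_def fun_eq_iff)
    moreover have "seq_valid F (\<lambda>m x. \<zero>\<^bsub>F m\<^esub>)" using cring.cring_simprules(2)[OF cr] by (simp add: valid_def)
    ultimately show "(\<lambda>_. \<zero>\<^bsub>K\<^esub>) \<in> Internal" unfolding Internal_def by (metis imageI mem_Collect_eq)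
    fix c f g assume "c \<in> carrier K" "f \<in> Internal" "g \<in> Internal"
    then obtain \<gamma> f' g' where c: "\<gamma> \<in> carrier (seq_ring F)" "c = \<phi> \<gamma>"
      and f: "seq_valid F f'" "f = seq_lift \<phi> f'" and g: "seq_valid F g'" "g = seq_lift \<phi> g'"
      using surj unfolding Internal_def by (metis imageE mem_Collect_eq)
    let ?e = "\<lambda>m x. \<gamma> m \<otimes>\<^bsub>F m\<^esub> f' m x \<oplus>\<^bsub>F m\<^esub> g' m x"
    have "seq_valid F ?e" using c f g cring.cring_simprules(1,5)[OF cr] by (simp add: valid_def)
    moreover have "seq_lift \<phi> ?e x = c \<otimes>\<^bsub>K\<^esub> f x \<oplus>\<^bsub>K\<^esub> g x" for x
    proof -
      let ?f = "\<lambda>m. f' m (\<lambda>j. x j m)" and ?g = "\<lambda>m. g' m (\<lambda>j. x j m)"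
      have fg: "?f \<in> carrier (seq_ring F)" "?g \<in> carrier (seq_ring F)" using f g by (simp_all add: valid_def)
      then have "\<gamma> \<otimes>\<^bsub>seq_ring F\<^esub> ?f \<in> carrier (seq_ring F)" by (intro hom.R.m_closed c)
      then have "\<phi> (\<gamma> \<otimes>\<^bsub>seq_ring F\<^esub> ?f \<oplus>\<^bsub>seq_ring F\<^esub> ?g) = \<phi> \<gamma> \<otimes>\<^bsub>K\<^esub> \<phi> ?f \<oplus>\<^bsub>K\<^esub> \<phi> ?g"
        using hom.hom_add[OF _ fg(2)] hom.hom_mult[OF c(1) fg(1)] by metis
      then show ?thesis by (simp add: lift_def c f g)
    qed
    ultimately show "(\<lambda>x. c \<otimes>\<^bsub>K\<^esub> f x \<oplus>\<^bsub>K\<^esub> g x) \<in> Internal" unfolding Internal_def by (intro image_eqI[of _ _ ?e]) auto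
  qed
  have Internal_slice: "(\<lambda>z. f (override_on y z I)) \<in> Internal" if f: "f \<in> Internal" for f y I
  proof -
    obtain g where g: "seq_valid F g" "f = seq_lift \<phi> g" using f by (auto simp: Internal_def)
    let ?e = "\<lambda>m z. g m (override_on (\<lambda>j. y j m) z I)"
    have "(\<lambda>j. override_on y z I j m) = override_on (\<lambda>j. y j m) (\<lambda>j. z j m) I" for z m
      by (auto simp: override_on_def)
    then have "(\<lambda>z. f (override_on y z I)) = seq_lift \<phi> ?e" by (auto simp: g lift_def fun_eq_iff)
    moreover have "seq_valid F ?e" using g by (simp add: valid_def)
    ultimately show ?thesis unfolding Internal_def by blast
  qed
  let ?M = "\<lambda>J. Internal \<inter> K.coord_funs J"
  have M: "K.coord_subspaces ?M"
    unfolding K.coord_subspaces_def using K.fun_subspace_inter[OF Internal_sub K.fun_subspace_coord_funs] by auto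
  have choose: "\<exists>g. (\<forall>J\<in>P. seq_valid F (g J) \<and> a J = seq_lift \<phi> (g J))" if "\<forall>J\<in>P. a J \<in> Internal" for P a
    using that unfolding Internal_def by (intro bchoice) auto
  have Internal_prods: "K.part_prods ?M P \<subseteq> Internal" for P
  proof
    fix f assume "f \<in> K.part_prods ?M P"
    then obtain a where a: "\<forall>J\<in>P. a J \<in> Internal" "f = (\<lambda>x. \<Otimes>\<^bsub>K\<^esub>J\<in>P. a J x)" 
      by (auto simp: K.part_prods_def)
    obtain g where g: "\<forall>J\<in>P. seq_valid F (g J) \<and> a J = seq_lift \<phi> (g J)" using choose[OF a(1)] by blast
    have "f = (\<lambda>x. \<Otimes>\<^bsub>K\<^esub>J\<in>P. seq_lift \<phi> (g J) x)" unfolding a(2)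
      using g lift_car by (intro ext K.finprod_cong') auto
    also have "\<dots> = seq_lift \<phi> (\<lambda>m x. \<Otimes>\<^bsub>F m\<^esub>J\<in>P. g J m x)" using g by (intro lift_prod) auto
    finally show "f \<in> Internal" using valid_prod[where A = P and g = g] g by (simp add: Internal_def)
  qed
  define T' where "T' m x = T m (grid_point d (n m) x)" for m x
  let ?D = "\<Inter>i\<in>{1..h}. refinements d (Rs i)"
  have h1: "{1..h} \<noteq> {}" using h by auto
  have T'_dec: "\<exists>a. (\<forall>P\<in>Rs i. \<forall>J\<in>P. \<forall>l. a l P J \<in> field.coord_funs (F m) J) \<and>
      (\<forall>x. T' m x = (\<Oplus>\<^bsub>F m\<^esub>l\<in>{1..k i}. \<Oplus>\<^bsub>F m\<^esub>P\<in>Rs i. \<Otimes>\<^bsub>F m\<^esub>J\<in>P. a l P J x))" if i: "i \<in> {1..h}" for m i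
    by (rule rank_decomp_uniform[OF F d Rs[OF i] n dec[OF i]]) (auto simp: T'_def)
  have T'_valid: "seq_valid F T'"
    unfolding valid_def
  proof (intro allI)
    fix m x
    interpret Fm: field "F m" by (rule F)
    obtain i where i: "i \<in> {1..h}" using h1 by auto
    obtain a where a: "\<forall>P\<in>Rs i. \<forall>J\<in>P. \<forall>l. a l P J \<in> Fm.coord_funs J"
      and Tx: "T' m x = (\<Oplus>\<^bsub>F m\<^esub>l\<in>{1..k i}. \<Oplus>\<^bsub>F m\<^esub>P\<in>Rs i. \<Otimes>\<^bsub>F m\<^esub>J\<in>P. a l P J x)" using T'_dec[OF i] by blast
    have "a l P J x \<in> carrier (F m)" if "P \<in> Rs i" "J \<in> P" for l P J
      using that a Fm.coord_funs_carrier by blast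
    then show "T' m x \<in> carrier (F m)" 
      unfolding Tx by (auto intro!: Fm.finsum_closed Fm.finprod_closed)
  qed
  have T_ext: "seq_lift \<phi> T' \<in> K.prod_span K.coord_funs (refinements d (Rs i))" if i: "i \<in> {1..h}" for i
  proof -
    have "\<forall>m. \<exists>a. (\<forall>P\<in>Rs i. \<forall>J\<in>P. \<forall>l. a l P J \<in> field.coord_funs (F m) J) \<and>
      (\<forall>x. T' m x = (\<Oplus>\<^bsub>F m\<^esub>l\<in>{1..k i}. \<Oplus>\<^bsub>F m\<^esub>P\<in>Rs i. \<Otimes>\<^bsub>F m\<^esub>J\<in>P. a l P J x))" using T'_dec[OF i] by blast
    from choice[OF this] obtain a where
      aT: "\<forall>m. (\<forall>P\<in>Rs i. \<forall>J\<in>P. \<forall>l. a m l P J \<in> field.coord_funs (F m) J) \<and>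
      (\<forall>x. T' m x = (\<Oplus>\<^bsub>F m\<^esub>l\<in>{1..k i}. \<Oplus>\<^bsub>F m\<^esub>P\<in>Rs i. \<Otimes>\<^bsub>F m\<^esub>J\<in>P. a m l P J x))" ..
    have a: "a m l P J \<in> field.coord_funs (F m) J" if "P \<in> Rs i" "J \<in> P" for m P J l
      using aT that by simp
    have Tx: "T' m x = (\<Oplus>\<^bsub>F m\<^esub>l\<in>{1..k i}. \<Oplus>\<^bsub>F m\<^esub>P\<in>Rs i. \<Otimes>\<^bsub>F m\<^esub>J\<in>P. a m l P J x)" for m x
      using aT by simp
    define g where "g l P J m = a m l P J" for l P J m
    have gv: "seq_valid F (g l P J)" if "P \<in> Rs i" "J \<in> P" for l P J
      unfolding valid_def g_def using a[OF that] field.coord_funs_carrier[OF F] by blast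
    have gc: "seq_lift \<phi> (g l P J) \<in> K.coord_funs J" if "P \<in> Rs i" "J \<in> P" for l P J
    proof (rule K.coord_funsI)
      fix x y :: "nat \<Rightarrow> nat \<Rightarrow> nat" assume "\<And>j. j \<in> J \<Longrightarrow> x j = y j"
      then have "g l P J m (\<lambda>j. x j m) = g l P J m (\<lambda>j. y j m)" for m
        unfolding g_def by (intro field.coord_funsD[OF F a[OF that]]) simp
      then show "seq_lift \<phi> (g l P J) x = seq_lift \<phi> (g l P J) y" by (simp add: lift_def)
    qed (rule lift_car[OF gv[OF that]])
    have v1: "seq_valid F (\<lambda>m x. \<Otimes>\<^bsub>F m\<^esub>J\<in>P. g l P J m x)" if "P \<in> Rs i" for l P
      by (rule valid_prod) (rule gv[OF that])
    have v2: "seq_valid F (\<lambda>m x. \<Oplus>\<^bsub>F m\<^esub>P\<in>Rs i. \<Otimes>\<^bsub>F m\<^esub>J\<in>P. g l P J m x)" for l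
      by (rule valid_sum) (rule v1)
    have "T' = (\<lambda>m x. \<Oplus>\<^bsub>F m\<^esub>l\<in>{1..k i}. \<Oplus>\<^bsub>F m\<^esub>P\<in>Rs i. \<Otimes>\<^bsub>F m\<^esub>J\<in>P. g l P J m x)"
      by (intro ext) (simp add: Tx g_def)
    then have "seq_lift \<phi> T' = (\<lambda>x. \<Oplus>\<^bsub>K\<^esub>l\<in>{1..k i}. seq_lift \<phi> (\<lambda>m x. \<Oplus>\<^bsub>F m\<^esub>P\<in>Rs i. \<Otimes>\<^bsub>F m\<^esub>J\<in>P. g l P J m x) x)"
      using lift_sum[where A = "{1..k i}" and g = "\<lambda>l m x. \<Oplus>\<^bsub>F m\<^esub>P\<in>Rs i. \<Otimes>\<^bsub>F m\<^esub>J\<in>P. g l P J m x", OF v2] by simp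
    moreover have "seq_lift \<phi> (\<lambda>m x. \<Oplus>\<^bsub>F m\<^esub>P\<in>Rs i. \<Otimes>\<^bsub>F m\<^esub>J\<in>P. g l P J m x) \<in>
      K.prod_span K.coord_funs (refinements d (Rs i))" for l
    proof -
      have "seq_lift \<phi> (\<lambda>m x. \<Oplus>\<^bsub>F m\<^esub>P\<in>Rs i. \<Otimes>\<^bsub>F m\<^esub>J\<in>P. g l P J m x) =
          (\<lambda>x. \<Oplus>\<^bsub>K\<^esub>P\<in>Rs i. seq_lift \<phi> (\<lambda>m x. \<Otimes>\<^bsub>F m\<^esub>J\<in>P. g l P J m x) x)"
        using lift_sum[where A = "Rs i" and g = "\<lambda>P m x. \<Otimes>\<^bsub>F m\<^esub>J\<in>P. g l P J m x", OF v1] by simp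
      moreover have "seq_lift \<phi> (\<lambda>m x. \<Otimes>\<^bsub>F m\<^esub>J\<in>P. g l P J m x) \<in> K.prod_span K.coord_funs (refinements d (Rs i))"
        if P: "P \<in> Rs i" for P
      proof -
        have "seq_lift \<phi> (\<lambda>m x. \<Otimes>\<^bsub>F m\<^esub>J\<in>P. g l P J m x) = (\<lambda>x. \<Otimes>\<^bsub>K\<^esub>J\<in>P. seq_lift \<phi> (g l P J) x)"
          using lift_prod[where A = P and g = "g l P"] gv[OF P] by simp
        moreover have "\<dots> \<in> K.part_prods K.coord_funs P"
          unfolding K.part_prods_def using gc[OF P]
            by (intro CollectI exI[of _ "\<lambda>J. seq_lift \<phi> (g l P J)"]) auto
        moreover have "P \<in> refinements d (Rs i)"
          using P refines_refl[OF partition_familyD[OF Rs[OF i] P]] by (auto simp: refinements_def)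
        ultimately show ?thesis
          using K.part_prods_subset_span[OF K.coord_subspaces_coord_funs] by force
      qed
      ultimately show ?thesis
        by (simp add: K.fun_subspace_finsum[OF K.fun_subspace_prod_span[OF K.coord_subspaces_coord_funs]])
    qed
    ultimately show ?thesis
      by (simp add: K.fun_subspace_finsum[OF K.fun_subspace_prod_span[OF K.coord_subspaces_coord_funs]])
  qed
  have rc: "refinement_closed {1..d} ?D"
    using refinement_closed_refinements[of d] h1 unfolding refinement_closed_def by blast
  \<comment> \<open>The factors obtained here are arbitrary functions on the limit. They have to be
    made internal before they can be taken back to the fields F m.\<close>
  have "seq_lift \<phi> T' \<in> K.prod_span K.coord_funs ?D"
    using refinement_closed_refinements T_ext h1 by (intro K.prod_span_INT[of "{1..d}"]) auto
  then have T_int: "seq_lift \<phi> T' \<in> K.prod_span ?M ?D"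
    using T'_valid by (intro K.internal_prod_span[OF _ rc Internal_sub Internal_slice Internal_prods]) (auto simp: Internal_def)
  have D_fin: "finite P \<and> P \<noteq> {}" if "P \<in> ?D" for P
  proof -
    have "partition_on {1..d} P" using rc that by (simp add: refinement_closed_def)
    then show ?thesis using finite_elements[of "{1..d}" P] d by (auto simp: partition_on_def)
  qed
  obtain N :: nat and P a where P: "\<And>i. i \<in> {1..N} \<Longrightarrow> P i \<in> ?D"
    and a: "\<And>i J. i \<in> {1..N} \<Longrightarrow> J \<in> P i \<Longrightarrow> a i J \<in> ?M J"
    and Tsum: "seq_lift \<phi> T' = (\<lambda>x. \<Oplus>\<^bsub>K\<^esub>i\<in>{1..N}. \<Otimes>\<^bsub>K\<^esub>J\<in>P i. a i J x)"
    by (rule K.prod_span_sum[OF M D_fin T_int]) blast+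
  define g where "g i J = (SOME g. seq_valid F g \<and> a i J = seq_lift \<phi> g)" for i J
  have g: "seq_valid F (g i J) \<and> a i J = seq_lift \<phi> (g i J)" if "i \<in> {1..N}" "J \<in> P i" for i J
    unfolding g_def using a[OF that] by (intro someI_ex[of "\<lambda>g. seq_valid F g \<and> a i J = seq_lift \<phi> g"]) (auto simp: Internal_def)
  \<comment> \<open>The lift of g i J depends only on the coordinates in J, but g i J itself may
    depend on others. Freezing those at 0 repairs this and leaves the lift unchanged.\<close>
  define b where "b i J m x = g i J m (override_on (\<lambda>_. 0) x J)" for i J m x
  have bv: "seq_valid F (b i J)" if "i \<in> {1..N}" "J \<in> P i" for i J
    using g[OF that] by (simp add: valid_def b_def)
  have bl: "a i J = seq_lift \<phi> (b i J)" if "i \<in> {1..N}" "J \<in> P i" for i J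
  proof
    fix x
    have "a i J x = a i J (override_on (\<lambda>_ _. 0) x J)"
      using a[OF that] by (intro K.coord_funsD[of "a i J" J x]) auto
    moreover have "(\<lambda>j. override_on (\<lambda>_ _. 0) x J j m) = override_on (\<lambda>_. 0) (\<lambda>j. x j m) J" for m
      by (auto simp: override_on_def)
    ultimately show "a i J x = seq_lift \<phi> (b i J) x" using g[OF that] by (simp add: lift_def b_def)
  qed
  let ?s = "\<lambda>m x. \<Oplus>\<^bsub>F m\<^esub>i\<in>{1..N}. \<Otimes>\<^bsub>F m\<^esub>J\<in>P i. b i J m x"
  have pv: "seq_valid F (\<lambda>m x. \<Otimes>\<^bsub>F m\<^esub>J\<in>P i. b i J m x)" if "i \<in> {1..N}" for i
    by (rule valid_prod) (rule bv[OF that])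
  have sv: "seq_valid F ?s" by (rule valid_sum) (rule pv)
  have lift_eq: "seq_lift \<phi> T' = seq_lift \<phi> ?s"
  proof -
    have "(\<Oplus>\<^bsub>K\<^esub>i\<in>{1..N}. \<Otimes>\<^bsub>K\<^esub>J\<in>P i. a i J x) = (\<Oplus>\<^bsub>K\<^esub>i\<in>{1..N}. seq_lift \<phi> (\<lambda>m x. \<Otimes>\<^bsub>F m\<^esub>J\<in>P i. b i J m x) x)" for x
    proof (rule K.finsum_cong')
      fix i assume i: "i \<in> {1..N}"
      have "(\<Otimes>\<^bsub>K\<^esub>J\<in>P i. a i J x) = (\<Otimes>\<^bsub>K\<^esub>J\<in>P i. seq_lift \<phi> (b i J) x)"
        using bl[OF i] lift_car[OF bv[OF i]] by (intro K.finprod_cong') auto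
      then show "(\<Otimes>\<^bsub>K\<^esub>J\<in>P i. a i J x) = seq_lift \<phi> (\<lambda>m x. \<Otimes>\<^bsub>F m\<^esub>J\<in>P i. b i J m x) x"
        using lift_prod[where A = "P i" and g = "b i"] bv[OF i] by (simp add: fun_eq_iff)
    qed (use lift_car[OF pv] in auto)
    then show ?thesis
      using Tsum lift_sum[where A = "{1..N}" and g = "\<lambda>i m x. \<Otimes>\<^bsub>F m\<^esub>J\<in>P i. b i J m x", OF pv] by simp
  qed
  \<comment> \<open>A point where the two sides differ over F m, if there is one. So u m = 0 gives
    equality at every point, and the single point of the limit formed by all the w m tests all m at
    once.\<close>
  define w where "w m = (SOME x. T' m x \<noteq> ?s m x)" for m
  define u where "u m = T' m (w m) \<ominus>\<^bsub>F m\<^esub> ?s m (w m)" for m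
  have uc: "u \<in> carrier (seq_ring F)"
    using T'_valid sv cring.cring_simprules(4)[OF cr] by (simp add: u_def valid_def)
  have "seq_lift \<phi> T' (\<lambda>j m. w m j) = seq_lift \<phi> ?s (\<lambda>j m. w m j)" by (simp only: lift_eq)
  then have *: "\<phi> (\<lambda>m. T' m (w m)) = \<phi> (\<lambda>m. ?s m (w m))" by (simp add: lift_def)
  have c: "(\<lambda>m. T' m (w m)) \<in> carrier (seq_ring F)" "(\<lambda>m. ?s m (w m)) \<in> carrier (seq_ring F)"
    using T'_valid sv by (simp_all add: valid_def)
  have "\<phi> u = \<zero>\<^bsub>K\<^esub>"
  proof -
    have "(\<lambda>m. T' m (w m)) = u \<oplus>\<^bsub>seq_ring F\<^esub> (\<lambda>m. ?s m (w m))"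
    proof
      fix m
      interpret Fm: field "F m" by (rule F)
      have "T' m (w m) \<in> carrier (F m)" "?s m (w m) \<in> carrier (F m)" using T'_valid sv by (simp_all add: valid_def)
      then have "T' m (w m) = (T' m (w m) \<ominus>\<^bsub>F m\<^esub> ?s m (w m)) \<oplus>\<^bsub>F m\<^esub> ?s m (w m)"
        by (simp add: Fm.minus_eq Fm.a_assoc Fm.l_neg)
      then show "T' m (w m) = (u \<oplus>\<^bsub>seq_ring F\<^esub> (\<lambda>m. ?s m (w m))) m" by (simp add: u_def)
    qed
    then have "\<phi> (\<lambda>m. T' m (w m)) = \<phi> u \<oplus>\<^bsub>K\<^esub> \<phi> (\<lambda>m. ?s m (w m))" using hom.hom_add[OF uc c(2)] by simp
    then have "\<phi> u \<oplus>\<^bsub>K\<^esub> \<phi> (\<lambda>m. ?s m (w m)) = \<zero>\<^bsub>K\<^esub> \<oplus>\<^bsub>K\<^esub> \<phi> (\<lambda>m. ?s m (w m))"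
      using * hom.hom_closed[OF c(2)] by simp
    then show ?thesis using hom.hom_closed[OF uc] hom.hom_closed[OF c(2)] by simp
  qed
  then have inf: "infinite {m. u m = \<zero>\<^bsub>F m\<^esub>}" by (rule ker[OF uc])
  have "rank_decomp (F m) d (n m) ?D N (T m)" if um: "u m = \<zero>\<^bsub>F m\<^esub>" for m
  proof (rule rank_decompI[OF F P])
    interpret Fm: field "F m" by (rule F)
    have c: "T' m (w m) \<in> carrier (F m)" "?s m (w m) \<in> carrier (F m)" using T'_valid sv by (simp_all add: valid_def)
    then have "T' m (w m) = ?s m (w m)" using um by (simp add: u_def)
    then have eq: "T' m x = ?s m x" for x unfolding w_def using someI[of "\<lambda>x. T' m x \<noteq> ?s m x" x] by blast
    show "T m x = ?s m x" if "x \<in> grid {1..d} (n m)" for x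
      using eq[of x] grid_point_id[OF that] by (simp add: T'_def)
    fix i J assume iJ: "i \<in> {1..N}" "J \<in> P i"
    show "b i J m \<in> Fm.coord_funs J"
    proof (rule Fm.coord_funsI)
      show "b i J m x \<in> carrier (F m)" for x using bv[OF iJ] by (simp add: valid_def)
      fix x y :: "nat \<Rightarrow> nat" assume "\<And>j. j \<in> J \<Longrightarrow> x j = y j"
      then have "override_on (\<lambda>_. 0) x J = override_on (\<lambda>_. 0) y J" by (auto simp: override_on_def fun_eq_iff)
      then show "b i J m x = b i J m y" by (simp add: b_def)
    qed
  qed
  then have "{m. u m = \<zero>\<^bsub>F m\<^esub>} \<subseteq> {m. rank_decomp (F m) d (n m) ?D N (T m)}" by blast
  then show ?thesis using inf infinite_super by blast
qed

section \<open>From countable fields to all fields\<close>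

text \<open>One round of field operations keeps a finite set finite. The stages increase, so any two
  elements of their union lie in a common stage and the union is closed under the
  operations.\<close>

lemma (in field) countable_subfield:
  assumes E: "finite E" "E \<subseteq> carrier R"
  obtains L where "subfield L R" "countable L" "E \<subseteq> L"
proof -
  define close where "close S = S \<union> (\<lambda>(x, y). x \<oplus> y) ` (S \<times> S) \<union> (\<lambda>(x, y). x \<otimes> y) ` (S \<times> S) \<union>
    (\<lambda>x. \<ominus> x) ` S \<union> (\<lambda>x. inv x) ` (S - {\<zero>})" for S
  define S where "S n = (close ^^ n) (insert \<one> E)" for n
  have S_Suc: "S (Suc n) = close (S n)" for n by (simp add: S_def)
  have fin: "finite (S n)" for n by (induction n) (use E in \<open>auto simp: S_def close_def\<close>)
  have car: "S n \<subseteq> carrier R" for n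
  proof (induction n)
    case 0
    show ?case using E by (simp add: S_def)
  next
    case (Suc n)
    then show ?case unfolding S_Suc close_def by (auto simp: field_Units subset_iff)
  qed
  have mono: "S m \<subseteq> S n" if "m \<le> n" for m n
    by (rule lift_Suc_mono_le[OF _ that]) (auto simp: S_Suc close_def)
  define L where "L = (\<Union>n. S n)"
  have two: "\<exists>n. x \<in> S n \<and> y \<in> S n" if xy: "x \<in> L" "y \<in> L" for x y
  proof -
    obtain m n where "x \<in> S m" "y \<in> S n" using xy by (auto simp: L_def)
    then show ?thesis using mono[of m "max m n"] mono[of n "max m n"] by auto
  qed
  have cl: "close (S n) \<subseteq> L" for n unfolding L_def S_Suc[symmetric] by blast
  have "subring L R"
  proof (rule subringI)
    show "L \<subseteq> carrier R" using car by (auto simp: L_def)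
    have "\<one> \<in> S 0" by (simp add: S_def)
    then show "\<one> \<in> L" unfolding L_def by blast
    show "\<ominus> x \<in> L" if "x \<in> L" for x using two[OF that that] cl by (auto simp: close_def)
    fix x y assume "x \<in> L" "y \<in> L"
    then obtain n where "x \<in> S n" "y \<in> S n" using two by blast
    then show "x \<otimes> y \<in> L" "x \<oplus> y \<in> L" using cl[of n] by (auto simp: close_def image_subset_iff)
  qed
  moreover have "inv x \<in> L" if "x \<in> L - {\<zero>}" for x
    using two[of x x] that cl by (auto simp: close_def)
  ultimately have "subfield L R" by (rule subfieldI')
  moreover have "countable L" unfolding L_def using fin by (intro countable_UN) (auto intro: countable_finite)
  moreover have "E \<subseteq> S 0" by (auto simp: S_def)
  then have "E \<subseteq> L" unfolding L_def by blast
  ultimately show thesis using that by blast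
qed

text \<open>A countable subfield that contains E is copied to natural numbers by an injection;
  \<eta> is the inverse of this injection.\<close>

lemma countable_model:
  fixes F :: "'a ring"
  assumes "field F" and E: "finite E" "E \<subseteq> carrier F"
  obtains G :: "nat ring" and \<eta> where "field G" "\<eta> \<in> ring_hom G F" "inj_on \<eta> (carrier G)" "E \<subseteq> \<eta> ` carrier G"
proof -
  interpret field F by fact
  obtain L where L: "subfield L F" "countable L" "E \<subseteq> L" using countable_subfield[OF E] by blast
  let ?L = "F\<lparr>carrier := L\<rparr>"
  have fL: "field ?L" by (rule subfield_iff(2)[OF L(1)])
  have LF: "L \<subseteq> carrier F" by (rule subfieldE(3)[OF L(1)])
  define \<iota> where "\<iota> = to_nat_on L"
  have inj: "inj_on \<iota> (carrier ?L)" unfolding \<iota>_def using inj_on_to_nat_on[OF L(2)] by simp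
  let ?G = "image_ring \<iota> ?L"
  have iso: "\<iota> \<in> ring_iso ?L ?G" by (rule inj_imp_image_ring_iso[OF inj])
  then have hom: "\<iota> \<in> ring_hom ?L ?G" by (simp add: ring_iso_def)
  have cG: "carrier ?G = \<iota> ` L" by (simp add: image_ring_carrier)
  define \<eta> where "\<eta> = inv_into L \<iota>"
  have \<eta>: "\<eta> (\<iota> x) = x" if "x \<in> L" for x unfolding \<eta>_def using inj that by (intro inv_into_f_f) auto
  have "\<eta> \<in> ring_hom ?G F"
  proof (rule ring_hom_memI)
    show "\<eta> x \<in> carrier F" if "x \<in> carrier ?G" for x using that \<eta> LF by (auto simp: cG)
    fix x y assume "x \<in> carrier ?G" "y \<in> carrier ?G"
    then obtain a b where ab: "a \<in> L" "b \<in> L" "x = \<iota> a" "y = \<iota> b" by (auto simp: cG)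
    have cl: "a \<otimes>\<^bsub>F\<^esub> b \<in> L" "a \<oplus>\<^bsub>F\<^esub> b \<in> L"
      using ab(1,2) subringE(6,7)[OF subfieldE(1)[OF L(1)]] by auto
    show "\<eta> (x \<otimes>\<^bsub>?G\<^esub> y) = \<eta> x \<otimes>\<^bsub>F\<^esub> \<eta> y"
      using ring_hom_mult[OF hom, of a b, symmetric] ab cl \<eta> by simp
    show "\<eta> (x \<oplus>\<^bsub>?G\<^esub> y) = \<eta> x \<oplus>\<^bsub>F\<^esub> \<eta> y"
      using ring_hom_add[OF hom, of a b, symmetric] ab cl \<eta> by simp
  next
    show "\<eta> \<one>\<^bsub>?G\<^esub> = \<one>\<^bsub>F\<^esub>"
      using ring_hom_one[OF hom, symmetric] \<eta> subringE(3)[OF subfieldE(1)[OF L(1)]] by simp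
  qed
  moreover have "inj_on \<eta> (carrier ?G)" unfolding cG using \<eta> by (intro inj_onI) auto
  moreover have "E \<subseteq> \<eta> ` carrier ?G"
  proof
    fix e assume "e \<in> E"
    then have "e \<in> L" using L(3) by blast
    then have "e = \<eta> (\<iota> e)" "\<iota> e \<in> carrier ?G" using \<eta> by (auto simp: cG)
    then show "e \<in> \<eta> ` carrier ?G" by blast
  qed
  moreover have "field ?G" using field.inj_imp_image_ring_is_field[OF fL inj] .
  ultimately show thesis using that by blast
qed

text \<open>Apply \<eta> to all factors: ranks do not grow under a homomorphism of fields.\<close>

lemma rank_decomp_hom:
  fixes G :: "'c ring" and F :: "'a ring"
  assumes "field G" "field F" and h: "\<eta> \<in> ring_hom G F"
    and Rs: "partition_family d Rs" and dec: "rank_decomp G d n Rs k T'" and T: "\<And>x. x \<in> grid {1..d} n \<Longrightarrow> T x = \<eta> (T' x)"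
  shows "rank_decomp F d n Rs k T"
proof -
  interpret G: field G by fact
  interpret F: field F by fact
  interpret h: ring_hom_cring G F \<eta>
    using G.is_cring F.is_cring h by (intro ring_hom_cring.intro ring_hom_cring_axioms.intro)
  obtain S where S: "\<And>i. i \<in> {1..k} \<Longrightarrow> S i \<in> tensors G d n" "\<And>i. i \<in> {1..k} \<Longrightarrow> rank_le_one G d n Rs (S i)"
    and T': "\<And>x. x \<in> grid {1..d} n \<Longrightarrow> T' x = (\<Oplus>\<^bsub>G\<^esub>i\<in>{1..k}. S i x)"
    using dec unfolding rank_decomp_def by blast
  have "rank_le_one F d n Rs (\<lambda>x. \<eta> (S i x))" if i: "i \<in> {1..k}" for i
  proof -
    obtain P a where P: "P \<in> Rs" and a: "\<forall>J\<in>P. a J \<in> grid J n \<rightarrow> carrier G"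
      and Sx: "\<forall>x\<in>grid {1..d} n. S i x = (\<Otimes>\<^bsub>G\<^esub>J\<in>P. a J (restrict x J))"
      using S(2)[OF i] unfolding rank_le_one_def by blast
    have "\<eta> (S i x) = (\<Otimes>\<^bsub>F\<^esub>J\<in>P. \<eta> (a J (restrict x J)))" if x: "x \<in> grid {1..d} n" for x
    proof -
      have "(\<lambda>J. a J (restrict x J)) \<in> P \<rightarrow> carrier G"
        using a grid_restrict[OF x partition_on_subset[OF partition_familyD[OF Rs P]]] by (auto simp: Pi_def)
      then show ?thesis using Sx x h.hom_finprod by (simp add: o_def)
    qed
    then show ?thesis unfolding rank_le_one_def using P a
      by (intro bexI[of _ P] exI[of _ "\<lambda>J y. \<eta> (a J y)"]) (auto simp: Pi_def)
  qed
  moreover have "(\<lambda>x. \<eta> (S i x)) \<in> tensors F d n" if "i \<in> {1..k}" for i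
    using S(1)[OF that] by (auto simp: tensors_def Pi_def)
  moreover have "T x = (\<Oplus>\<^bsub>F\<^esub>i\<in>{1..k}. \<eta> (S i x))" if x: "x \<in> grid {1..d} n" for x
  proof -
    have "(\<lambda>i. S i x) \<in> {1..k} \<rightarrow> carrier G" using S(1) x unfolding tensors_def by blast
    then show ?thesis using T[OF x] T'[OF x] h.hom_finsum by (simp add: o_def)
  qed
  ultimately show ?thesis unfolding rank_decomp_def by (intro exI[of _ "\<lambda>i x. \<eta> (S i x)"]) blast
qed

text \<open>E consists of the finitely many values of the factors, so every field model whose image
  contains them carries the same decomposition. E is chosen before G because one G has to serve the
  decompositions for all i at once.\<close>

lemma rank_decomp_entries:
  fixes F :: "'a ring"
  assumes "field F" and Rs: "partition_family d Rs" and n: "\<And>j. j \<in> {1..d} \<Longrightarrow> 1 \<le> n j"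
    and dec: "rank_decomp F d n Rs k T"
  shows "\<exists>E. finite E \<and> E \<subseteq> carrier F \<and> (\<forall>(G :: nat ring) \<eta> T'. field G \<longrightarrow> \<eta> \<in> ring_hom G F \<longrightarrow>
    inj_on \<eta> (carrier G) \<longrightarrow> E \<subseteq> \<eta> ` carrier G \<longrightarrow> T' \<in> tensors G d n \<longrightarrow>
    (\<forall>x\<in>grid {1..d} n. T x = \<eta> (T' x)) \<longrightarrow> rank_decomp G d n Rs k T')"
proof -
  interpret field F by fact
  obtain P a where P: "\<And>i. i \<in> {1..k} \<Longrightarrow> P i \<in> Rs"
    and a: "\<And>i J. i \<in> {1..k} \<Longrightarrow> J \<in> P i \<Longrightarrow> a i J \<in> coord_funs J"
    and T: "\<And>x. T (grid_point d n x) = (\<Oplus>\<^bsub>F\<^esub>i\<in>{1..k}. \<Otimes>\<^bsub>F\<^esub>J\<in>P i. a i J x)"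
    using rank_decomp_total[OF assms(1) Rs n dec] by blast
  define E where "E = (\<Union>i\<in>{1..k}. \<Union>J\<in>P i. a i J ` grid J n)"
  have Jd: "J \<subseteq> {1..d}" if "i \<in> {1..k}" "J \<in> P i" for i J
    using partition_on_subset[OF partition_familyD[OF Rs P[OF that(1)]] that(2)] .
  have "finite (P i)" if "i \<in> {1..k}" for i
    using finite_elements[OF _ partition_familyD[OF Rs P[OF that]]] by simp
  moreover have "finite J" if "i \<in> {1..k}" "J \<in> P i" for i J
    using finite_subset[OF Jd[OF that]] by simp
  ultimately have "finite E" unfolding E_def by (intro finite_UN_I finite_imageI finite_grid) auto
  moreover have "E \<subseteq> carrier F" unfolding E_def using a coord_funs_carrier by blast
  moreover have "rank_decomp G d n Rs k T'"
    if "field G" and h: "\<eta> \<in> ring_hom G F" and inj: "inj_on \<eta> (carrier G)" and EG: "E \<subseteq> \<eta> ` carrier G"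
      and T': "T' \<in> tensors G d n" and TT': "\<forall>x\<in>grid {1..d} n. T x = \<eta> (T' x)"
    for G :: "nat ring" and \<eta> T'
  proof -
    interpret G: field G by fact
    interpret h: ring_hom_cring G F \<eta>
      using G.is_cring is_cring h by (intro ring_hom_cring.intro ring_hom_cring_axioms.intro)
    define b where "b i J x = inv_into (carrier G) \<eta> (a i J x)" for i J x
    have b: "b i J x \<in> carrier G" "\<eta> (b i J x) = a i J x" if "i \<in> {1..k}" "J \<in> P i" "x \<in> grid J n" for i J x
    proof -
      have "a i J x \<in> \<eta> ` carrier G" using EG that unfolding E_def by blast
      then show "b i J x \<in> carrier G" "\<eta> (b i J x) = a i J x"
        unfolding b_def by (rule inv_into_into, rule f_inv_into_f)
    qed
    define S where "S i x = (\<Otimes>\<^bsub>G\<^esub>J\<in>P i. b i J (restrict x J))" for i x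
    have pi: "(\<lambda>J. b i J (restrict x J)) \<in> P i \<rightarrow> carrier G" if "i \<in> {1..k}" "x \<in> grid {1..d} n" for i x
      using b(1)[OF that(1) _ grid_restrict[OF that(2) Jd[OF that(1)]]] by auto
    have Sc: "S i x \<in> carrier G" if "i \<in> {1..k}" "x \<in> grid {1..d} n" for i x
      unfolding S_def by (rule G.finprod_closed[OF pi[OF that]])
    have hS: "\<eta> (S i x) = (\<Otimes>\<^bsub>F\<^esub>J\<in>P i. a i J x)" if i: "i \<in> {1..k}" and x: "x \<in> grid {1..d} n" for i x
    proof -
      have "\<eta> (S i x) = (\<Otimes>\<^bsub>F\<^esub>J\<in>P i. \<eta> (b i J (restrict x J)))"
        unfolding S_def using h.hom_finprod[OF pi[OF i x]] by (simp add: o_def)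
      also have "\<dots> = (\<Otimes>\<^bsub>F\<^esub>J\<in>P i. a i J x)"
      proof (rule finprod_cong')
        fix J assume J: "J \<in> P i"
        have "\<eta> (b i J (restrict x J)) = a i J (restrict x J)"
          by (rule b(2)[OF i J grid_restrict[OF x Jd[OF i J]]])
        also have "\<dots> = a i J x" by (rule coord_funsD[OF a[OF i J]]) simp
        finally show "\<eta> (b i J (restrict x J)) = a i J x" .
      qed (use a[OF i] coord_funs_carrier in auto)
      finally show ?thesis .
    qed
    have "T' x = (\<Oplus>\<^bsub>G\<^esub>i\<in>{1..k}. S i x)" if x: "x \<in> grid {1..d} n" for x
    \<comment> \<open>The identity holds in F by construction and descends to G because \<eta> is
      injective.\<close>
    proof (rule inj_onD[OF inj])
      have pS: "(\<lambda>i. S i x) \<in> {1..k} \<rightarrow> carrier G" using Sc x by auto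
      show "(\<Oplus>\<^bsub>G\<^esub>i\<in>{1..k}. S i x) \<in> carrier G" by (rule G.finsum_closed[OF pS])
      show "T' x \<in> carrier G" using T' x by (auto simp: tensors_def)
      have "\<eta> (\<Oplus>\<^bsub>G\<^esub>i\<in>{1..k}. S i x) = (\<Oplus>\<^bsub>F\<^esub>i\<in>{1..k}. \<eta> (S i x))"
        using h.hom_finsum[OF pS] by (simp add: o_def)
      also have "\<dots> = (\<Oplus>\<^bsub>F\<^esub>i\<in>{1..k}. \<Otimes>\<^bsub>F\<^esub>J\<in>P i. a i J x)"
      proof (rule finsum_cong')
        show "(\<lambda>i. \<Otimes>\<^bsub>F\<^esub>J\<in>P i. a i J x) \<in> {1..k} \<rightarrow> carrier F"
          using a coord_funs_carrier by (intro Pi_I finprod_closed) blast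
      qed (use hS x in auto)
      also have "\<dots> = \<eta> (T' x)" using T[of x] TT' x by (simp add: grid_point_id)
      finally show "\<eta> (T' x) = \<eta> (\<Oplus>\<^bsub>G\<^esub>i\<in>{1..k}. S i x)" ..
    qed
    moreover have "S i \<in> tensors G d n \<and> rank_le_one G d n Rs (S i)" if i: "i \<in> {1..k}" for i
    proof
      show "S i \<in> tensors G d n" using Sc[OF i] by (auto simp: tensors_def)
      show "rank_le_one G d n Rs (S i)" unfolding rank_le_one_def
        using P[OF i] b(1)[OF i] by (intro bexI[of _ "P i"] exI[of _ "b i"]) (auto simp: S_def)
    qed
    ultimately show ?thesis unfolding rank_decomp_def by blast
  qed
  ultimately show ?thesis by blast
qed

section \<open>Existence of the bound\<close>

lemma refinements_family_meet:
  assumes h: "1 \<le> h" and Rs: "\<And>i. i \<in> {1..h} \<Longrightarrow> partition_family d (Rs i)"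
    and finer: "family_finer d (family_meet h Rs) R" and P: "P \<in> (\<Inter>i\<in>{1..h}. refinements d (Rs i))"
  shows "\<exists>Q\<in>R. refines {1..d} P Q"
proof -
  have "\<forall>i\<in>{1..h}. \<exists>Q. Q \<in> Rs i \<and> refines {1..d} P Q" using P by (auto simp: refinements_def)
  then obtain Q where Q: "\<And>i. i \<in> {1..h} \<Longrightarrow> Q i \<in> Rs i \<and> refines {1..d} P (Q i)" by metis
  \<comment> \<open>P refines a member of each \<open>Rs i\<close>, and the common refinement of
    these members is the coarsest partition that does so.\<close>
  have "refines {1..d} P (common_refinement (Q ` {1..h}))"
  proof (rule common_refinement_coarsest)
    show "partition_on {1..d} P" using Q[of 1] h by (simp add: refines_def)
  qed (use Q Rs h in \<open>auto simp: partition_family_def\<close>)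
  moreover have "common_refinement (Q ` {1..h}) \<in> family_meet h Rs"
    unfolding family_meet_def using Q by blast
  then obtain Q' where "Q' \<in> R" "refines {1..d} (common_refinement (Q ` {1..h})) Q'"
    using finer unfolding family_finer_def by blast
  ultimately show ?thesis using refines_trans by blast
qed

text \<open>If no C worked, let the counterexample for C = m be the m-th member of a sequence, over
  its own field and with its own R. \<open>uniform_rank_bound\<close> gives one N for infinitely
  many m, and some m \<ge> N then contradicts the choice of its counterexample. R may vary with m
  because the uniform statement speaks of the \<open>Rs i\<close> alone; R enters only when the
  decomposition at the chosen m is coarsened.\<close>

lemma rank_bound_countable:
  fixes F :: "nat ring"
  assumes d: "1 \<le> d" and h: "1 \<le> h" and Rs: "\<And>i. i \<in> {1..h} \<Longrightarrow> partition_family d (Rs i)"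
    and R: "partition_family d R" "family_finer d (family_meet h Rs) R"
    and F: "field F" and n: "\<forall>j\<in>{1..d}. 1 \<le> n j" and T: "T \<in> tensors F d n"
    and k: "\<forall>i\<in>{1..h}. tensor_rank F d n (Rs i) T \<le> k i"
  shows "tensor_rank F d n R T \<le> rank_bound d h Rs k"
proof -
  define bad where "bad C R F n T \<longleftrightarrow> partition_family d R \<and> family_finer d (family_meet h Rs) R \<and>
        field F \<and> (\<forall>j\<in>{1..d}. 1 \<le> n j) \<and> T \<in> tensors F d n \<and>
        (\<forall>i\<in>{1..h}. tensor_rank F d n (Rs i) T \<le> k i) \<and>
        \<not> tensor_rank F d n R T \<le> C" for C R and F :: "nat ring" and n T
  have "\<exists>C. \<forall>R F n T. \<not> bad C R F n T"
  proof (rule ccontr)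
    assume "\<not> ?thesis"
    \<comment> \<open>R, F, n and T are packed in one tuple, so that a single choice gives all four
      sequences.\<close>
    then have "\<forall>C. \<exists>X. bad C (fst X) (fst (snd X)) (fst (snd (snd X))) (snd (snd (snd X)))" by simp
    from choice[OF this] obtain X where
      "\<forall>C. bad C (fst (X C)) (fst (snd (X C))) (fst (snd (snd (X C)))) (snd (snd (snd (X C))))" ..
    then obtain R F n T where b: "\<And>C. bad C (R C) (F C) (n C) (T C)"
      by (intro that[of "\<lambda>C. fst (X C)" "\<lambda>C. fst (snd (X C))" "\<lambda>C. fst (snd (snd (X C)))"
        "\<lambda>C. snd (snd (snd (X C)))"]) blast
    have "\<exists>N. infinite {m. rank_decomp (F m) d (n m) (\<Inter>i\<in>{1..h}. refinements d (Rs i)) N (T m)}"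
    proof (rule uniform_rank_bound[OF _ d h Rs])
      show "field (F m)" for m using b[of m] by (simp add: bad_def)
      show "1 \<le> n m j" if "j \<in> {1..d}" for m j using b[of m] that by (simp add: bad_def)
      show "rank_decomp (F m) d (n m) (Rs i) (k i) (T m)" if "i \<in> {1..h}" for m i
        using b[of m] tensor_rank_le_iff[OF _ d Rs[OF that], of "F m" "T m" "n m" "k i"] that by (simp add: bad_def)
    qed
    then obtain N where N: "infinite {m. rank_decomp (F m) d (n m) (\<Inter>i\<in>{1..h}. refinements d (Rs i)) N (T m)}" ..
    then obtain m where m: "N \<le> m" "rank_decomp (F m) d (n m) (\<Inter>i\<in>{1..h}. refinements d (Rs i)) N (T m)"
      unfolding infinite_nat_iff_unbounded_le by auto
    have bm: "partition_family d (R m)" "family_finer d (family_meet h Rs) (R m)" "field (F m)"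
      "T m \<in> tensors (F m) d (n m)" "\<not> tensor_rank (F m) d (n m) (R m) (T m) \<le> m"
      using b[of m] by (auto simp: bad_def)
    have "rank_decomp (F m) d (n m) (R m) N (T m)"
      by (rule rank_decomp_coarsen[OF bm(3) m(2)]) (rule refinements_family_meet[OF h Rs bm(2)])
    then show False using tensor_rank_le_iff[OF bm(3) d bm(1,4), of N] bm(5) m(1) by simp
  qed
  then have ex: "\<exists>C. \<forall>R (F :: nat ring) n T.
        partition_family d R \<longrightarrow> family_finer d (family_meet h Rs) R \<longrightarrow>
        field F \<longrightarrow> (\<forall>j\<in>{1..d}. 1 \<le> n j) \<longrightarrow> T \<in> tensors F d n \<longrightarrow>
        (\<forall>i\<in>{1..h}. tensor_rank F d n (Rs i) T \<le> k i) \<longrightarrow>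
        tensor_rank F d n R T \<le> C"
    unfolding bad_def by blast
  show ?thesis using LeastI_ex[OF ex] R F n T k unfolding rank_bound_def by blast
qed

text \<open>One countable model contains the entries of T and the factors of its decompositions for
  all i, so the same bounds k i hold there. The decomposition for R that exists over the model is
  mapped back to F.\<close>

lemma tensor_rank_le_rank_bound:
  fixes F :: "'a ring"
  assumes d: "1 \<le> d" and h: "1 \<le> h" and Rs: "\<And>i. i \<in> {1..h} \<Longrightarrow> partition_family d (Rs i)"
    and R: "partition_family d R" "family_finer d (family_meet h Rs) R"
    and F: "field F" and n: "\<forall>j\<in>{1..d}. 1 \<le> n j" and T: "T \<in> tensors F d n"
    and k: "\<forall>i\<in>{1..h}. tensor_rank F d n (Rs i) T \<le> k i"
  shows "tensor_rank F d n R T \<le> rank_bound d h Rs k"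
proof -
  have n': "1 \<le> n j" if "j \<in> {1..d}" for j using n that by blast
  have dec: "rank_decomp F d n (Rs i) (k i) T" if "i \<in> {1..h}" for i
    using tensor_rank_le_iff[OF F d Rs[OF that] T] k that by blast
  define Q where "Q i E \<longleftrightarrow> finite E \<and> E \<subseteq> carrier F \<and> (\<forall>(G :: nat ring) \<eta> T'. field G \<longrightarrow> \<eta> \<in> ring_hom G F \<longrightarrow>
    inj_on \<eta> (carrier G) \<longrightarrow> E \<subseteq> \<eta> ` carrier G \<longrightarrow> T' \<in> tensors G d n \<longrightarrow>
    (\<forall>x\<in>grid {1..d} n. T x = \<eta> (T' x)) \<longrightarrow> rank_decomp G d n (Rs i) (k i) T')" for i E
  have "\<forall>i\<in>{1..h}. \<exists>E. Q i E"
    unfolding Q_def using rank_decomp_entries[OF F Rs n' dec] by blast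
  from bchoice[OF this] obtain E where E: "\<forall>i\<in>{1..h}. Q i (E i)" ..
  define A where "A = T ` grid {1..d} n \<union> (\<Union>i\<in>{1..h}. E i)"
  have "finite A" unfolding A_def using E by (auto simp: Q_def intro: finite_grid)
  moreover have "A \<subseteq> carrier F" unfolding A_def using E T by (auto simp: Q_def tensors_def)
  ultimately obtain G :: "nat ring" and \<eta> where G: "field G" and h': "\<eta> \<in> ring_hom G F"
    and inj: "inj_on \<eta> (carrier G)" and AG: "A \<subseteq> \<eta> ` carrier G"
    using countable_model[OF F] by blast
  define T' where "T' x = inv_into (carrier G) \<eta> (T x)" for x
  have TG: "T x \<in> \<eta> ` carrier G" if "x \<in> grid {1..d} n" for x using AG that unfolding A_def by blast
  have T': "T' \<in> tensors G d n" unfolding tensors_def T'_def using TG by (auto intro: inv_into_into)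
  have TT': "\<forall>x\<in>grid {1..d} n. T x = \<eta> (T' x)" unfolding T'_def using TG f_inv_into_f by metis
  have "rank_decomp G d n (Rs i) (k i) T'" if i: "i \<in> {1..h}" for i
  proof -
    have "E i \<subseteq> \<eta> ` carrier G" using AG i unfolding A_def by blast
    then show ?thesis using E i G h' inj T' TT' unfolding Q_def by blast
  qed
  then have "\<forall>i\<in>{1..h}. tensor_rank G d n (Rs i) T' \<le> k i"
    using tensor_rank_le_iff[OF G d Rs T'] by blast
  then have "tensor_rank G d n R T' \<le> rank_bound d h Rs k"
    using rank_bound_countable[OF d h Rs R G n T'] by blast
  then have "rank_decomp G d n R (rank_bound d h Rs k) T'"
    using tensor_rank_le_iff[OF G d R(1) T'] by blast
  then have "rank_decomp F d n R (rank_bound d h Rs k) T"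
    using TT' by (intro rank_decomp_hom[OF G F h' R(1)]) auto
  then show ?thesis using tensor_rank_le_iff[OF F d R(1) T] by blast
qed

section \<open>A lower bound for products of identity tensors\<close>

context field
begin

lemma finsum_swap:
  assumes "finite A" "finite B" "\<And>x y. x \<in> A \<Longrightarrow> y \<in> B \<Longrightarrow> f x y \<in> carrier R"
  shows "(\<Oplus>x\<in>A. \<Oplus>y\<in>B. f x y) = (\<Oplus>y\<in>B. \<Oplus>x\<in>A. f x y)"
  using assms(1,3)
proof (induction A rule: finite_induct)
  case empty
  then show ?case by simp
next
  case (insert x A)
  have "(\<Oplus>x\<in>insert x A. \<Oplus>y\<in>B. f x y) = (\<Oplus>y\<in>B. f x y) \<oplus> (\<Oplus>x\<in>A. \<Oplus>y\<in>B. f x y)"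
    using insert by (subst finsum_insert) (auto intro!: finsum_closed)
  also have "(\<Oplus>x\<in>A. \<Oplus>y\<in>B. f x y) = (\<Oplus>y\<in>B. \<Oplus>x\<in>A. f x y)" using insert by auto
  also have "(\<Oplus>y\<in>B. f x y) \<oplus> (\<Oplus>y\<in>B. \<Oplus>x\<in>A. f x y) = (\<Oplus>y\<in>B. f x y \<oplus> (\<Oplus>x\<in>A. f x y))"
    using insert by (subst finsum_addf) (auto intro!: finsum_closed)
  also have "\<dots> = (\<Oplus>y\<in>B. \<Oplus>x\<in>insert x A. f x y)"
  proof (rule finsum_cong')
    show "f x y \<oplus> (\<Oplus>x\<in>A. f x y) = (\<Oplus>x\<in>insert x A. f x y)" if "y \<in> B" for y
      using insert that by (subst finsum_insert) auto
    show "(\<lambda>y. \<Oplus>x\<in>insert x A. f x y) \<in> B \<rightarrow> carrier R"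
      using insert by (intro Pi_I finsum_closed) auto
  qed simp
  finally show ?case .
qed

lemma finsum_zero':
  "(\<And>x. x \<in> A \<Longrightarrow> f x = \<zero>) \<Longrightarrow> (\<Oplus>x\<in>A. f x) = \<zero>"
  using finsum_cong'[of A A "\<lambda>_. \<zero>" f] by simp

text \<open>Each homogeneous condition costs at most one point: at a y0 where the condition e has a
  non-zero coefficient, e determines g y0 from the other values, and substituting this leaves
  conditions on the remaining points. The value 1 elsewhere means that a contraction with g does not
  change the entries it picks out there.\<close>

lemma large_support_solution:
  assumes "finite E" "finite Y" "\<And>e y. e \<in> E \<Longrightarrow> y \<in> Y \<Longrightarrow> v e y \<in> carrier R"
  shows "\<exists>g Y0. Y0 \<subseteq> Y \<and> card Y0 \<le> card E \<and> (\<forall>y. g y \<in> carrier R) \<and> (\<forall>y\<in>Y - Y0. g y = \<one>) \<and>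
    (\<forall>e\<in>E. (\<Oplus>y\<in>Y. g y \<otimes> v e y) = \<zero>)"
  using assms
proof (induction E arbitrary: Y v rule: finite_induct)
  case empty
  show ?case by (intro exI[of _ "\<lambda>_. \<one>"] exI[of _ "{}"]) auto
next
  case (insert e E)
  show ?case
  proof (cases "\<forall>y\<in>Y. v e y = \<zero>")
    case True
    obtain g Y0 where g: "Y0 \<subseteq> Y" "card Y0 \<le> card E" "\<forall>y. g y \<in> carrier R" "\<forall>y\<in>Y - Y0. g y = \<one>"
      "\<forall>e\<in>E. (\<Oplus>y\<in>Y. g y \<otimes> v e y) = \<zero>"
      using insert.IH[of Y v] insert.prems by auto
    moreover have "(\<Oplus>y\<in>Y. g y \<otimes> v e y) = \<zero>" using True g(3) by (intro finsum_zero') auto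
    moreover have "card Y0 \<le> card (insert e E)" using g(2) insert.hyps by simp
    ultimately show ?thesis by (intro exI[of _ g] exI[of _ Y0]) auto
  next
    case False
    then obtain y0 where y0: "y0 \<in> Y" "v e y0 \<noteq> \<zero>" by auto
    define w where "w = inv (v e y0)"
    have vc: "v e' y \<in> carrier R" if "e' \<in> insert e E" "y \<in> Y" for e' y using insert.prems(2) that .
    have w: "w \<in> carrier R" "w \<otimes> v e y0 = \<one>" using y0 vc by (auto simp: w_def field_Units)
    let ?Y = "Y - {y0}"
    \<comment> \<open>The other conditions after the unknown at y0 has been eliminated by means of
      e.\<close>
    define v' where "v' e' y = v e' y \<oplus> (\<ominus> (v e' y0 \<otimes> w)) \<otimes> v e y" for e' y
    have "\<exists>g Y0. Y0 \<subseteq> ?Y \<and> card Y0 \<le> card E \<and> (\<forall>y. g y \<in> carrier R) \<and> (\<forall>y\<in>?Y - Y0. g y = \<one>) \<and>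
      (\<forall>e\<in>E. (\<Oplus>y\<in>?Y. g y \<otimes> v' e y) = \<zero>)"
      using insert.prems(1) vc w y0(1) by (intro insert.IH) (auto simp: v'_def)
    then obtain g' Y0 where g': "Y0 \<subseteq> ?Y" "card Y0 \<le> card E" "\<And>y. g' y \<in> carrier R" "\<And>y. y \<in> ?Y - Y0 \<Longrightarrow> g' y = \<one>"
      "\<And>e. e \<in> E \<Longrightarrow> (\<Oplus>y\<in>?Y. g' y \<otimes> v' e y) = \<zero>" by blast
    define s where "s e' = (\<Oplus>y\<in>?Y. g' y \<otimes> v e' y)" for e'
    have sc: "s e' \<in> carrier R" if "e' \<in> insert e E" for e'
      unfolding s_def using vc[OF that] g'(3) by (intro finsum_closed) auto
    \<comment> \<open>The value at y0 is the one that solves the condition e.\<close>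
    define g where "g = g'(y0 := \<ominus> (w \<otimes> s e))"
    have gc: "g y \<in> carrier R" for y using g'(3) w(1) sc[of e] by (auto simp: g_def)
    have split: "(\<Oplus>y\<in>Y. g y \<otimes> v e' y) = \<ominus> (w \<otimes> s e) \<otimes> v e' y0 \<oplus> s e'" if e': "e' \<in> insert e E" for e'
    proof -
      have "(\<Oplus>y\<in>insert y0 ?Y. g y \<otimes> v e' y) = g y0 \<otimes> v e' y0 \<oplus> (\<Oplus>y\<in>?Y. g y \<otimes> v e' y)"
        using insert.prems(1) gc vc[OF e'] y0(1) by (intro finsum_insert) auto
      also have "(\<Oplus>y\<in>?Y. g y \<otimes> v e' y) = s e'"
        unfolding s_def using g'(3) vc[OF e'] by (intro finsum_cong') (auto simp: g_def)
      finally show ?thesis using y0(1) by (simp add: g_def insert_absorb)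
    qed
    have "(\<Oplus>y\<in>Y. g y \<otimes> v e' y) = \<zero>" if e': "e' \<in> insert e E" for e'
    proof (cases "e' = e")
      case True
      have "\<ominus> (w \<otimes> s e) \<otimes> v e y0 \<oplus> s e = \<ominus> (w \<otimes> v e y0 \<otimes> s e) \<oplus> s e"
        using w(1) sc[of e] vc[of e y0] y0(1) by (simp add: l_minus r_minus m_ac)
      then show ?thesis using split[OF e'] True w sc[of e] by (simp add: l_neg)
    next
      case False
      then have eE: "e' \<in> E" using e' by simp
      have vy: "v e' y0 \<in> carrier R" using vc[OF e' y0(1)] .
      have "\<zero> = (\<Oplus>y\<in>?Y. g' y \<otimes> v' e' y)" using g'(5)[OF eE] by simp
      also have "\<dots> = (\<Oplus>y\<in>?Y. g' y \<otimes> v e' y \<oplus> (\<ominus> (v e' y0 \<otimes> w)) \<otimes> (g' y \<otimes> v e y))"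
      proof (rule finsum_cong')
        show "g' y \<otimes> v' e' y = g' y \<otimes> v e' y \<oplus> (\<ominus> (v e' y0 \<otimes> w)) \<otimes> (g' y \<otimes> v e y)" if "y \<in> ?Y" for y
        proof -
          have "v e' y \<in> carrier R" "v e y \<in> carrier R" "g' y \<in> carrier R" using vc e' that g'(3) by auto
          then show ?thesis unfolding v'_def using vy w(1) by algebra
        qed
      qed (use vc e' g'(3) vy w(1) in auto)
      also have "\<dots> = s e' \<oplus> (\<Oplus>y\<in>?Y. (\<ominus> (v e' y0 \<otimes> w)) \<otimes> (g' y \<otimes> v e y))"
        unfolding s_def using vc e' g'(3) vy w(1) by (intro finsum_addf) auto
      also have "(\<Oplus>y\<in>?Y. (\<ominus> (v e' y0 \<otimes> w)) \<otimes> (g' y \<otimes> v e y)) = (\<ominus> (v e' y0 \<otimes> w)) \<otimes> s e"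
        unfolding s_def using vc g'(3) vy w(1) insert.prems(1) by (intro finsum_rdistr[symmetric]) auto
      finally have "s e' \<oplus> (\<ominus> (v e' y0 \<otimes> w)) \<otimes> s e = \<zero>" ..
      moreover have "\<ominus> (w \<otimes> s e) \<otimes> v e' y0 \<oplus> s e' = s e' \<oplus> (\<ominus> (v e' y0 \<otimes> w)) \<otimes> s e"
        using w(1) vy sc[of e] sc[OF e'] by (simp add: l_minus r_minus m_ac a_comm)
      ultimately show ?thesis using split[OF e'] by simp
    qed
    moreover have "card (insert y0 Y0) \<le> card (insert e E)"
      using g'(2) insert.hyps card_insert_le_m1[of "card (insert e E)" Y0 y0] by simp
    moreover have "insert y0 Y0 \<subseteq> Y" using g'(1) y0 by auto
    moreover have "g y = \<one>" if "y \<in> Y - insert y0 Y0" for y using g'(4)[of y] that by (auto simp: g_def)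
    ultimately show ?thesis using gc by (intro exI[of _ g] exI[of _ "insert y0 Y0"]) auto
  qed
qed

section \<open>Elimination of coordinates from a sum of cutting products\<close>

definition cut_at :: "nat set \<Rightarrow> (nat \<Rightarrow> nat) \<Rightarrow> nat set \<Rightarrow> nat \<Rightarrow> bool" where
  "cut_at D \<pi> A c \<longleftrightarrow> (\<exists>j\<in>A. \<exists>j'\<in>D - A. \<pi> j = c \<and> \<pi> j' = c)"

text \<open>The colouring \<pi> encodes a partition of D by its colour classes. Numbering the parts
  also orders them, which the size condition of \<open>cut_sum\<close> uses.\<close>

definition diagonal_on :: "nat set \<Rightarrow> (nat \<Rightarrow> nat) \<Rightarrow> (nat \<Rightarrow> 'x) \<Rightarrow> bool" where
  "diagonal_on D \<pi> x \<longleftrightarrow> (\<forall>i\<in>D. \<forall>j\<in>D. \<pi> i = \<pi> j \<longrightarrow> x i = x j)"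

text \<open>The invariant of the elimination of coordinates. Only the support of T is prescribed, so that no
  weights have to be carried along. The last condition makes the box much longer in the directions of
  larger colours.\<close>

definition cut_sum ::
  "nat set \<Rightarrow> (nat \<Rightarrow> nat) \<Rightarrow> (nat \<Rightarrow> 'x set) \<Rightarrow> nat set \<Rightarrow> (nat \<Rightarrow> nat set) \<Rightarrow>
    (nat \<Rightarrow> (nat \<Rightarrow> 'x) \<Rightarrow> 'a) \<Rightarrow> (nat \<Rightarrow> (nat \<Rightarrow> 'x) \<Rightarrow> 'a) \<Rightarrow> ((nat \<Rightarrow> 'x) \<Rightarrow> 'a) \<Rightarrow> bool" where
  "cut_sum D \<pi> X I A a b T \<longleftrightarrow> finite D \<and> finite I \<and> (\<forall>c. finite (X c)) \<and>
     (\<forall>i\<in>I. A i \<subseteq> D \<and> a i \<in> coord_funs (A i) \<and> b i \<in> coord_funs (D - A i) \<and> (\<exists>c. cut_at D \<pi> (A i) c)) \<and>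
     (\<forall>x. (\<forall>j\<in>D. x j \<in> X (\<pi> j)) \<longrightarrow>
        T x = (\<Oplus>i\<in>I. a i x \<otimes> b i x) \<and> (T x \<noteq> \<zero> \<longleftrightarrow> diagonal_on D \<pi> x)) \<and>
     (\<forall>c\<in>\<pi> ` D. card {i\<in>I. cut_at D \<pi> (A i) c} * (\<Prod>j\<in>{j\<in>D. \<pi> j < c}. card (X (\<pi> j))) < card (X c))"

lemma cut_at_compl: "A \<subseteq> D \<Longrightarrow> cut_at D \<pi> (D - A) c \<longleftrightarrow> cut_at D \<pi> A c"
  by (auto simp: cut_at_def)

text \<open>The two factors of a summand are interchangeable and cuts are symmetric under
  complements, so in every summand the factor whose set contains j can be called a.\<close>

lemma cut_sum_flip:
  assumes "cut_sum D \<pi> X I A a b T" "j \<in> D"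
  obtains A' a' b' where "cut_sum D \<pi> X I A' a' b' T" "\<And>i. i \<in> I \<Longrightarrow> j \<in> A' i"
proof -
  define A' where "A' i = (if j \<in> A i then A i else D - A i)" for i
  define a' where "a' i = (if j \<in> A i then a i else b i)" for i
  define b' where "b' i = (if j \<in> A i then b i else a i)" for i
  have sub: "A i \<subseteq> D" if "i \<in> I" for i using assms that by (simp add: cut_sum_def)
  have cut: "cut_at D \<pi> (A' i) c \<longleftrightarrow> cut_at D \<pi> (A i) c" if "i \<in> I" for i c
    using cut_at_compl[OF sub[OF that]] by (simp add: A'_def)
  have sum_eq: "(\<Oplus>i\<in>I. a' i x \<otimes> b' i x) = (\<Oplus>i\<in>I. a i x \<otimes> b i x)" for x
  proof (rule finsum_cong')
    have "a i x \<in> carrier R" "b i x \<in> carrier R" if "i \<in> I" for i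
      using assms that coord_funs_carrier unfolding cut_sum_def by blast+
    then show "(\<lambda>i. a i x \<otimes> b i x) \<in> I \<rightarrow> carrier R"
      "\<And>i. i \<in> I \<Longrightarrow> a' i x \<otimes> b' i x = a i x \<otimes> b i x"
      by (auto simp: a'_def b'_def m_comm)
  qed simp
  have cut_eq: "{i \<in> I. cut_at D \<pi> (A' i) c} = {i \<in> I. cut_at D \<pi> (A i) c}" for c using cut by blast
  have coord: "A' i \<subseteq> D \<and> a' i \<in> coord_funs (A' i) \<and> b' i \<in> coord_funs (D - A' i) \<and> (\<exists>c. cut_at D \<pi> (A' i) c)"
    if i: "i \<in> I" for i
  proof -
    have "D - (D - A i) = A i" using sub[OF i] by blast
    then show ?thesis using assms(1) i cut[OF i] unfolding cut_sum_def A'_def a'_def b'_def by simp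
  qed
  have "cut_sum D \<pi> X I A' a' b' T"
    using assms(1) coord unfolding cut_sum_def sum_eq cut_eq by blast
  then show thesis using that assms(2) by (auto simp: A'_def)
qed

lemma coord_funs_upd:
  fixes f :: "(nat \<Rightarrow> 'p) \<Rightarrow> 'a"
  assumes "f \<in> coord_funs A" shows "(\<lambda>x. f (x(j := y))) \<in> coord_funs (A - {j})"
proof (rule coord_funsI)
  fix x z :: "nat \<Rightarrow> 'p" assume "\<And>i. i \<in> A - {j} \<Longrightarrow> x i = z i"
  then show "f (x(j := y)) = f (z(j := y))" by (intro coord_funsD[OF assms]) auto
qed (use assms coord_funs_carrier in blast)

text \<open>A colour with the single coordinate j is cut by no set, so fixing x j loses no cut. As
  this colour is the largest, the products in the size condition do not involve j.\<close>

lemma cut_sum_fix: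
  assumes cs: "cut_sum D \<pi> X I A a b T" and j: "j \<in> D" "\<And>i. i \<in> D \<Longrightarrow> \<pi> i \<le> \<pi> j"
    and single: "\<And>i. i \<in> D \<Longrightarrow> \<pi> i = \<pi> j \<Longrightarrow> i = j" and y: "y \<in> X (\<pi> j)"
  shows "cut_sum (D - {j}) \<pi> X I (\<lambda>i. A i - {j}) (\<lambda>i x. a i (x(j := y))) (\<lambda>i x. b i (x(j := y))) (\<lambda>x. T (x(j := y)))"
proof -
  have cut: "cut_at (D - {j}) \<pi> (A i - {j}) c \<longleftrightarrow> cut_at D \<pi> (A i) c" if "i \<in> I" for i c
  proof -
    have sub: "A i \<subseteq> D" using cs that by (simp add: cut_sum_def)
    show ?thesis
    proof
      assume "cut_at D \<pi> (A i) c"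
      then obtain l l' where l: "l \<in> A i" "l' \<in> D - A i" "\<pi> l = c" "\<pi> l' = c" by (auto simp: cut_at_def)
      have lD: "l \<in> D" "l' \<in> D" and ne: "l \<noteq> l'" using l sub by blast+
      have eq: "\<pi> l = \<pi> l'" using l by simp
      have "l \<noteq> j"
      proof
        assume "l = j"
        then have "l' = j" using single[OF lD(2)] eq by simp
        then show False using ne \<open>l = j\<close> by simp
      qed
      moreover have "l' \<noteq> j"
      proof
        assume "l' = j"
        then have "l = j" using single[OF lD(1)] eq by simp
        then show False using ne \<open>l' = j\<close> by simp
      qed
      ultimately show "cut_at (D - {j}) \<pi> (A i - {j}) c"
        using l unfolding cut_at_def by (intro bexI[of _ l] bexI[of _ l']) auto
    next
      assume "cut_at (D - {j}) \<pi> (A i - {j}) c"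
      then obtain l l' where l: "l \<in> A i - {j}" "l' \<in> D - {j} - (A i - {j})" "\<pi> l = c" "\<pi> l' = c"
        by (auto simp: cut_at_def)
      then show "cut_at D \<pi> (A i) c"
        unfolding cut_at_def by (intro bexI[of _ l] bexI[of _ l']) auto
    qed
  qed
  have set: "{i \<in> D - {j}. \<pi> i < c} = {i \<in> D. \<pi> i < c}" if "c \<in> \<pi> ` (D - {j})" for c
    using that j(2) by fastforce
  have diag: "diagonal_on D \<pi> (x(j := y)) \<longleftrightarrow> diagonal_on (D - {j}) \<pi> x" for x
  proof
    assume d: "diagonal_on D \<pi> (x(j := y))"
    have "x i = x l" if "i \<in> D - {j}" "l \<in> D - {j}" "\<pi> i = \<pi> l" for i l
      using d[unfolded diagonal_on_def, rule_format, of i l] that by auto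
    then show "diagonal_on (D - {j}) \<pi> x" unfolding diagonal_on_def by blast
  next
    assume d: "diagonal_on (D - {j}) \<pi> x"
    have "(x(j := y)) i = (x(j := y)) l" if "i \<in> D" "l \<in> D" "\<pi> i = \<pi> l" for i l
    proof (cases "i = j \<or> l = j")
      case True
      then have "i = l" using single[OF that(1)] single[OF that(2)] that(3) by auto
      then show ?thesis by simp
    next
      case False
      then show ?thesis using d[unfolded diagonal_on_def, rule_format, of i l] that by simp
    qed
    then show "diagonal_on D \<pi> (x(j := y))" unfolding diagonal_on_def by blast
  qed
  have D: "D - A i - {j} = D - {j} - (A i - {j})" for i by blast
  have coord: "(\<lambda>x. a i (x(j := y))) \<in> coord_funs (A i - {j})"
    "(\<lambda>x. b i (x(j := y))) \<in> coord_funs (D - {j} - (A i - {j}))" if "i \<in> I" for i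
    using cs that coord_funs_upd[of "a i" "A i" j y] coord_funs_upd[of "b i" "D - A i" j y]
    unfolding cut_sum_def D by auto
  have pt: "\<forall>i\<in>D. (x(j := y)) i \<in> X (\<pi> i)" if "\<forall>i\<in>D - {j}. x i \<in> X (\<pi> i)" for x
    using that y by auto
  have Tx: "T (x(j := y)) = (\<Oplus>i\<in>I. a i (x(j := y)) \<otimes> b i (x(j := y))) \<and>
      (T (x(j := y)) \<noteq> \<zero> \<longleftrightarrow> diagonal_on (D - {j}) \<pi> x)" if "\<forall>i\<in>D - {j}. x i \<in> X (\<pi> i)" for x
    using cs pt[OF that] diag[of x] unfolding cut_sum_def by blast
  have card: "card {i\<in>I. cut_at (D - {j}) \<pi> (A i - {j}) c} * (\<Prod>i\<in>{i\<in>D - {j}. \<pi> i < c}. card (X (\<pi> i))) < card (X c)"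
    if c: "c \<in> \<pi> ` (D - {j})" for c
  proof -
    have "{i\<in>I. cut_at (D - {j}) \<pi> (A i - {j}) c} = {i\<in>I. cut_at D \<pi> (A i) c}" using cut by blast
    then show ?thesis using cs c set[OF c] unfolding cut_sum_def by auto
  qed
  have fin: "finite (D - {j})" "finite I" "\<forall>c. finite (X c)"
    and sub: "\<forall>i\<in>I. A i \<subseteq> D" and ex: "\<forall>i\<in>I. \<exists>c. cut_at D \<pi> (A i) c"
    using cs by (auto simp: cut_sum_def)
  have ex': "\<forall>i\<in>I. \<exists>c. cut_at (D - {j}) \<pi> (A i - {j}) c" using ex cut by blast
  have sub': "\<forall>i\<in>I. A i - {j} \<subseteq> D - {j}" using sub by blast
  show ?thesis
    unfolding cut_sum_def
  proof (intro conjI)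
    show "\<forall>i\<in>I. A i - {j} \<subseteq> D - {j} \<and> (\<lambda>x. a i (x(j := y))) \<in> coord_funs (A i - {j}) \<and>
        (\<lambda>x. b i (x(j := y))) \<in> coord_funs (D - {j} - (A i - {j})) \<and> (\<exists>c. cut_at (D - {j}) \<pi> (A i - {j}) c)"
      using sub' ex' coord by blast
  qed (use fin Tx card in blast)+
qed


text \<open>\<open>Kill\<close> collects the summands whose first factor meets the largest colour c
  in j only. Such a factor depends on x j and on coordinates of smaller colours, so its contraction
  with g vanishes on the box once M conditions hold, one for each point in the smaller directions.
  The g of \<open>large_support_solution\<close> meets all of them and is 1 off a set
  \<open>Y0\<close> of at most \<open>card Kill * M\<close> points, which are removed from
  \<open>X c\<close>. The killed summands all cut c, as their sets contain j and omit j2, so the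
  left side of the size condition for c drops by at least \<open>card Kill * M\<close> as
  well.\<close>

lemma cut_sum_contract:
  fixes T :: "(nat \<Rightarrow> 'x) \<Rightarrow> 'a"
  assumes cs: "cut_sum D \<pi> X I A a b T" and j: "j \<in> D" "\<And>i. i \<in> D \<Longrightarrow> \<pi> i \<le> \<pi> j"
    and j2: "j2 \<in> D" "\<pi> j2 = \<pi> j" "j2 \<noteq> j" and jA: "\<And>i. i \<in> I \<Longrightarrow> j \<in> A i"
  shows "\<exists>X' I' a' b' (T' :: (nat \<Rightarrow> 'x) \<Rightarrow> 'a). cut_sum (D - {j}) \<pi> X' I' (\<lambda>i. A i - {j}) a' b' T'"
proof -
  define c where "c = \<pi> j"
  define B where "B = {i \<in> D. \<pi> i < c}"
  define Kill where "Kill = {i \<in> I. \<forall>l\<in>A i. \<pi> l = c \<longrightarrow> l = j}"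
  define M where "M = (\<Prod>l\<in>B. card (X (\<pi> l)))"
  have fin: "finite D" "finite I" "\<And>c. finite (X c)" and finB: "finite B"
    using cs by (auto simp: cut_sum_def B_def)
  have sub: "A i \<subseteq> D" and ai: "a i \<in> coord_funs (A i)" and bi: "b i \<in> coord_funs (D - A i)"
    and cuti: "\<exists>c. cut_at D \<pi> (A i) c" if "i \<in> I" for i
    using cs that by (auto simp: cut_sum_def)
  have ac: "a i x \<in> carrier R" and bc: "b i x \<in> carrier R" if "i \<in> I" for i x
    using ai[OF that] bi[OF that] coord_funs_carrier by auto
  have Tx: "T x = (\<Oplus>i\<in>I. a i x \<otimes> b i x)" "T x \<noteq> \<zero> \<longleftrightarrow> diagonal_on D \<pi> x"
    if "\<forall>l\<in>D. x l \<in> X (\<pi> l)" for x using cs that by (auto simp: cut_sum_def)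
  have size: "card {i\<in>I. cut_at D \<pi> (A i) e} * (\<Prod>l\<in>{l\<in>D. \<pi> l < e}. card (X (\<pi> l))) < card (X e)"
    if "e \<in> \<pi> ` D" for e using cs that unfolding cut_sum_def by blast
  have lt: "\<pi> l < c \<or> \<pi> l = c" if "l \<in> D" for l using j(2)[OF that] by (auto simp: c_def)
  define E where "E = Kill \<times> (\<Pi>\<^sub>E l\<in>B. X (\<pi> l))"
  have finE: "finite E" unfolding E_def Kill_def using fin finB by (intro finite_cartesian_product finite_PiE) auto
  have cardE: "card E = card Kill * M"
    unfolding E_def M_def using finB by (simp add: card_cartesian_product card_PiE)
  have acE: "a (fst e) ((snd e)(j := y)) \<in> carrier R" if "e \<in> E" for e y
    using that ac by (auto simp: E_def Kill_def)
  have "\<exists>g Y0. Y0 \<subseteq> X c \<and> card Y0 \<le> card E \<and> (\<forall>y. g y \<in> carrier R) \<and> (\<forall>y\<in>X c - Y0. g y = \<one>) \<and>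
      (\<forall>e\<in>E. (\<Oplus>y\<in>X c. g y \<otimes> a (fst e) ((snd e)(j := y))) = \<zero>)"
    by (rule large_support_solution[OF finE fin(3) acE])
  then obtain g Y0 where Y0: "Y0 \<subseteq> X c" "card Y0 \<le> card E" and gc: "\<And>y. g y \<in> carrier R"
    and g1: "\<And>y. y \<in> X c - Y0 \<Longrightarrow> g y = \<one>"
    and gE: "\<And>e. e \<in> E \<Longrightarrow> (\<Oplus>y\<in>X c. g y \<otimes> a (fst e) ((snd e)(j := y))) = \<zero>" by blast
  define X' where "X' = X(c := X c - Y0)"
  define I' where "I' = I - Kill"
  define a' where "a' i x = (\<Oplus>y\<in>X c. g y \<otimes> a i (x(j := y)))" for i x
  define T' where "T' x = (\<Oplus>y\<in>X c. g y \<otimes> T (x(j := y)))" for x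
  let ?D = "D - {j}"
  have a'c: "a' i x \<in> carrier R" if "i \<in> I" for i x
    unfolding a'_def using gc ac[OF that] by (intro finsum_closed) auto
  have a'i: "a' i \<in> coord_funs (A i - {j})" if "i \<in> I" for i
  proof (rule coord_funsI[OF a'c[OF that]])
    fix x z :: "nat \<Rightarrow> 'x" assume "\<And>l. l \<in> A i - {j} \<Longrightarrow> x l = z l"
    then have "a i (x(j := y)) = a i (z(j := y))" for y by (intro coord_funsD[OF ai[OF that]]) auto
    then show "a' i x = a' i z" by (simp add: a'_def)
  qed
  have b_upd: "b i (x(j := y)) = b i x" if "i \<in> I" for i x y
    using jA[OF that] by (intro coord_funsD[OF bi[OF that]]) auto
  have cut_c: "cut_at D \<pi> (A i) c" if "i \<in> Kill" for i
    using that j(1) j2 jA[of i] unfolding cut_at_def Kill_def c_def by blast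
  \<comment> \<open>The set of a surviving summand contains a coordinate l2 of colour c besides j,
    which replaces j as a witness of the cut.\<close>
  have cut': "cut_at ?D \<pi> (A i - {j}) e" if i: "i \<in> I'" and e: "cut_at D \<pi> (A i) e" for i e
  proof -
    have iI: "i \<in> I" "i \<notin> Kill" using i by (auto simp: I'_def)
    obtain l l' where l: "l \<in> A i" "l' \<in> D - A i" "\<pi> l = e" "\<pi> l' = e" using e by (auto simp: cut_at_def)
    obtain l2 where l2: "l2 \<in> A i" "\<pi> l2 = c" "l2 \<noteq> j" using iI by (auto simp: Kill_def)
    have "\<exists>l\<in>A i - {j}. \<pi> l = e"
      using l l2 by (cases "l = j") (auto simp: c_def)
    moreover have "l' \<in> ?D - (A i - {j})" using l jA[OF iI(1)] by auto
    ultimately show ?thesis using l(4) unfolding cut_at_def by blast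
  qed
  have cut'': "cut_at D \<pi> (A i) e" if "cut_at ?D \<pi> (A i - {j}) e" for i e
    using that unfolding cut_at_def by blast
  have main: "T' x = (\<Oplus>i\<in>I'. a' i x \<otimes> b i x) \<and> (T' x \<noteq> \<zero> \<longleftrightarrow> diagonal_on ?D \<pi> x)"
    if x: "\<forall>l\<in>?D. x l \<in> X' (\<pi> l)" for x
  proof
    have xX: "x l \<in> X (\<pi> l)" if "l \<in> ?D" for l
      using x that by (auto simp: X'_def split: if_splits)
    have pt: "\<forall>l\<in>D. (x(j := y)) l \<in> X (\<pi> l)" if "y \<in> X c" for y
      using that xX by (auto simp: c_def)
    have zero: "a' i x = \<zero>" if i: "i \<in> Kill" for i
    proof -
      have iI: "i \<in> I" using i by (simp add: Kill_def)
      have "restrict x B \<in> (\<Pi>\<^sub>E l\<in>B. X (\<pi> l))" using xX by (auto simp: B_def c_def)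
      then have e: "(i, restrict x B) \<in> E" using i by (simp add: E_def)
      \<comment> \<open>The conditions were imposed at points known on \<open>B\<close> only; this
        suffices because a killed factor sees nothing but j and \<open>B\<close>.\<close>
      have "a i ((restrict x B)(j := y)) = a i (x(j := y))" for y
      proof (rule coord_funsD[OF ai[OF iI]])
        fix l assume l: "l \<in> A i"
        then have "l = j \<or> l \<in> B" using i lt[of l] sub[OF iI] by (auto simp: Kill_def B_def)
        then show "((restrict x B)(j := y)) l = (x(j := y)) l" by auto
      qed
      then show ?thesis using gE[OF e] by (simp add: a'_def)
    qed
    have Tc: "T (x(j := y)) \<in> carrier R" if "y \<in> X c" for y
      unfolding Tx(1)[OF pt[OF that]] using ac bc by (intro finsum_closed) auto
    have "T' x = (\<Oplus>y\<in>X c. \<Oplus>i\<in>I. g y \<otimes> a i (x(j := y)) \<otimes> b i x)"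
      unfolding T'_def
    proof (rule finsum_cong')
      fix y assume y: "y \<in> X c"
      have "g y \<otimes> T (x(j := y)) = g y \<otimes> (\<Oplus>i\<in>I. a i (x(j := y)) \<otimes> b i (x(j := y)))"
        by (simp only: Tx(1)[OF pt[OF y]])
      also have "\<dots> = (\<Oplus>i\<in>I. g y \<otimes> (a i (x(j := y)) \<otimes> b i (x(j := y))))"
        using fin(2) gc ac bc by (intro finsum_rdistr) auto
      also have "\<dots> = (\<Oplus>i\<in>I. g y \<otimes> a i (x(j := y)) \<otimes> b i x)"
        using gc ac bc b_upd by (intro finsum_cong') (auto simp: m_assoc)
      finally show "g y \<otimes> T (x(j := y)) = (\<Oplus>i\<in>I. g y \<otimes> a i (x(j := y)) \<otimes> b i x)" .
    qed (use gc ac bc in \<open>auto intro!: finsum_closed\<close>)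
    also have "\<dots> = (\<Oplus>i\<in>I. \<Oplus>y\<in>X c. g y \<otimes> a i (x(j := y)) \<otimes> b i x)"
      using fin gc ac bc by (intro finsum_swap) auto
    also have "\<dots> = (\<Oplus>i\<in>I. a' i x \<otimes> b i x)"
    proof (rule finsum_cong')
      show "(\<Oplus>y\<in>X c. g y \<otimes> a i (x(j := y)) \<otimes> b i x) = a' i x \<otimes> b i x" if "i \<in> I" for i
        unfolding a'_def using fin(3) gc ac[OF that] bc[OF that] by (intro finsum_ldistr[symmetric]) auto
    qed (use a'c bc in auto)
    also have "\<dots> = (\<Oplus>i\<in>I'. a' i x \<otimes> b i x)"
      using fin(2) zero a'c bc unfolding I'_def
      by (intro add.finprod_mono_neutral_cong_right[simplified]) (auto simp: Kill_def)
    finally show "T' x = (\<Oplus>i\<in>I'. a' i x \<otimes> b i x)" .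
    have j2D: "j2 \<in> ?D" using j2 by auto
    have diag: "diagonal_on D \<pi> (x(j := y)) \<longleftrightarrow> diagonal_on ?D \<pi> x \<and> y = x j2" for y
    proof
      assume d: "diagonal_on D \<pi> (x(j := y))"
      have "x i = x l" if "i \<in> ?D" "l \<in> ?D" "\<pi> i = \<pi> l" for i l
        using d[unfolded diagonal_on_def, rule_format, of i l] that by auto
      moreover have "y = x j2" using d[unfolded diagonal_on_def, rule_format, of j j2] j j2 by auto
      ultimately show "diagonal_on ?D \<pi> x \<and> y = x j2" unfolding diagonal_on_def by blast
    next
      assume d: "diagonal_on ?D \<pi> x \<and> y = x j2"
      have dD: "x i = x l" if "i \<in> ?D" "l \<in> ?D" "\<pi> i = \<pi> l" for i l
        using d that unfolding diagonal_on_def by blast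
      define f where "f i = (if i = j then j2 else i)" for i
      have f: "f i \<in> ?D" "\<pi> (f i) = \<pi> i" if "i \<in> D" for i using that j2D j2(2) by (auto simp: f_def)
      have xf: "(x(j := y)) i = x (f i)" for i using d by (simp add: f_def)
      have "(x(j := y)) i = (x(j := y)) l" if "i \<in> D" "l \<in> D" "\<pi> i = \<pi> l" for i l
        unfolding xf by (rule dD) (use f that in auto)
      then show "diagonal_on D \<pi> (x(j := y))" unfolding diagonal_on_def by blast
    qed
    show "T' x \<noteq> \<zero> \<longleftrightarrow> diagonal_on ?D \<pi> x"
    proof (cases "diagonal_on ?D \<pi> x")
      case True
      \<comment> \<open>x j2 avoids \<open>Y0\<close>, so g is 1 there, and it is the only y for
        which the entry of T is non-zero. Thus T' has a single entry of T as its value.\<close>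
      have y2: "x j2 \<in> X c - Y0" using bspec[OF x j2D] j2(2) by (simp add: X'_def c_def)
      have nz: "T (x(j := y)) \<noteq> \<zero> \<longleftrightarrow> y = x j2" if "y \<in> X c" for y
        using Tx(2)[OF pt[OF that]] diag[of y] True by blast
      have "T' x = (\<Oplus>y\<in>X c. if x j2 = y then T (x(j := y)) else \<zero>)"
        unfolding T'_def
      proof (rule finsum_cong')
        show "g y \<otimes> T (x(j := y)) = (if x j2 = y then T (x(j := y)) else \<zero>)" if "y \<in> X c" for y
          using nz[OF that] gc g1 y2 Tc[OF that] by auto
      qed (use Tc in auto)
      also have "\<dots> = T (x(j := x j2))" using y2 fin(3) Tc by (intro finsum_singleton) auto
      finally show ?thesis using True nz[of "x j2"] y2 by simp
    next
      case False
      have "T (x(j := y)) = \<zero>" if "y \<in> X c" for y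
        using Tx(2)[OF pt[OF that]] diag[of y] False by blast
      then have "T' x = \<zero>" unfolding T'_def using gc by (intro finsum_zero') auto
      then show ?thesis using False by simp
    qed
  qed
  \<comment> \<open>Only \<open>X c\<close> has changed, and the largest colour c is not below
    e.\<close>
  have prod_eq: "(\<Prod>l\<in>{l\<in>?D. \<pi> l < e}. card (X' (\<pi> l))) = (\<Prod>l\<in>{l\<in>D. \<pi> l < e}. card (X (\<pi> l)))"
    if e: "e \<in> \<pi> ` ?D" for e
  proof -
    have "e \<le> c" using e lt by fastforce
    then show ?thesis by (intro prod.cong) (auto simp: X'_def c_def)
  qed
  have size': "card {i\<in>I'. cut_at ?D \<pi> (A i - {j}) e} * (\<Prod>l\<in>{l\<in>?D. \<pi> l < e}. card (X' (\<pi> l))) < card (X' e)"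
    if e: "e \<in> \<pi> ` ?D" for e
  proof -
    have eD: "e \<in> \<pi> ` D" using e by auto
    let ?C = "{i\<in>I. cut_at D \<pi> (A i) e}" and ?C' = "{i\<in>I'. cut_at ?D \<pi> (A i - {j}) e}"
    let ?m = "\<Prod>l\<in>{l\<in>D. \<pi> l < e}. card (X (\<pi> l))"
    have finC: "finite ?C" using fin by simp
    have C'C: "?C' \<subseteq> ?C" using cut'' by (auto simp: I'_def)
    show ?thesis
    proof (cases "e = c")
      case True
      have "?C' \<subseteq> ?C - Kill" using C'C by (auto simp: I'_def)
      moreover have KC: "Kill \<subseteq> ?C" using cut_c True by (auto simp: Kill_def)
      ultimately have "card ?C' \<le> card (?C - Kill)" using finC by (intro card_mono) auto
      also have "\<dots> = card ?C - card Kill" using KC finC finite_subset by (intro card_Diff_subset) auto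
      finally have le: "card ?C' \<le> card ?C - card Kill" .
      \<comment> \<open>This keeps the truncated subtraction below exact.\<close>
      have K: "card Kill \<le> card ?C" using KC finC by (rule card_mono[rotated])
      have mM: "?m = M" unfolding M_def B_def True by simp
      have "card ?C' * M \<le> (card ?C - card Kill) * M" using le by (rule mult_right_mono) simp
      also have "\<dots> = card ?C * M - card Kill * M" by (rule diff_mult_distrib)
      finally have "card ?C' * M \<le> card ?C * M - card Kill * M" .
      moreover have "card ?C * M < card (X c)" using size[OF eD] mM True by simp
      moreover have "card Kill * M \<le> card ?C * M" using K by (rule mult_right_mono) simp
      moreover have "card (X c - Y0) = card (X c) - card Y0"
        using Y0(1) fin(3) finite_subset by (intro card_Diff_subset) auto
      moreover have "card Y0 \<le> card Kill * M" using Y0(2) cardE by simp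
      ultimately have "card ?C' * M < card (X c - Y0)" by linarith
      then show ?thesis using prod_eq[OF e] mM True by (simp add: X'_def)
    next
      case False
      have "card ?C' * ?m \<le> card ?C * ?m" using card_mono[OF finC C'C] by (rule mult_right_mono) simp
      also have "\<dots> < card (X e)" by (rule size[OF eD])
      finally show ?thesis using prod_eq[OF e] False by (simp add: X'_def)
    qed
  qed
  have "cut_sum ?D \<pi> X' I' (\<lambda>i. A i - {j}) a' b T'"
    unfolding cut_sum_def
  proof (intro conjI)
    show "finite ?D" "finite I'" using fin by (auto simp: I'_def)
    show "\<forall>c. finite (X' c)" using fin(3) by (simp add: X'_def)
    show "\<forall>i\<in>I'. A i - {j} \<subseteq> ?D \<and> a' i \<in> coord_funs (A i - {j}) \<and> b i \<in> coord_funs (?D - (A i - {j})) \<and>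
        (\<exists>c. cut_at ?D \<pi> (A i - {j}) c)"
    proof
      fix i assume i: "i \<in> I'"
      then have iI: "i \<in> I" by (simp add: I'_def)
      have "?D - (A i - {j}) = D - A i" using jA[OF iI] by auto
      then show "A i - {j} \<subseteq> ?D \<and> a' i \<in> coord_funs (A i - {j}) \<and> b i \<in> coord_funs (?D - (A i - {j})) \<and>
        (\<exists>c. cut_at ?D \<pi> (A i - {j}) c)"
        using sub[OF iI] a'i[OF iI] bi[OF iI] cuti[OF iI] cut'[OF i] by auto
    qed
  qed (use main size' in blast)+
  then show ?thesis by blast
qed

text \<open>Induction on the number of coordinates, always at the largest colour: a coordinate is
  contracted while the colour has several, and the last one is fixed. With no coordinate left
  nothing can be cut, so T is an empty sum; but every point is then diagonal and T has to be
  non-zero there.\<close>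

lemma cut_sum_impossible: "\<not> cut_sum D \<pi> X I A a b T"
proof (induction "card D" arbitrary: D X I A a b T)
  case 0
  show ?case
  proof
    assume cs: "cut_sum D \<pi> X I A a b T"
    then have "D = {}" using 0 by (simp add: cut_sum_def)
    moreover then have "I = {}" using cs unfolding cut_sum_def cut_at_def by blast
    ultimately show False using cs by (simp add: cut_sum_def diagonal_on_def)
  qed
next
  case (Suc n)
  show ?case
  proof
    assume cs: "cut_sum D \<pi> X I A a b T"
    have fin: "finite D" using cs by (simp add: cut_sum_def)
    have "D \<noteq> {}" using Suc(2) by auto
    then have "Max (\<pi> ` D) \<in> \<pi> ` D" using fin by (intro Max_in) auto
    then obtain j where j: "j \<in> D" "\<pi> j = Max (\<pi> ` D)" by force
    have max: "\<pi> i \<le> \<pi> j" if "i \<in> D" for i using j(2) that fin by simp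
    have cD: "n = card (D - {j})" using Suc(2) j(1) fin by simp
    show False
    proof (cases "\<forall>i\<in>D. \<pi> i = \<pi> j \<longrightarrow> i = j")
      case True
      \<comment> \<open>The strict size condition guarantees a point at which x j can be
        fixed.\<close>
      have "card (X (\<pi> j)) > 0" using cs j(1) unfolding cut_sum_def by fastforce
      then obtain y where y: "y \<in> X (\<pi> j)" by fastforce
      show False using cut_sum_fix[OF cs j(1) max _ y] True Suc(1)[OF cD] by blast
    next
      case False
      then obtain j2 where j2: "j2 \<in> D" "\<pi> j2 = \<pi> j" "j2 \<noteq> j" by auto
      obtain A' a' b' where cs': "cut_sum D \<pi> X I A' a' b' T" and jA: "\<And>i. i \<in> I \<Longrightarrow> j \<in> A' i"
        using cut_sum_flip[OF cs j(1)] by blast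
      show False using cut_sum_contract[OF cs' j(1) max j2 jA] Suc(1)[OF cD] by blast
    qed
  qed
qed

end

section \<open>The rank of products of identity tensors\<close>

lemma part_separated:
  assumes P: "partition_on A P" and Q: "partition_on A Q" and nref: "\<not> refines A P Q"
  obtains J B where "J \<in> P" "B \<in> Q" "J \<inter> B \<noteq> {}" "J - B \<noteq> {}"
proof -
  obtain J where J: "J \<in> P" "\<And>Y. Y \<in> Q \<Longrightarrow> \<not> J \<subseteq> Y"
    using nref P Q by (auto simp: refines_def)
  have "J \<noteq> {}" using P J(1) by (auto simp: partition_on_def)
  then obtain j where j: "j \<in> J" by auto
  then obtain B where B: "B \<in> Q" "j \<in> B" using P Q J(1) unfolding partition_on_def by blast
  then have "J - B \<noteq> {}" "J \<inter> B \<noteq> {}" using J(2) j by auto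
  then show thesis using that J(1) B(1) by blast
qed

text \<open>This is the product over the parts J of P of the identity tensors in the coordinates of J.\<close>

definition diagonal_tensor :: "'a ring \<Rightarrow> nat set set \<Rightarrow> (nat \<Rightarrow> nat) \<Rightarrow> 'a" where
  "diagonal_tensor F P x = (if \<forall>J\<in>P. \<forall>i\<in>J. \<forall>j\<in>J. x i = x j then \<one>\<^bsub>F\<^esub> else \<zero>\<^bsub>F\<^esub>)"

lemma diagonal_tensor_rank_le_one:
  fixes F :: "'a ring"
  assumes "field F" and P: "partition_on {1..d} P"
  shows "rank_le_one F d n {P} (diagonal_tensor F P)"
proof -
  interpret field F by fact
  have finP: "finite P" by (rule finite_elements[OF _ P]) simp
  define a where "a J x = (if \<forall>i\<in>J. \<forall>j\<in>J. x i = x j then \<one>\<^bsub>F\<^esub> else \<zero>\<^bsub>F\<^esub>)" for J and x :: "nat \<Rightarrow> nat"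
  have ac: "a J x \<in> carrier F" for J x by (simp add: a_def)
  have "diagonal_tensor F P x = (\<Otimes>\<^bsub>F\<^esub>J\<in>P. a J (restrict x J))" for x
  proof (cases "\<forall>J\<in>P. \<forall>i\<in>J. \<forall>j\<in>J. x i = x j")
    case True
    have "a J (restrict x J) = \<one>\<^bsub>F\<^esub>" if "J \<in> P" for J
    proof -
      have "\<forall>i\<in>J. \<forall>j\<in>J. restrict x J i = restrict x J j"
      proof (intro ballI)
        fix i j assume "i \<in> J" "j \<in> J"
        then show "restrict x J i = restrict x J j" using True[rule_format, OF that, of i j] by simp
      qed
      then show ?thesis unfolding a_def by (rule if_P)
    qed
    then have "(\<Otimes>\<^bsub>F\<^esub>J\<in>P. a J (restrict x J)) = (\<Otimes>\<^bsub>F\<^esub>J\<in>P. \<one>\<^bsub>F\<^esub>)"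
      by (intro finprod_cong') auto
    moreover have "diagonal_tensor F P x = \<one>\<^bsub>F\<^esub>" unfolding diagonal_tensor_def using True by (rule if_P)
    ultimately show ?thesis by simp
  next
    case False
    then obtain J i j where J: "J \<in> P" "i \<in> J" "j \<in> J" "x i \<noteq> x j" by blast
    then have "restrict x J i \<noteq> restrict x J j" by simp
    then have "\<not> (\<forall>i\<in>J. \<forall>j\<in>J. restrict x J i = restrict x J j)" using J(2,3) by blast
    then have "a J (restrict x J) = \<zero>\<^bsub>F\<^esub>" unfolding a_def by (rule if_not_P)
    then have "(\<Otimes>\<^bsub>F\<^esub>J\<in>P. a J (restrict x J)) = \<zero>\<^bsub>F\<^esub>" using ac by (intro finprod_zero[OF finP J(1)]) auto
    moreover have "diagonal_tensor F P x = \<zero>\<^bsub>F\<^esub>" unfolding diagonal_tensor_def using False by (rule if_not_P)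
    ultimately show ?thesis by simp
  qed
  then show ?thesis unfolding rank_le_one_def using ac by (intro bexI[of _ P] exI[of _ a]) auto
qed

lemma diagonal_tensor_tensors: "field F \<Longrightarrow> diagonal_tensor F P \<in> tensors F d n"
  unfolding tensors_def diagonal_tensor_def
  by (auto simp: field_def domain_def cring.cring_simprules(2,6))

text \<open>By \<open>part_separated\<close> the partition of each summand has a part that cuts a
  part of P. Its factor becomes a, and the product of all other factors becomes b.\<close>

lemma rank_decomp_cut:
  fixes F :: "'a ring"
  assumes "field F" and R: "partition_family d R" and P: "partition_on {1..d} P"
    and nref: "\<And>Q. Q \<in> R \<Longrightarrow> \<not> refines {1..d} P Q" and n: "\<And>j. j \<in> {1..d} \<Longrightarrow> 1 \<le> n j"
    and dec: "rank_decomp F d n R k T"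
  obtains A a b where
    "\<And>i. i \<in> {1..k} \<Longrightarrow> A i \<subseteq> {1..d} \<and> a i \<in> field.coord_funs F (A i) \<and> b i \<in> field.coord_funs F ({1..d} - A i) \<and>
      (\<exists>J\<in>P. J \<inter> A i \<noteq> {} \<and> J - A i \<noteq> {})"
    "\<And>x. T (grid_point d n x) = (\<Oplus>\<^bsub>F\<^esub>i\<in>{1..k}. a i x \<otimes>\<^bsub>F\<^esub> b i x)"
proof -
  interpret field F by fact
  obtain Q c where Q: "\<And>i. i \<in> {1..k} \<Longrightarrow> Q i \<in> R"
    and c: "\<And>i J. i \<in> {1..k} \<Longrightarrow> J \<in> Q i \<Longrightarrow> c i J \<in> coord_funs J"
    and T: "\<And>x. T (grid_point d n x) = (\<Oplus>\<^bsub>F\<^esub>i\<in>{1..k}. \<Otimes>\<^bsub>F\<^esub>J\<in>Q i. c i J x)"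
    using rank_decomp_total[OF assms(1) R n dec] by blast
  have Qp: "partition_on {1..d} (Q i)" if "i \<in> {1..k}" for i by (rule partition_familyD[OF R Q[OF that]])
  have "\<forall>i\<in>{1..k}. \<exists>B. B \<in> Q i \<and> (\<exists>J\<in>P. J \<inter> B \<noteq> {} \<and> J - B \<noteq> {})"
    using part_separated[OF P Qp nref[OF Q]] by metis
  from bchoice[OF this] obtain A where A: "\<forall>i\<in>{1..k}. A i \<in> Q i \<and> (\<exists>J\<in>P. J \<inter> A i \<noteq> {} \<and> J - A i \<noteq> {})" ..
  define a where "a i = c i (A i)" for i
  define b where "b i x = (\<Otimes>\<^bsub>F\<^esub>J\<in>Q i - {A i}. c i J x)" for i x
  have cc: "c i J x \<in> carrier F" if "i \<in> {1..k}" "J \<in> Q i" for i J x using c[OF that] coord_funs_carrier by blast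
  have ac: "a i \<in> coord_funs (A i)" if "i \<in> {1..k}" for i unfolding a_def using c A that by blast
  have bc: "b i \<in> coord_funs ({1..d} - A i)" if i: "i \<in> {1..k}" for i
  proof -
    have "(\<lambda>x. \<Otimes>\<^bsub>F\<^esub>J\<in>Q i - {A i}. c i J x) \<in> coord_funs (\<Union>(Q i - {A i}))"
      using c[OF i] by (intro coord_funs_finprod) auto
    then show ?thesis using partition_on_Union_remove[OF Qp[OF i], of "A i"] A i by (simp add: b_def[abs_def])
  qed
  have prod: "(\<Otimes>\<^bsub>F\<^esub>J\<in>Q i. c i J x) = a i x \<otimes>\<^bsub>F\<^esub> b i x" if i: "i \<in> {1..k}" for i x
  proof -
    have "finite (Q i)" by (rule finite_elements[OF _ Qp[OF i]]) simp
    then have "(\<Otimes>\<^bsub>F\<^esub>J\<in>insert (A i) (Q i - {A i}). c i J x) = a i x \<otimes>\<^bsub>F\<^esub> b i x"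
      unfolding a_def b_def using cc[OF i] A i by (intro finprod_insert) auto
    then show ?thesis using A i by (simp add: insert_absorb)
  qed
  have "(\<Oplus>\<^bsub>F\<^esub>i\<in>{1..k}. \<Otimes>\<^bsub>F\<^esub>J\<in>Q i. c i J x) = (\<Oplus>\<^bsub>F\<^esub>i\<in>{1..k}. a i x \<otimes>\<^bsub>F\<^esub> b i x)" for x
    using prod ac bc coord_funs_carrier by (intro finsum_cong') blast+
  moreover have "A i \<subseteq> {1..d}" if "i \<in> {1..k}" for i using partition_on_subset[OF Qp[OF that]] A that by blast
  ultimately show thesis using that[of A a b] A ac bc T by simp
qed

text \<open>For c > 0 there are at most d terms, each at most (d+1)^(c-1), and 1 is at most this
  power too. This is the size condition on the level of exponents, where the extra 1 pays for the
  factor k.\<close>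

lemma sum_geometric_colours:
  fixes \<pi> :: "nat \<Rightarrow> nat"
  assumes "finite B" "card B \<le> d" "\<And>j. j \<in> B \<Longrightarrow> \<pi> j < c"
  shows "1 + (\<Sum>j\<in>B. (d + 1) ^ \<pi> j) \<le> (d + 1) ^ c"
proof (cases c)
  case 0
  then have "B = {}" using assms(3) by auto
  then show ?thesis using 0 by simp
next
  case (Suc e)
  have "(\<Sum>j\<in>B. (d + 1) ^ \<pi> j) \<le> (\<Sum>j\<in>B. (d + 1) ^ e)"
    using assms(3) Suc by (intro sum_mono power_increasing) (auto simp: less_Suc_eq_le)
  also have "\<dots> \<le> d * (d + 1) ^ e" using assms(2) by simp
  finally have "1 + (\<Sum>j\<in>B. (d + 1) ^ \<pi> j) \<le> (d + 1) ^ e + d * (d + 1) ^ e"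
    by (intro add_mono) auto
  then show ?thesis using Suc by simp
qed

text \<open>Otherwise the grid contains a box whose side in each direction of colour c is
  (k+1)^((d+1)^c), as all colours are below d. On this box a decomposition into k summands would be
  a \<open>cut_sum\<close>.\<close>

lemma diagonal_tensor_rank_lower:
  fixes F :: "'a ring"
  assumes F: "field F" and d: "1 \<le> d" and R: "partition_family d R" and P: "partition_on {1..d} P"
    and nref: "\<And>Q. Q \<in> R \<Longrightarrow> \<not> refines {1..d} P Q" and m: "1 \<le> m"
    and dec: "rank_decomp F d (\<lambda>_. m) R k (diagonal_tensor F P)"
  shows "m < (k + 1) ^ ((d + 1) ^ (d - 1))"
proof (rule ccontr)
  assume "\<not> ?thesis"
  then have big: "(k + 1) ^ ((d + 1) ^ (d - 1)) \<le> m" by simp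
  interpret field F by fact
  obtain A a b where
    A: "\<And>i. i \<in> {1..k} \<Longrightarrow> A i \<subseteq> {1..d} \<and> a i \<in> coord_funs (A i) \<and> b i \<in> coord_funs ({1..d} - A i) \<and>
      (\<exists>J\<in>P. J \<inter> A i \<noteq> {} \<and> J - A i \<noteq> {})"
    and T: "\<And>x. diagonal_tensor F P (grid_point d (\<lambda>_. m) x) = (\<Oplus>\<^bsub>F\<^esub>i\<in>{1..k}. a i x \<otimes>\<^bsub>F\<^esub> b i x)"
    using rank_decomp_cut[OF F R P nref m dec] by blast
  have finP: "finite P" by (rule finite_elements[OF _ P]) simp
  \<comment> \<open>Any numbering of the parts can serve as the colouring.\<close>
  obtain e where e: "bij_betw e P {0..<card P}" using ex_bij_betw_finite_nat[OF finP] by blast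
  define part where "part j = (THE J. J \<in> P \<and> j \<in> J)" for j
  have part: "part j = J" if "J \<in> P" "j \<in> J" for j J
    unfolding part_def
  proof (rule the_equality)
    show "J \<in> P \<and> j \<in> J" using that by simp
    have dj: "\<And>K L. K \<in> P \<Longrightarrow> L \<in> P \<Longrightarrow> K \<noteq> L \<Longrightarrow> K \<inter> L = {}"
      using P by (simp add: partition_on_def disjoint_def)
    show "K = J" if "K \<in> P \<and> j \<in> K" for K
      using dj[of K J] that \<open>J \<in> P\<close> \<open>j \<in> J\<close> by blast
  qed
  have part_in: "part j \<in> P" "j \<in> part j" if "j \<in> {1..d}" for j
  proof -
    have "j \<in> \<Union>P" using that by (simp only: partition_onD1[OF P, symmetric])
    then obtain J where J: "J \<in> P" "j \<in> J" by (rule UnionE)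
    show "part j \<in> P" "j \<in> part j" unfolding part[OF J] by (rule J)+
  qed
  define \<pi> where "\<pi> j = e (part j)" for j
  have pi_eq: "\<pi> i = \<pi> j \<longleftrightarrow> part i = part j" if "i \<in> {1..d}" "j \<in> {1..d}" for i j
    unfolding \<pi>_def by (rule inj_on_eq_iff[OF bij_betw_imp_inj_on[OF e] part_in(1)[OF that(1)] part_in(1)[OF that(2)]])
  have same: "\<pi> i = \<pi> j" if "J \<in> P" "i \<in> J" "j \<in> J" for i j J
    unfolding \<pi>_def part[OF that(1,2)] part[OF that(1,3)] ..
  have cardP: "card P \<le> d"
  proof -
    have "P \<subseteq> part ` {1..d}"
    proof
      fix J assume J: "J \<in> P"
      have "J \<noteq> {}" using P J by (auto simp: partition_on_def)
      then obtain j where j: "j \<in> J" by blast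
      then have "j \<in> {1..d}" using partition_on_subset[OF P J] by blast
      then show "J \<in> part ` {1..d}" using part[OF J j] by blast
    qed
    then have "card P \<le> card (part ` {1..d})" by (intro card_mono) auto
    also have "\<dots> \<le> d" using card_image_le[of "{1..d}" part] by simp
    finally show ?thesis .
  qed
  have pi_less: "\<pi> j \<le> d - 1" if "j \<in> {1..d}" for j
  proof -
    have "\<pi> j \<in> {0..<card P}" unfolding \<pi>_def using e part_in(1)[OF that] by (auto simp: bij_betw_def)
    then show ?thesis using cardP by simp
  qed
  \<comment> \<open>Let s be the sum of (d+1)^(\<pi> j) over the coordinates j of smaller colour
    than c. At most k summands cut c, and k (k+1)^s < (k+1)^(1+s) \<le> N c by
    \<open>sum_geometric_colours\<close>.\<close>
  define N where "N c = (k + 1) ^ ((d + 1) ^ c)" for c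
  define X where "X c = {1..N c}" for c
  have diag: "(\<forall>J\<in>P. \<forall>i\<in>J. \<forall>j\<in>J. x i = x j) \<longleftrightarrow> diagonal_on {1..d} \<pi> x" for x :: "nat \<Rightarrow> nat"
  proof
    assume *: "\<forall>J\<in>P. \<forall>i\<in>J. \<forall>j\<in>J. x i = x j"
    show "diagonal_on {1..d} \<pi> x"
      unfolding diagonal_on_def
    proof (intro ballI impI)
      fix i j assume ij: "i \<in> {1..d}" "j \<in> {1..d}" "\<pi> i = \<pi> j"
      then have "part i = part j" using pi_eq by blast
      then have "j \<in> part i" using part_in(2)[OF ij(2)] by simp
      then show "x i = x j" by (rule *[rule_format, OF part_in[OF ij(1)]])
    qed
  next
    assume *: "diagonal_on {1..d} \<pi> x"
    show "\<forall>J\<in>P. \<forall>i\<in>J. \<forall>j\<in>J. x i = x j"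
    proof (intro ballI)
      fix J i j assume J: "J \<in> P" "i \<in> J" "j \<in> J"
      have "i \<in> {1..d}" "j \<in> {1..d}" using partition_on_subset[OF P J(1)] J(2,3) by blast+
      then show "x i = x j" using * same[OF J] unfolding diagonal_on_def by blast
    qed
  qed
  have "cut_sum {1..d} \<pi> X {1..k} A a b (\<lambda>x. diagonal_tensor F P (grid_point d (\<lambda>_. m) x))"
    unfolding cut_sum_def
  proof (intro conjI ballI allI impI)
    fix i assume i: "i \<in> {1..k}"
    show "A i \<subseteq> {1..d}" "a i \<in> coord_funs (A i)" "b i \<in> coord_funs ({1..d} - A i)" using A[OF i] by auto
    obtain J j j' where J: "J \<in> P" "j \<in> J" "j \<in> A i" "j' \<in> J" "j' \<notin> A i" using A[OF i] by blast
    then have "j' \<in> {1..d}" using partition_on_subset[OF P] by blast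
    then show "\<exists>c. cut_at {1..d} \<pi> (A i) c"
      using J same[OF J(1,2,4)] unfolding cut_at_def by blast
  next
    fix x :: "nat \<Rightarrow> nat" assume x: "\<forall>j\<in>{1..d}. x j \<in> X (\<pi> j)"
    have "grid_point d (\<lambda>_. m) x j = x j" if j: "j \<in> {1..d}" for j
    proof -
      have "N (\<pi> j) \<le> (k + 1) ^ ((d + 1) ^ (d - 1))"
        unfolding N_def using pi_less[OF j] by (intro power_increasing) auto
      moreover have "1 \<le> x j" "x j \<le> N (\<pi> j)" using bspec[OF x j] by (auto simp: X_def)
      ultimately have "x j \<in> {1..m}" using big by simp
      then show ?thesis using j by (simp add: grid_point_def)
    qed
    then have "diagonal_on {1..d} \<pi> (grid_point d (\<lambda>_. m) x) \<longleftrightarrow> diagonal_on {1..d} \<pi> x"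
      by (simp add: diagonal_on_def)
    then show "diagonal_tensor F P (grid_point d (\<lambda>_. m) x) \<noteq> \<zero>\<^bsub>F\<^esub> \<longleftrightarrow> diagonal_on {1..d} \<pi> x"
      unfolding diagonal_tensor_def diag by simp
  next
    fix c assume "c \<in> \<pi> ` {1..d}"
    let ?B = "{j \<in> {1..d}. \<pi> j < c}"
    have "card {i \<in> {1..k}. cut_at {1..d} \<pi> (A i) c} \<le> card {1..k}" by (intro card_mono) auto
    then have "card {i \<in> {1..k}. cut_at {1..d} \<pi> (A i) c} * (\<Prod>j\<in>?B. card (X (\<pi> j))) \<le> k * (\<Prod>j\<in>?B. N (\<pi> j))"
      by (simp add: X_def mult_right_mono)
    also have "(\<Prod>j\<in>?B. N (\<pi> j)) = (k + 1) ^ (\<Sum>j\<in>?B. (d + 1) ^ \<pi> j)"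
      unfolding N_def by (simp add: power_sum)
    also have "k * (k + 1) ^ (\<Sum>j\<in>?B. (d + 1) ^ \<pi> j) < (k + 1) ^ (1 + (\<Sum>j\<in>?B. (d + 1) ^ \<pi> j))" by simp
    also have "\<dots> \<le> (k + 1) ^ ((d + 1) ^ c)"
    proof (intro power_increasing sum_geometric_colours)
      have "card ?B \<le> card {1..d}" by (intro card_mono) auto
      then show "card ?B \<le> d" by simp
    qed auto
    finally show "card {i \<in> {1..k}. cut_at {1..d} \<pi> (A i) c} * (\<Prod>j\<in>?B. card (X (\<pi> j))) < card (X c)"
      by (simp add: X_def N_def)
  qed (auto simp: X_def T)
  then show False using cut_sum_impossible by blast
qed

text \<open>A power of k + 1 is not bounded by a power of k when k = 1, so this case needs a direct
  argument. A single product a b that is non-zero at the constant points 1 and 2 is non-zero at the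
  point equal to 1 on the coordinates of a and 2 elsewhere; but this point is not constant on the
  part of P that is cut.\<close>

lemma diagonal_tensor_rank_one:
  fixes F :: "'a ring"
  assumes F: "field F" and R: "partition_family d R" and P: "partition_on {1..d} P"
    and nref: "\<And>Q. Q \<in> R \<Longrightarrow> \<not> refines {1..d} P Q" and m: "1 \<le> m"
    and dec: "rank_decomp F d (\<lambda>_. m) R 1 (diagonal_tensor F P)"
  shows "m = 1"
proof (rule ccontr)
  assume "m \<noteq> 1"
  then have m2: "2 \<le> m" using m by simp
  interpret field F by fact
  obtain A a b where
    A: "\<And>i. i \<in> {1..1::nat} \<Longrightarrow> A i \<subseteq> {1..d} \<and> a i \<in> coord_funs (A i) \<and> b i \<in> coord_funs ({1..d} - A i) \<and>
      (\<exists>J\<in>P. J \<inter> A i \<noteq> {} \<and> J - A i \<noteq> {})"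
    and T: "\<And>x. diagonal_tensor F P (grid_point d (\<lambda>_. m) x) = (\<Oplus>\<^bsub>F\<^esub>i\<in>{1..1::nat}. a i x \<otimes>\<^bsub>F\<^esub> b i x)"
    using rank_decomp_cut[OF F R P nref m dec] by blast
  let ?T = "\<lambda>x. diagonal_tensor F P (grid_point d (\<lambda>_. m) x)"
  have ac: "a 1 \<in> coord_funs (A 1)" and bc: "b 1 \<in> coord_funs ({1..d} - A 1)" using A[of 1] by auto
  have car: "a 1 x \<in> carrier F" "b 1 x \<in> carrier F" for x using ac bc coord_funs_carrier by auto
  have T1: "?T x = a 1 x \<otimes>\<^bsub>F\<^esub> b 1 x" for x using T[of x] car by simp
  have Pd: "j \<in> {1..d}" if "J \<in> P" "j \<in> J" for J j using partition_on_subset[OF P that(1)] that(2) by blast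
  have const: "?T (\<lambda>_. c) \<noteq> \<zero>\<^bsub>F\<^esub>" if "c \<in> {1..m}" for c
  proof -
    have "grid_point d (\<lambda>_. m) (\<lambda>_. c) j = c" if "j \<in> {1..d}" for j
      using that \<open>c \<in> {1..m}\<close> by (simp add: grid_point_def)
    then have "\<forall>J\<in>P. \<forall>i\<in>J. \<forall>j\<in>J. grid_point d (\<lambda>_. m) (\<lambda>_. c) i = grid_point d (\<lambda>_. m) (\<lambda>_. c) j"
      using Pd by metis
    then have "?T (\<lambda>_. c) = \<one>\<^bsub>F\<^esub>" unfolding diagonal_tensor_def by (rule if_P)
    then show ?thesis by simp
  qed
  define z where "z j = (if j \<in> A 1 then 1 else 2 :: nat)" for j
  have "a 1 z = a 1 (\<lambda>_. 1)" by (rule coord_funsD[OF ac]) (simp add: z_def)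
  moreover have "b 1 z = b 1 (\<lambda>_. 2)" by (rule coord_funsD[OF bc]) (simp add: z_def)
  moreover have "a 1 (\<lambda>_. 1) \<noteq> \<zero>\<^bsub>F\<^esub>" using const[of 1] T1[of "\<lambda>_. 1"] car m2 by auto
  moreover have "b 1 (\<lambda>_. 2) \<noteq> \<zero>\<^bsub>F\<^esub>" using const[of 2] T1[of "\<lambda>_. 2"] car m2 by auto
  ultimately have "?T z \<noteq> \<zero>\<^bsub>F\<^esub>" using T1[of z] car by (simp add: integral_iff)
  moreover obtain J j j' where J: "J \<in> P" "j \<in> J" "j \<in> A 1" "j' \<in> J" "j' \<notin> A 1" using A[of 1] by auto
  then have "grid_point d (\<lambda>_. m) z j \<noteq> grid_point d (\<lambda>_. m) z j'"
    using Pd[OF J(1,2)] Pd[OF J(1,4)] m2 by (simp add: grid_point_def z_def)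
  then have "\<not> (\<forall>J\<in>P. \<forall>i\<in>J. \<forall>j\<in>J. grid_point d (\<lambda>_. m) z i = grid_point d (\<lambda>_. m) z j)"
    using J by blast
  then have "?T z = \<zero>\<^bsub>F\<^esub>" unfolding diagonal_tensor_def by (rule if_not_P)
  ultimately show False by simp
qed

lemma diagonal_tensor_rank_pos:
  fixes F :: "'a ring"
  assumes F: "field F" and P: "partition_on {1..d} P" and m: "1 \<le> m"
  shows "\<not> rank_decomp F d (\<lambda>_. m) R 0 (diagonal_tensor F P)"
proof
  interpret field F by fact
  assume "rank_decomp F d (\<lambda>_. m) R 0 (diagonal_tensor F P)"
  moreover have x: "restrict (\<lambda>_. 1) {1..d} \<in> grid {1..d} (\<lambda>_. m)" using m by (auto simp: grid_def)
  ultimately have "diagonal_tensor F P (restrict (\<lambda>_. 1) {1..d}) = \<zero>\<^bsub>F\<^esub>"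
    unfolding rank_decomp_def by fastforce
  moreover have "\<forall>J\<in>P. \<forall>i\<in>J. \<forall>j\<in>J. restrict (\<lambda>_. 1::nat) {1..d} i = restrict (\<lambda>_. 1) {1..d} j"
  proof (intro ballI)
    fix J i j assume "J \<in> P" "i \<in> J" "j \<in> J"
    then have "i \<in> {1..d}" "j \<in> {1..d}" using partition_on_subset[OF P] by blast+
    then show "restrict (\<lambda>_. 1::nat) {1..d} i = restrict (\<lambda>_. 1) {1..d} j" by simp
  qed
  then have "diagonal_tensor F P (restrict (\<lambda>_. 1) {1..d}) = \<one>\<^bsub>F\<^esub>"
    unfolding diagonal_tensor_def by (rule if_P)
  ultimately show False by simp
qed

text \<open>By d + 1 \<le> 2^d the left side is at most 2^(1 + d(d-1)), whose exponent is at most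
  2^(d+1).\<close>

lemma exponent_bound:
  assumes "2 \<le> d" shows "2 * (d + 1) ^ (d - 1) \<le> (3::nat) ^ (2 ^ (d + 1))"
proof -
  have d2: "d + 1 \<le> 2 ^ d" by (metis Suc_eq_plus1 Suc_leI less_exp)
  have "1 + d * (d - 1) \<le> 2 ^ (d + 1)" using assms
  proof (induction d rule: nat_induct_at_least)
    case (Suc d)
    have "2 * d \<le> 2 ^ (d + 1)" using less_exp[of d] by simp
    moreover have "1 + Suc d * (Suc d - 1) = 1 + d * (d - 1) + 2 * d" using Suc(1) by (cases d) auto
    moreover have "(2::nat) ^ (Suc d + 1) = 2 ^ (d + 1) + 2 ^ (d + 1)" by simp
    ultimately show ?case using Suc.IH by linarith
  qed simp
  then have e: "1 + d * (d - 1) \<le> 2 ^ (d + 1)" .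
  have "2 * (d + 1) ^ (d - 1) \<le> 2 * (2 ^ d) ^ (d - 1)" using d2 by (intro mult_left_mono power_mono) auto
  also have "\<dots> = (2::nat) ^ (1 + d * (d - 1))" by (simp add: power_mult)
  also have "\<dots> \<le> 2 ^ (2 ^ (d + 1))" using e by (intro power_increasing) auto
  also have "\<dots> \<le> 3 ^ (2 ^ (d + 1))" by (intro power_mono) auto
  finally show ?thesis .
qed

text \<open>For k \<ge> 2 one has k + 1 \<le> k^2, so \<open>diagonal_tensor_rank_lower\<close>
  bounds m by a power of k with exponent 2(d+1)^(d-1), and \<open>exponent_bound\<close> compares
  this exponent with the inverse of \<open>rank_exponent d\<close>. Rank 0 and, for m > 1, rank 1
  are excluded beforehand.\<close>

lemma tensor_rank_diagonal_lower:
  fixes F :: "'a ring"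
  assumes F: "field F" and d: "2 \<le> d" and R: "partition_family d R" and P: "partition_on {1..d} P"
    and nref: "\<And>Q. Q \<in> R \<Longrightarrow> \<not> refines {1..d} P Q" and m: "1 \<le> m"
  shows "real m powr rank_exponent d \<le> real (tensor_rank F d (\<lambda>_. m) R (diagonal_tensor F P))"
proof -
  define k where "k = tensor_rank F d (\<lambda>_. m) R (diagonal_tensor F P)"
  have d1: "1 \<le> d" using d by simp
  have dec: "rank_decomp F d (\<lambda>_. m) R k (diagonal_tensor F P)"
    unfolding k_def
    by (rule iffD1[OF tensor_rank_le_iff[OF F d1 R diagonal_tensor_tensors[OF F]] order_refl])
  have k0: "k \<noteq> 0" using diagonal_tensor_rank_pos[OF F P m] dec by metis
  have "real m powr rank_exponent d \<le> real k"
  proof (cases "m = 1")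
    case True
    then show ?thesis using k0 by simp
  next
    case False
    then have "k \<noteq> 1" using diagonal_tensor_rank_one[OF F R P nref m] dec by metis
    then have k2: "2 \<le> k" using k0 by simp
    have "m < (k + 1) ^ ((d + 1) ^ (d - 1))" by (rule diagonal_tensor_rank_lower[OF F d1 R P nref m dec])
    also have "\<dots> \<le> (k ^ 2) ^ ((d + 1) ^ (d - 1))"
    proof (rule power_mono)
      have "k + 1 \<le> 2 * k" using k2 by simp
      also have "\<dots> \<le> k * k" using k2 by (rule mult_right_mono) simp
      finally show "k + 1 \<le> k ^ 2" by (simp add: power2_eq_square)
    qed simp
    also have "\<dots> = k ^ (2 * (d + 1) ^ (d - 1))" by (simp add: power_mult)
    also have "\<dots> \<le> k ^ (3 ^ (2 ^ (d + 1)))" using exponent_bound[OF d] k2 by (intro power_increasing) auto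
    finally have "real m \<le> real k ^ (3 ^ (2 ^ (d + 1)))" by (simp flip: of_nat_power)
    also have "\<dots> = real k powr real (3 ^ (2 ^ (d + 1)))" using k2 by (subst powr_realpow) auto
    finally have "real m powr rank_exponent d \<le> (real k powr real (3 ^ (2 ^ (d + 1)))) powr rank_exponent d"
      by (intro powr_mono2) (auto simp: rank_exponent_def)
    also have "\<dots> = real k powr (real (3 ^ (2 ^ (d + 1))) * rank_exponent d)" by (rule powr_powr)
    also have "real (3 ^ (2 ^ (d + 1))) * rank_exponent d = 1"
    proof -
      have "real (3 ^ (2 ^ (d + 1))) = 3 powr (2 ^ (d + 1))"
        using powr_realpow[of 3 "2 ^ (d + 1)"] by simp
      then show ?thesis unfolding rank_exponent_def by (simp add: powr_minus)
    qed
    also have "real k powr 1 = real k" using k2 by simp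
    finally show ?thesis .
  qed
  then show ?thesis by (simp only: k_def)
qed

text \<open>The factors along P combine to factors along the coarser Q, and rank 0 is impossible
  because the tensor is 1 at a constant point.\<close>

lemma tensor_rank_diagonal_eq_one:
  fixes F :: "'a ring"
  assumes F: "field F" and d: "1 \<le> d" and R: "partition_family d R" and P: "partition_on {1..d} P"
    and Q: "Q \<in> R" "refines {1..d} P Q" and m: "1 \<le> m"
  shows "tensor_rank F d (\<lambda>_. m) R (diagonal_tensor F P) = 1"
proof -
  let ?T = "diagonal_tensor F P"
  interpret field F by fact
  have T: "?T \<in> tensors F d (\<lambda>_. m)" by (rule diagonal_tensor_tensors[OF F])
  have "rank_le_one F d (\<lambda>_. m) {Q} ?T"
    by (rule rank_le_one_coarsen[OF F Q(2) diagonal_tensor_rank_le_one[OF F P]])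
  then have "rank_le_one F d (\<lambda>_. m) R ?T" using Q(1) by (auto simp: rank_le_one_def)
  moreover have "?T x = (\<Oplus>\<^bsub>F\<^esub>i\<in>{1..1::nat}. ?T x)" for x by (simp add: diagonal_tensor_def)
  ultimately have "rank_decomp F d (\<lambda>_. m) R 1 ?T"
    unfolding rank_decomp_def using T by (intro exI[of _ "\<lambda>_. ?T"]) blast
  then have "tensor_rank F d (\<lambda>_. m) R ?T \<le> 1" using tensor_rank_le_iff[OF F d R T] by blast
  moreover have "\<not> tensor_rank F d (\<lambda>_. m) R ?T \<le> 0"
    using tensor_rank_le_iff[OF F d R T] diagonal_tensor_rank_pos[OF F P m] by blast
  ultimately show ?thesis by simp
qed

theorem theorem1p10:
  fixes d h :: nat
    and Rs :: "nat \<Rightarrow> nat set set set"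
    and R :: "nat set set set"
  assumes "2 \<le> d" and "1 \<le> h"
    and "\<And>i. i \<in> {1..h} \<Longrightarrow> partition_family d (Rs i)"
    and "partition_family d R"
  shows "(\<not> family_finer d (family_meet h Rs) R \<longrightarrow>
           (\<forall>(F :: 'a ring) m :: nat. field F \<longrightarrow> 1 \<le> m \<longrightarrow>
              (\<exists>T\<in>tensors F d (\<lambda>_. m).
                 (\<forall>i\<in>{1..h}. tensor_rank F d (\<lambda>_. m) (Rs i) T = 1) \<and>
                 real (tensor_rank F d (\<lambda>_. m) R T) \<ge> real m powr rank_exponent d))) \<and>
         (family_finer d (family_meet h Rs) R \<longrightarrow>
           (\<forall>k :: nat \<Rightarrow> nat. (\<forall>i\<in>{1..h}. 1 \<le> k i) \<longrightarrow>
              (\<forall>(F :: 'a ring) n T. field F \<longrightarrow> (\<forall>j\<in>{1..d}. 1 \<le> n j) \<longrightarrow>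
                 T \<in> tensors F d n \<longrightarrow>
                 (\<forall>i\<in>{1..h}. tensor_rank F d n (Rs i) T \<le> k i) \<longrightarrow>
                 tensor_rank F d n R T \<le> rank_bound d h Rs k)))"
proof -
  have d: "1 \<le> d" using assms(1) by simp
  show ?thesis
  proof (intro conjI impI allI)
    fix F :: "'a ring" and m :: nat
    assume not_finer: "\<not> family_finer d (family_meet h Rs) R" and F: "field F" and m: "1 \<le> m"
    \<comment> \<open>A member of the meet that refines no member of R, given by one P i from each
      \<open>Rs i\<close>. It depends on neither the field nor m, so its diagonal tensor is the
      witness in all cases.\<close>
    obtain P where P: "\<And>i. i \<in> {1..h} \<Longrightarrow> P i \<in> Rs i"
      and nref: "\<And>Q. Q \<in> R \<Longrightarrow> \<not> refines {1..d} (common_refinement (P ` {1..h})) Q"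
      using not_finer unfolding family_finer_def family_meet_def by blast
    let ?P = "common_refinement (P ` {1..h})"
    have Pp: "partition_on {1..d} Q" if "Q \<in> P ` {1..h}" for Q
      using that P partition_familyD[OF assms(3)] by blast
    have part: "partition_on {1..d} ?P"
      using assms(2) by (intro partition_on_common_refinement Pp) auto
    have "tensor_rank F d (\<lambda>_. m) (Rs i) (diagonal_tensor F ?P) = 1" if i: "i \<in> {1..h}" for i
    proof (rule tensor_rank_diagonal_eq_one[OF F d assms(3)[OF i] part P[OF i] _ m])
      show "refines {1..d} ?P (P i)" using i by (intro refines_common_refinement Pp) auto
    qed
    moreover have "real m powr rank_exponent d \<le> real (tensor_rank F d (\<lambda>_. m) R (diagonal_tensor F ?P))"
      by (rule tensor_rank_diagonal_lower[OF F assms(1,4) part nref m])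
    ultimately show "\<exists>T\<in>tensors F d (\<lambda>_. m). (\<forall>i\<in>{1..h}. tensor_rank F d (\<lambda>_. m) (Rs i) T = 1) \<and>
        real (tensor_rank F d (\<lambda>_. m) R T) \<ge> real m powr rank_exponent d"
      using diagonal_tensor_tensors[OF F] by (intro bexI[of _ "diagonal_tensor F ?P"]) auto
  next
    fix k :: "nat \<Rightarrow> nat" and F :: "'a ring" and n T
    assume "family_finer d (family_meet h Rs) R" "field F" "\<forall>j\<in>{1..d}. 1 \<le> n j" "T \<in> tensors F d n"
      "\<forall>i\<in>{1..h}. tensor_rank F d n (Rs i) T \<le> k i"
    then show "tensor_rank F d n R T \<le> rank_bound d h Rs k"
      using tensor_rank_le_rank_bound[where Rs = Rs and R = R, OF d assms(2,3,4)] by blast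
  qed
qed

end
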